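(* Consider the billiard in the square $S=[-1/2,1/2]^2$ with one small obstacle $O$. If $u$ is a number from the interior of the admissible rotation set $AR$, then there exists a trajectory of admissible type with rotation number $u$.
   Context: Setting: $O\subset S$ is a compact convex set with nonempty interior and smooth boundary. It is small if it is contained in a closed ball of radius smaller than $\sqrt{2}/4$ centered at the origin. Billiard trajectories in $S\setminus\operatorname{int}O$ move with unit speed along straight lines and reflect from the sides of $S$ and from $\partial O$ with angle of incidence equal to angle of reflection; a trajectory reaching a vertex of $S$ returns along the same line. Time along a trajectory piece equals its length. A tangency to the obstacle is not counted as a reflection. "Trajectory" means positive (one-sided) trajectory. Unfolding: cover $\mathbb{R}^2$ by the squares $S+\mathbf{k}$, $\mathbf{k}\in\mathbb{Z}^2$, obtained from $S$ by consecutive reflections in the lines $x=n+1/2$, $y=n+1/2$, $n\in\mathbb{Z}$. For $\mathbf{k}=(p,q)$ the obstacle in $S+\mathbf{k}$ is $O_{\mathbf{k}}=\{(p+(-1)^p x,\,q+(-1)^q y):(x,y)\in O\}$. Trajectories in $S$ with obstacle $O$ unfold to billiard trajectories in $\mathbb{R}^2$ with obstacles $O_{\mathbf{k}}$. Admissibility: $O_{\mathbf{k}}$ is between $O_{\mathbf{i}}$ and $O_{\mathbf{j}}$ if $\mathbf{k}\ne\mathbf{i},\mathbf{j}$ and $O_{\mathbf{k}}$ intersects the convex hull of $O_{\mathbf{i}}\cup O_{\mathbf{j}}$. A (finite or infinite) sequence $(\mathbf{k}_n)_{n\ge 0}$ in $\mathbb{Z}^2$ is admissible if (1) $\mathbf{k}_0=\mathbf{0}$;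 (2) $\mathbf{k}_{n+1}\ne\mathbf{k}_n$ for every $n$; (3) for every $n$ there is no obstacle between $O_{\mathbf{k}_n}$ and $O_{\mathbf{k}_{n+1}}$; (4) for every $n$ the obstacle $O_{\mathbf{k}_{n+1}}$ is not between $O_{\mathbf{k}_n}$ and $O_{\mathbf{k}_{n+2}}$. A trajectory starting on $\partial O$ has type $(\mathbf{k}_n)_{n=0}^\infty$ if its unfolding starts on the boundary of $O_{\mathbf{k}_0}=O_{\mathbf{0}}$ and reflects consecutively from $O_{\mathbf{k}_1},O_{\mathbf{k}_2},\dots$; a trajectory piece starting and ending on $\partial O$ has type $(\mathbf{k}_n)_{n=0}^s$ if its unfolding starts on the boundary of $O_{\mathbf{k}_0}=O_{\mathbf{0}}$, reflects consecutively from $O_{\mathbf{k}_1},\dots,O_{\mathbf{k}_{s-1}}$ and ends on the boundary of $O_{\mathbf{k}_s}$. Displacement: fix a point $\mathbf{z}$ in the interior of $O$ and set $\phi(\mathbf{x})=\arg(\mathbf{x}-\mathbf{z})/(2\pi)$, identifying $\mathbb{R}^2$ with $\mathbb{C}$; the displacement along a trajectory piece in $S$ is the (continuous) increment of $\phi$ along it. The admissible rotation set $AR$ is the set of all limits of sequences $d_n/t_n$, where $d_n$ and $t_n$ are the displacement and the length of a trajectory piece of admissible type, and $t_n\to\infty$ (it does not depend on the choice of $\mathbf{z}$). The rotation number of a trajectory is the limit as $t\to\infty$ of (displacement during time $[0,t]$)$/t$, if it exists. *)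

theory Defs
  imports "HOL-Analysis.Analysis" "HOL-Library.Extended_Nat"
begin

text \<open>The plane is identified with the complex numbers throughout.\<close>

section \<open>The square and the obstacle\<close>

definition unit_square :: "complex set" where
  "unit_square = {p. \<bar>Re p\<bar> \<le> 1/2 \<and> \<bar>Im p\<bar> \<le> 1/2}"

text \<open>Smoothness of the boundary is taken in the weakest usual sense, class \<open>C\<^sup>1\<close>: the boundary is
  a simple closed regular \<open>C\<^sup>1\<close> curve, given by a parametrization of period 1.\<close>

definition smooth_boundary :: "complex set \<Rightarrow> bool" where
  "smooth_boundary K \<longleftrightarrow>
     (\<exists>(g :: real \<Rightarrow> complex) g'.
        (\<forall>t. (g has_vector_derivative g' t) (at t)) \<and> continuous_on UNIV g' \<and> (\<forall>t. g' t \<noteq> 0) \<and>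
        (\<forall>t. g (t + 1) = g t) \<and> inj_on g {0..<1} \<and> g ` {0..<1} = frontier K)"

definition obstacle :: "complex set \<Rightarrow> bool" where
  "obstacle K \<longleftrightarrow> K \<subseteq> unit_square \<and> compact K \<and> convex K \<and> interior K \<noteq> {} \<and> smooth_boundary K"

definition small :: "complex set \<Rightarrow> bool" where
  "small K \<longleftrightarrow> (\<exists>r < sqrt 2 / 4. K \<subseteq> cball 0 r)"

section \<open>Unfolding: squares and obstacles in the plane\<close>

definition place :: "int \<times> int \<Rightarrow> complex \<Rightarrow> complex" where
  "place k a = Complex (of_int (fst k) + (-1) powi fst k * Re a) (of_int (snd k) + (-1) powi snd k * Im a)"

definition obst :: "complex set \<Rightarrow> int \<times> int \<Rightarrow> complex set" where
  "obst K k = place k ` K"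

definition between :: "complex set \<Rightarrow> int \<times> int \<Rightarrow> int \<times> int \<Rightarrow> int \<times> int \<Rightarrow> bool" where
  "between K k i j \<longleftrightarrow> k \<noteq> i \<and> k \<noteq> j \<and> obst K k \<inter> convex hull (obst K i \<union> obst K j) \<noteq> {}"

text \<open>Only the terms of \<open>k\<close> with index at most \<open>N\<close> are considered; \<open>N = \<infinity>\<close> gives infinite sequences.\<close>

definition admissible :: "complex set \<Rightarrow> enat \<Rightarrow> (nat \<Rightarrow> int \<times> int) \<Rightarrow> bool" where
  "admissible K N k \<longleftrightarrow>
     k 0 = (0, 0) \<and>
     (\<forall>n. enat (Suc n) \<le> N \<longrightarrow> k (Suc n) \<noteq> k n) \<and>
     (\<forall>n. enat (Suc n) \<le> N \<longrightarrow> \<not> (\<exists>j. between K j (k n) (k (Suc n)))) \<and>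
     (\<forall>n. enat (Suc (Suc n)) \<le> N \<longrightarrow> \<not> between K (k (Suc n)) (k n) (k (Suc (Suc n))))"

section \<open>Billiard trajectories\<close>

text \<open>Near time \<open>t\<close> (within the time interval \<open>I\<close>) the curve \<open>c\<close> is straight with unit speed on either
  side, with velocity \<open>v\<close> before and \<open>w\<close> after \<open>t\<close>. At an endpoint of \<open>I\<close> the velocity on the missing
  side is an arbitrary unit vector.\<close>

definition velocities :: "real set \<Rightarrow> (real \<Rightarrow> complex) \<Rightarrow> real \<Rightarrow> complex \<Rightarrow> complex \<Rightarrow> bool" where
  "velocities I c t v w \<longleftrightarrow>
     norm v = 1 \<and> norm w = 1 \<and>
     (\<exists>\<epsilon>>0. \<forall>s\<in>{0..\<epsilon>}.
        (t - s \<in> I \<longrightarrow> c (t - s) = c t - s *\<^sub>R v) \<and>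
        (t + s \<in> I \<longrightarrow> c (t + s) = c t + s *\<^sub>R w))"

text \<open>For a convex set with smooth boundary and \<open>p\<close> on the boundary, such \<open>n\<close> is unique.\<close>

definition outer_unit_normal :: "complex set \<Rightarrow> complex \<Rightarrow> complex \<Rightarrow> bool" where
  "outer_unit_normal K p n \<longleftrightarrow> norm n = 1 \<and> (\<forall>y\<in>K. n \<bullet> (y - p) \<le> 0)"

definition reflect :: "complex \<Rightarrow> complex \<Rightarrow> complex" where
  "reflect n v = v - (2 * (v \<bullet> n)) *\<^sub>R n"

definition billiard_path ::
    "complex set \<Rightarrow> (complex \<Rightarrow> complex \<Rightarrow> complex \<Rightarrow> bool) \<Rightarrow> real set \<Rightarrow> (real \<Rightarrow> complex) \<Rightarrow> bool" where
  "billiard_path table law I c \<longleftrightarrow>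
     (\<forall>t\<in>I. c t \<in> table \<and> (\<exists>v w. velocities I c t v w \<and> law (c t) v w))"

text \<open>At a vertex both components of the velocity change sign, so the trajectory returns along the
  same line. In the interior of the table the law says \<open>w = v\<close>, and so does it at a tangency.\<close>

definition square_law :: "complex set \<Rightarrow> complex \<Rightarrow> complex \<Rightarrow> complex \<Rightarrow> bool" where
  "square_law K p v w \<longleftrightarrow>
     (if p \<in> frontier K then \<exists>n. outer_unit_normal K p n \<and> w = reflect n v
      else w = Complex (if \<bar>Re p\<bar> = 1/2 then - Re v else Re v)
                       (if \<bar>Im p\<bar> = 1/2 then - Im v else Im v))"

definition square_trajectory :: "complex set \<Rightarrow> real set \<Rightarrow> (real \<Rightarrow> complex) \<Rightarrow> bool" where
  "square_trajectory K = billiard_path (unit_square - interior K) (square_law K)"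

definition plane_law :: "complex set \<Rightarrow> complex \<Rightarrow> complex \<Rightarrow> complex \<Rightarrow> bool" where
  "plane_law K p v w \<longleftrightarrow>
     (if \<exists>k. p \<in> frontier (obst K k)
      then \<exists>k n. p \<in> frontier (obst K k) \<and> outer_unit_normal (obst K k) p n \<and> w = reflect n v
      else w = v)"

definition plane_trajectory :: "complex set \<Rightarrow> real set \<Rightarrow> (real \<Rightarrow> complex) \<Rightarrow> bool" where
  "plane_trajectory K = billiard_path (- (\<Union>k. interior (obst K k))) (plane_law K)"

definition unfolding_of :: "complex set \<Rightarrow> real set \<Rightarrow> (real \<Rightarrow> complex) \<Rightarrow> (real \<Rightarrow> complex) \<Rightarrow> bool" where
  "unfolding_of K I c \<Gamma> \<longleftrightarrow> plane_trajectory K I \<Gamma> \<and> (\<forall>t\<in>I. \<exists>k. \<Gamma> t = place k (c t))"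

section \<open>Types\<close>

text \<open>In the plane the velocity can only change on the boundary of an obstacle, and it does not
  change at a tangency.\<close>

definition reflects_at :: "real set \<Rightarrow> (real \<Rightarrow> complex) \<Rightarrow> real \<Rightarrow> bool" where
  "reflects_at I \<Gamma> t \<longleftrightarrow> (\<exists>v w. velocities I \<Gamma> t v w \<and> v \<noteq> w)"

text \<open>The times \<open>\<tau> 1 < \<tau> 2 < \<dots>\<close> are exactly the times of reflections, so that no further
  reflections occur.\<close>

definition trajectory_of_type :: "complex set \<Rightarrow> (nat \<Rightarrow> int \<times> int) \<Rightarrow> (real \<Rightarrow> complex) \<Rightarrow> bool" where
  "trajectory_of_type K k c \<longleftrightarrow>
     square_trajectory K {0..} c \<and> k 0 = (0, 0) \<and>
     (\<exists>\<Gamma> \<tau>. unfolding_of K {0..} c \<Gamma> \<and>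
        strict_mono \<tau> \<and> \<tau> 0 = 0 \<and>
        (\<forall>n. \<Gamma> (\<tau> n) \<in> frontier (obst K (k n))) \<and>
        {t. 0 < t \<and> reflects_at {0..} \<Gamma> t} = \<tau> ` {1..})"

text \<open>A trajectory piece is parametrized by \<open>{0..T}\<close>; its length is \<open>T\<close> as the speed is 1.\<close>

definition piece_of_type ::
    "complex set \<Rightarrow> nat \<Rightarrow> (nat \<Rightarrow> int \<times> int) \<Rightarrow> real \<Rightarrow> (real \<Rightarrow> complex) \<Rightarrow> bool" where
  "piece_of_type K s k T c \<longleftrightarrow>
     square_trajectory K {0..T} c \<and> k 0 = (0, 0) \<and>
     (\<exists>\<Gamma> \<tau>. unfolding_of K {0..T} c \<Gamma> \<and>
        strict_mono_on {0..s} \<tau> \<and> \<tau> 0 = 0 \<and> \<tau> s = T \<and>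
        (\<forall>n\<le>s. \<Gamma> (\<tau> n) \<in> frontier (obst K (k n))) \<and>
        {t. 0 < t \<and> t < T \<and> reflects_at {0..T} \<Gamma> t} = \<tau> ` {1..<s})"

section \<open>Displacement and rotation\<close>

text \<open>\<open>d\<close> is the increment over \<open>{0..T}\<close> of a continuous branch \<open>\<theta>\<close> of \<open>arg (c t - z) / (2\<pi>)\<close>.\<close>

definition has_displacement :: "complex \<Rightarrow> (real \<Rightarrow> complex) \<Rightarrow> real \<Rightarrow> real \<Rightarrow> bool" where
  "has_displacement z c T d \<longleftrightarrow>
     (\<exists>\<theta>. continuous_on {0..T} \<theta> \<and> (\<forall>t\<in>{0..T}. is_Arg (c t - z) (2 * pi * \<theta> t)) \<and>
          d = \<theta> T - \<theta> 0)"

definition has_rotation_number :: "complex \<Rightarrow> (real \<Rightarrow> complex) \<Rightarrow> real \<Rightarrow> bool" where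
  "has_rotation_number z c u \<longleftrightarrow>
     (\<exists>d. (\<forall>T\<ge>0. has_displacement z c T (d T)) \<and> ((\<lambda>T. d T / T) \<longlongrightarrow> u) at_top)"

definition admissible_rotation_set :: "complex set \<Rightarrow> complex \<Rightarrow> real set" where
  "admissible_rotation_set K z =
     {u. \<exists>(d :: nat \<Rightarrow> real) T.
           (\<forall>n. \<exists>s k c. admissible K (enat s) k \<and> piece_of_type K s k (T n) c \<and>
                        has_displacement z c (T n) (d n)) \<and>
           filterlim T at_top sequentially \<and> (\<lambda>n. d n / T n) \<longlonglongrightarrow> u}"

end

theory Submission
  imports Defs
begin

text \<open>
  The displacement \<open>d\<close> and the length \<open>T\<close> of a trajectory piece are determined by its admissible type
  up to an error that does not depend on the number of reflections. Consider the defect \<open>d - u * T\<close>. If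
  \<open>u\<close> is an interior point of the admissible rotation set, there are admissible types with large
  negative and with large positive defect. These types are concatenated to an infinite admissible type,
  using the negative one whenever the defect so far is nonnegative and the positive one otherwise.
  Then the defect remains bounded along a trajectory of this type, and the rotation number is \<open>u\<close>.

  Lengths. Unfolded, a piece is a broken line whose vertices lie in convex obstacles, and the law of
  reflection says that its length is stationary. Length being convex, a stationary broken line is
  shortest up to the freedom of its end points (\<open>chain_length_le\<close>). Minimization and compactness
  produce in turn a broken line in equilibrium for each infinite admissible type
  (\<open>equilibrium_exists\<close>). Admissibility makes it an unfolded trajectory: the segments miss the other
  obstacles, and every vertex is a proper reflection.

  Displacements. Two pieces of the same type cannot be compared by a straight homotopy, because this may
  cross the obstacles. Instead, admissibility gives at each vertex a line that separates the obstacle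
  from its two neighbours. Behind this line the plane is cut along a ray that starts at the copy of \<open>z\<close>
  in the obstacle; by the law of reflection no piece of this type crosses the cut (\<open>critical_ray\<close>). The
  displacement along a segment is then a constant of the type plus the difference of two angles, one
  at each end, each measured from the corresponding cut (\<open>segment_displacement_formula\<close>). The cut at
  a vertex serves both adjacent segments, and so the angles telescope
  (\<open>chain_disp_compare\<close>). The few segments without cuts at both ends contribute a bounded amount
  since admissible steps are bounded (\<open>bounded_steps\<close>).

  Concatenation. For a small obstacle, two consecutive steps satisfy the last condition of admissibility
  whenever they turn by at least 90 degrees, and unit steps are always possible
  (\<open>not_between_obtuse\<close>, \<open>not_between_unit_step\<close>). So a unit step in front and another one behind turn each admissible word into
  a block, and blocks can be concatenated freely (\<open>block_append\<close>).
\<close>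

section \<open>Reflected squares\<close>

definition sg :: "int \<Rightarrow> int" where
  "sg p = (if even p then 1 else -1)"

text \<open>The unfolding maps form a group, and \<open>k \<odot> l\<close> is its multiplication in
  terms of squares: it is the square reached from \<open>k\<close> by the step that leads from the origin to \<open>l\<close>
  when seen in the mirrored coordinates of \<open>k\<close>. In these local coordinates a sequence of squares can
  be cut and glued without keeping track of parities.\<close>

definition sq_mult :: "int \<times> int \<Rightarrow> int \<times> int \<Rightarrow> int \<times> int" (infixl "\<odot>" 70) where
  "k \<odot> l = (fst k + sg (fst k) * fst l, snd k + sg (snd k) * snd l)"

definition sq_inv :: "int \<times> int \<Rightarrow> int \<times> int" where
  "sq_inv k = (- sg (fst k) * fst k, - sg (snd k) * snd k)"

definition centre :: "int \<times> int \<Rightarrow> complex" where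
  "centre k = Complex (of_int (fst k)) (of_int (snd k))"

text \<open>The linear part of \<open>place k\<close>, an isometric involution.\<close>

definition lin :: "int \<times> int \<Rightarrow> complex \<Rightarrow> complex" where
  "lin k w = Complex (of_int (sg (fst k)) * Re w) (of_int (sg (snd k)) * Im w)"

lemma place_alt: "place k a = centre k + lin k a"
  by (simp add: place_def centre_def lin_def sg_def complex_eq_iff power_int_minus_left)

lemma sg_sq [simp]: "sg p * sg p = 1" "(of_int (sg p) :: real) * of_int (sg p) = 1"
  by (auto simp: sg_def)

lemma sg_cases: "sg p = 1 \<or> sg p = -1"
  by (auto simp: sg_def)

lemma sg_uminus [simp]: "sg (- p) = sg p"
  by (simp add: sg_def)

lemma sg_add_mult [simp]: "sg (p + sg p * q) = sg p * sg q" "sg (p + q * sg p) = sg p * sg q"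
  by (auto simp: sg_def)

lemma sg_mult_self [simp]: "sg (sg p * q) = sg q"
  by (auto simp: sg_def)

lemma lin_add: "lin k (a + b) = lin k a + lin k b"
  by (simp add: lin_def complex_eq_iff algebra_simps)

lemma lin_diff: "lin k (a - b) = lin k a - lin k b"
  by (simp add: lin_def complex_eq_iff algebra_simps)

lemma lin_minus: "lin k (- a) = - lin k a"
  by (simp add: lin_def complex_eq_iff)

lemma lin_scaleR: "lin k (c *\<^sub>R a) = c *\<^sub>R lin k a"
  by (simp add: lin_def complex_eq_iff)

lemma inner_lin [simp]: "lin k a \<bullet> lin k b = a \<bullet> b"
  using sg_cases[of "fst k"] sg_cases[of "snd k"] by (auto simp: lin_def inner_complex_def)

lemma norm_lin [simp]: "norm (lin k a) = norm a"
  by (simp add: norm_eq_sqrt_inner)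

lemma lin_lin [simp]: "lin k (lin k a) = a"
  using sg_cases[of "fst k"] sg_cases[of "snd k"] by (auto simp: lin_def complex_eq_iff)

lemma lin_0 [simp]: "lin k 0 = 0"
  by (simp add: lin_def complex_eq_iff)

lemma lin_eq_0_iff [simp]: "lin k a = 0 \<longleftrightarrow> a = 0"
  by (metis lin_0 lin_lin)

lemma lin_sgn: "lin k (sgn a) = sgn (lin k a)"
  by (simp add: sgn_div_norm lin_scaleR)

lemma linear_lin: "linear (lin k)"
  by (intro linearI) (simp_all add: lin_add lin_scaleR)

lemma continuous_on_lin [continuous_intros]: "continuous_on S f \<Longrightarrow> continuous_on S (\<lambda>x. lin k (f x))"
  unfolding lin_def by (intro continuous_on_Complex continuous_intros)

lemma place_mult: "place (k \<odot> l) a = place k (place l a)"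
  by (simp add: place_alt centre_def lin_def sq_mult_def complex_eq_iff algebra_simps)

lemma place_origin [simp]: "place (0, 0) a = a"
  by (simp add: place_def complex_eq_iff)

lemma sq_mult_assoc: "k \<odot> l \<odot> m = k \<odot> (l \<odot> m)"
  by (simp add: sq_mult_def algebra_simps)

lemma sq_mult_origin [simp]: "(0, 0) \<odot> k = k" "k \<odot> (0, 0) = k"
  by (simp_all add: sq_mult_def sg_def)

lemma sg_sg_mult [simp]: "sg p * (sg p * q) = q"
  by (simp add: mult.assoc[symmetric])

lemma sq_mult_inv [simp]: "k \<odot> sq_inv k = (0, 0)" "sq_inv k \<odot> k = (0, 0)"
  by (simp_all add: sq_mult_def sq_inv_def)

lemma sq_mult_inv_cancel [simp]: "sq_inv k \<odot> (k \<odot> l) = l" "k \<odot> (sq_inv k \<odot> l) = l"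
  by (simp_all add: sq_mult_assoc[symmetric])

lemma sq_mult_left_cancel [simp]: "k \<odot> l = k \<odot> m \<longleftrightarrow> l = m"
  by (metis sq_mult_inv_cancel(1))

lemma place_inv [simp]: "place (sq_inv k) (place k a) = a" "place k (place (sq_inv k) a) = a"
  by (simp_all add: place_mult[symmetric])

lemma place_diff: "place k a - place k b = lin k (a - b)"
  by (simp add: place_alt lin_diff)

lemma inj_place: "inj (place k)"
  by (metis injI place_inv(1))

lemma place_eq_iff [simp]: "place k a = place k b \<longleftrightarrow> a = b"
  by (metis place_inv(1))

lemma dist_place [simp]: "dist (place k a) (place k b) = dist a b"
  by (simp add: dist_norm place_diff)

lemma place_image_comp: "place g ` obst K k = obst K (g \<odot> k)"
  by (simp add: obst_def image_image place_mult)

lemma place_linepath: "place g (linepath a b t) = linepath (place g a) (place g b) t"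
  by (simp add: linepath_def place_alt lin_add lin_diff lin_scaleR algebra_simps)

lemma continuous_on_place [continuous_intros]: "continuous_on S f \<Longrightarrow> continuous_on S (\<lambda>x. place k (f x))"
  unfolding place_alt by (intro continuous_intros)

lemma place_image_eq: "place k ` X = (+) (centre k) ` lin k ` X"
  by (simp add: image_image place_alt)

lemma place_convex_hull: "place g ` (convex hull X) = convex hull (place g ` X)"
  by (simp add: place_image_eq convex_hull_translation convex_hull_linear_image linear_lin)

lemma place_closed_segment: "place g ` closed_segment a b = closed_segment (place g a) (place g b)"
  using place_convex_hull[of g "{a, b}"] by (simp add: segment_convex_hull)

lemma interior_place: "interior (place k ` X) = place k ` interior X"
proof -
  have "inj (lin k)" by (metis injI lin_lin)
  then show ?thesis
    by (simp add: place_image_eq interior_translation interior_injective_linear_image linear_lin)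
qed

lemma closure_place: "closure (place k ` X) = place k ` closure X"
proof -
  have "inj (lin k)" by (metis injI lin_lin)
  then show ?thesis
    by (simp add: place_image_eq closure_translation closure_injective_linear_image linear_lin)
qed

lemma frontier_place: "frontier (place k ` X) = place k ` frontier X"
  by (simp add: frontier_def closure_place interior_place image_set_diff[OF inj_place])

lemma between_place: "between K (g \<odot> k) (g \<odot> i) (g \<odot> j) \<longleftrightarrow> between K k i j"
proof -
  have "obst K (g \<odot> k) \<inter> convex hull (obst K (g \<odot> i) \<union> obst K (g \<odot> j))
      = place g ` (obst K k \<inter> convex hull (obst K i \<union> obst K j))"
    by (simp add: place_image_comp[symmetric] image_Un[symmetric] place_convex_hull[symmetric] image_Int inj_place)
  then show ?thesis by (simp add: between_def)
qed

section \<open>Folding the plane onto the square\<close>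

text \<open>The composition of sine and arcsine is the zigzag function, which folds the line onto
  \<open>[-1/2, 1/2]\<close>; in this form its continuity and its symmetries are immediate.\<close>

definition wrap1 :: "real \<Rightarrow> real" where
  "wrap1 x = arcsin (sin (pi * x)) / pi"

lemma sin_sg: "sin (of_int (sg n) * x) = of_int (sg n) * sin x"
  using sg_cases[of n] by auto

lemma cos_pi_int: "cos (pi * of_int n) = of_int (sg n)"
  by (simp add: sg_def)

lemma wrap1_reflect: "wrap1 (of_int n + of_int (sg n) * x) = wrap1 x"
proof -
  have "sin (pi * (of_int n + of_int (sg n) * x)) = sin (pi * of_int n + of_int (sg n) * (pi * x))"
    by (simp add: algebra_simps)
  also have "\<dots> = sin (pi * x)"
    unfolding sin_add sin_sg using sg_cases[of n] by (auto simp: cos_pi_int simp del: cos_npi_int)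
  finally show ?thesis by (simp add: wrap1_def)
qed

lemma wrap1_id: "\<bar>x\<bar> \<le> 1/2 \<Longrightarrow> wrap1 x = x"
proof -
  assume "\<bar>x\<bar> \<le> 1/2"
  then have "- (pi * (1/2)) \<le> pi * x" "pi * x \<le> pi * (1/2)"
    using mult_left_mono[of "-(1/2)" x pi] mult_left_mono[of x "1/2" pi] by auto
  then show ?thesis by (simp add: wrap1_def arcsin_sin)
qed

lemma wrap1_bound: "\<bar>wrap1 x\<bar> \<le> 1/2"
proof -
  have "\<bar>arcsin (sin (pi * x))\<bar> \<le> pi / 2"
    using arcsin_bounded[of "sin (pi * x)"] by auto
  then show ?thesis by (simp add: wrap1_def divide_le_eq)
qed

lemma wrap1_preimage: obtains n where "x = of_int n + of_int (sg n) * wrap1 x"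
proof -
  define n where "n = round x"
  define a where "a = of_int (sg n) * (x - of_int n)"
  have x: "x = of_int n + of_int (sg n) * a"
    using sg_cases[of n] by (auto simp: a_def)
  have "\<bar>a\<bar> \<le> 1/2"
    using of_int_round_abs_le[of x] sg_cases[of n] by (auto simp: a_def n_def abs_minus_commute)
  then have "wrap1 x = a" using wrap1_reflect[of n a] wrap1_id[of a] x by simp
  then show thesis using x that by blast
qed

lemma continuous_on_wrap1 [continuous_intros]:
  "continuous_on S (f :: 'a::t2_space \<Rightarrow> _) \<Longrightarrow> continuous_on S (\<lambda>x. wrap1 (f x))"
  unfolding wrap1_def
  by (intro continuous_on_divide continuous_on_arcsin continuous_on_sin continuous_on_mult continuous_on_const) auto

lemma wrap1_dist: "\<bar>wrap1 x - wrap1 y\<bar> \<le> \<bar>x - y\<bar>"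
proof -
  obtain n where n: "x = of_int n + of_int (sg n) * wrap1 x" by (rule wrap1_preimage)
  define a where "a = wrap1 x"
  define y' where "y' = of_int (sg n) * (y - of_int n)"
  have "y = of_int n + of_int (sg n) * y'"
    using sg_cases[of n] by (auto simp: y'_def)
  then have wy: "wrap1 y = wrap1 y'" using wrap1_reflect by metis
  have xy: "\<bar>x - y\<bar> = \<bar>a - y'\<bar>"
    using sg_cases[of n] n[folded a_def] by (auto simp: y'_def)
  obtain m where m: "y' = of_int m + of_int (sg m) * wrap1 y'" by (rule wrap1_preimage)
  define b where "b = wrap1 y'"
  have a: "\<bar>a\<bar> \<le> 1/2" and b: "\<bar>b\<bar> \<le> 1/2" unfolding a_def b_def by (rule wrap1_bound)+
  consider "m = 0" | "m = 1" | "m = -1" | "\<bar>m\<bar> \<ge> 2" by linarith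
  then have "\<bar>a - b\<bar> \<le> \<bar>a - y'\<bar>"
  proof cases
    case 4
    then have "\<bar>real_of_int m\<bar> \<ge> 2" by linarith
    then show ?thesis using m[folded b_def] a b sg_cases[of m] by auto
  qed (use m[folded b_def] a b in \<open>auto simp: sg_def\<close>)
  then show ?thesis using wy xy a_def b_def by simp
qed

text \<open>At an interior point of the interval the fold is a translation near the point, and at an
  endpoint a moving point turns back. The velocities \<open>v\<close> before and \<open>w\<close> after may differ, so that
  reflections from obstacles are covered as well as those from the sides of the square.\<close>

lemma wrap1_local_centered:
  assumes "\<bar>a\<bar> \<le> 1/2"
  shows "\<exists>v' w'. \<bar>v'\<bar> = \<bar>v\<bar> \<and> \<bar>w'\<bar> = \<bar>w\<bar> \<and> (v = w \<longrightarrow> w' = (if \<bar>a\<bar> = 1/2 then - v' else v')) \<and>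
     (\<bar>a\<bar> < 1/2 \<longrightarrow> v' = v \<and> w' = w) \<and>
     (\<exists>\<epsilon>>0. \<forall>s\<in>{0..\<epsilon>}. wrap1 (a - s * v) = a - s * v' \<and> wrap1 (a + s * w) = a + s * w')"
proof (cases "\<bar>a\<bar> < 1/2")
  case True
  define \<epsilon> where "\<epsilon> = (1/2 - \<bar>a\<bar>) / (1 + \<bar>v\<bar> + \<bar>w\<bar>)"
  have pos: "\<epsilon> > 0" using True by (auto simp: \<epsilon>_def intro!: divide_pos_pos)
  have "wrap1 (a - s * v) = a - s * v \<and> wrap1 (a + s * w) = a + s * w" if "s \<in> {0..\<epsilon>}" for s
  proof -
    have "s * (1 + \<bar>v\<bar> + \<bar>w\<bar>) \<le> 1/2 - \<bar>a\<bar>" using that by (simp add: \<epsilon>_def field_simps)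
    moreover have "\<bar>s * v\<bar> = s * \<bar>v\<bar>" "\<bar>s * w\<bar> = s * \<bar>w\<bar>" "0 \<le> s * \<bar>v\<bar>" "0 \<le> s * \<bar>w\<bar>"
      using that by (auto simp: abs_mult)
    ultimately show ?thesis using that
      by (intro conjI wrap1_id) (auto simp: distrib_left abs_if split: if_splits)
  qed
  then show ?thesis using True pos by (intro exI[of _ v] exI[of _ w]) auto
next
  case False
  define \<sigma> :: real where "\<sigma> = sgn a"
  have \<sigma>: "\<sigma> = 1 \<or> \<sigma> = -1" and a: "a = \<sigma> / 2" using False assms by (auto simp: \<sigma>_def sgn_if)
  have w: "wrap1 (a + u) = a - \<sigma> * \<bar>u\<bar>" if "\<bar>u\<bar> \<le> 1" for u
  proof (cases "\<sigma> * u \<le> 0")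
    case True
    from \<sigma> have "\<bar>a + u\<bar> \<le> 1/2"
    proof
      assume "\<sigma> = 1"
      then show ?thesis using a that True unfolding abs_le_iff by simp
    next
      assume "\<sigma> = -1"
      then show ?thesis using a that True unfolding abs_le_iff by simp
    qed
    then show ?thesis using \<sigma> True by (auto simp: wrap1_id)
  next
    case False
    have "a + u = of_int (if \<sigma> = 1 then 1 else -1) + of_int (sg (if \<sigma> = 1 then 1 else -1)) * (a - u)"
      using \<sigma> a by (auto simp: sg_def)
    then have "wrap1 (a + u) = wrap1 (a - u)" by (metis wrap1_reflect)
    moreover from \<sigma> have "\<bar>a - u\<bar> \<le> 1/2"
    proof
      assume "\<sigma> = 1"
      then show ?thesis using a that False unfolding abs_le_iff by simp
    next
      assume "\<sigma> = -1"
      then show ?thesis using a that False unfolding abs_le_iff by simp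
    qed
    ultimately show ?thesis using \<sigma> False by (auto simp: wrap1_id)
  qed
  define \<epsilon> where "\<epsilon> = 1 / (1 + \<bar>v\<bar> + \<bar>w\<bar>)"
  have pos: "\<epsilon> > 0" by (auto simp: \<epsilon>_def intro!: divide_pos_pos)
  have "wrap1 (a - s * v) = a - s * (\<sigma> * \<bar>v\<bar>) \<and> wrap1 (a + s * w) = a + s * (- \<sigma> * \<bar>w\<bar>)" if "s \<in> {0..\<epsilon>}" for s
  proof -
    have s: "s * (1 + \<bar>v\<bar> + \<bar>w\<bar>) \<le> 1" using that by (simp add: \<epsilon>_def field_simps)
    have e: "\<bar>s * v\<bar> = s * \<bar>v\<bar>" "\<bar>s * w\<bar> = s * \<bar>w\<bar>" "0 \<le> s * \<bar>v\<bar>" "0 \<le> s * \<bar>w\<bar>"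
      using that by (auto simp: abs_mult)
    then have "\<bar>- (s * v)\<bar> \<le> 1" "\<bar>s * w\<bar> \<le> 1" using s that by (auto simp: distrib_left)
    then show ?thesis using w[of "- (s * v)"] w[of "s * w"] e by (simp add: mult.left_commute)
  qed
  moreover have "\<bar>a\<bar> = 1/2" using \<sigma> a by auto
  ultimately show ?thesis using \<sigma> pos False
    by (intro exI[of _ "\<sigma> * \<bar>v\<bar>"] exI[of _ "- \<sigma> * \<bar>w\<bar>"]) (auto simp: abs_mult)
qed

lemma wrap1_local:
  assumes x: "x = of_int n + of_int (sg n) * wrap1 x"
  shows "\<exists>v' w'. \<bar>v'\<bar> = \<bar>v\<bar> \<and> \<bar>w'\<bar> = \<bar>w\<bar> \<and> (v = w \<longrightarrow> w' = (if \<bar>wrap1 x\<bar> = 1/2 then - v' else v')) \<and>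
     (\<bar>wrap1 x\<bar> < 1/2 \<longrightarrow> v' = of_int (sg n) * v \<and> w' = of_int (sg n) * w) \<and>
     (\<exists>\<epsilon>>0. \<forall>s\<in>{0..\<epsilon>}. wrap1 (x - s * v) = wrap1 x - s * v' \<and> wrap1 (x + s * w) = wrap1 x + s * w')"
proof -
  define a where "a = wrap1 x"
  have "x - s * v = of_int n + of_int (sg n) * (a - s * (of_int (sg n) * v))" for s
    using x[folded a_def] sg_cases[of n] by auto
  then have 1: "wrap1 (x - s * v) = wrap1 (a - s * (of_int (sg n) * v))" for s
    by (metis wrap1_reflect)
  have "x + s * w = of_int n + of_int (sg n) * (a + s * (of_int (sg n) * w))" for s
    using x[folded a_def] sg_cases[of n] by auto
  then have 2: "wrap1 (x + s * w) = wrap1 (a + s * (of_int (sg n) * w))" for s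
    by (metis wrap1_reflect)
  have "\<bar>a\<bar> \<le> 1/2" unfolding a_def by (rule wrap1_bound)
  from wrap1_local_centered[OF this, of "of_int (sg n) * v" "of_int (sg n) * w"]
  obtain v' w' where vw: "\<bar>v'\<bar> = \<bar>of_int (sg n) * v\<bar>" "\<bar>w'\<bar> = \<bar>of_int (sg n) * w\<bar>"
    "of_int (sg n) * v = of_int (sg n) * w \<longrightarrow> w' = (if \<bar>a\<bar> = 1/2 then - v' else v')"
    "\<bar>a\<bar> < 1/2 \<longrightarrow> v' = of_int (sg n) * v \<and> w' = of_int (sg n) * w"
    "\<exists>\<epsilon>>0. \<forall>s\<in>{0..\<epsilon>}. wrap1 (a - s * (of_int (sg n) * v)) = a - s * v' \<and>
      wrap1 (a + s * (of_int (sg n) * w)) = a + s * w'"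
    by blast
  moreover have "\<bar>of_int (sg n) * y\<bar> = \<bar>y\<bar>" for y :: real
    using sg_cases[of n] by auto
  ultimately show ?thesis
    unfolding 1 2 a_def[symmetric] by (intro exI[of _ v'] exI[of _ w']) simp
qed

text \<open>The left inverse of all unfolding maps: a curve in the square is recovered from its
  unfolding by \<open>wrap\<close>.\<close>

definition wrap :: "complex \<Rightarrow> complex" where
  "wrap x = Complex (wrap1 (Re x)) (wrap1 (Im x))"

lemma wrap_place [simp]: "wrap (place k a) = wrap a"
  by (simp add: wrap_def place_alt centre_def lin_def wrap1_reflect)

lemma wrap_id: "a \<in> unit_square \<Longrightarrow> wrap a = a"
  by (simp add: wrap_def unit_square_def wrap1_id)

lemma wrap_in_square: "wrap x \<in> unit_square"
  using wrap1_bound[of "Re x"] wrap1_bound[of "Im x"] by (simp add: wrap_def unit_square_def)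

lemma wrap_preimage: obtains k where "x = place k (wrap x)"
proof -
  obtain n m where "Re x = of_int n + of_int (sg n) * wrap1 (Re x)"
    "Im x = of_int m + of_int (sg m) * wrap1 (Im x)"
    by (metis wrap1_preimage)
  then have "x = place (n, m) (wrap x)"
    by (simp add: place_alt centre_def lin_def wrap_def complex_eq_iff)
  then show thesis by (rule that)
qed

lemma continuous_on_wrap [continuous_intros]:
  "continuous_on S (f :: 'a::t2_space \<Rightarrow> _) \<Longrightarrow> continuous_on S (\<lambda>x. wrap (f x))"
  unfolding wrap_def by (intro continuous_on_Complex continuous_intros)

lemma wrap_dist: "dist (wrap x) (wrap y) \<le> dist x y"
proof -
  have "(Re (wrap x) - Re (wrap y))\<^sup>2 \<le> (Re x - Re y)\<^sup>2" "(Im (wrap x) - Im (wrap y))\<^sup>2 \<le> (Im x - Im y)\<^sup>2"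
    using wrap1_dist by (auto simp: wrap_def abs_le_square_iff)
  then show ?thesis unfolding dist_norm cmod_def by (intro real_sqrt_le_mono) (simp add: add_mono)
qed

section \<open>Angle functions along curves\<close>

lemma continuous_Ints_imp_const:
  fixes f :: "'a::topological_space \<Rightarrow> real"
  assumes "connected S" "continuous_on S f" "\<And>x. x \<in> S \<Longrightarrow> f x \<in> \<int>" "x \<in> S" "y \<in> S"
  shows "f x = f y"
proof -
  have "1 \<le> norm (f y - f x)" if "x \<in> S" "y \<in> S" "f y \<noteq> f x" for x y
  proof -
    have "f y - f x \<in> \<int>" using assms(3) that by (intro Ints_diff) auto
    then obtain m where m: "f y - f x = of_int m" by (auto elim: Ints_cases)
    then have "m \<noteq> 0" using that by auto
    then show ?thesis by (simp add: m)
  qed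
  then have "f constant_on S"
    by (intro continuous_discrete_range_constant[OF assms(1,2)]) (metis zero_less_one)
  then show ?thesis using assms(4,5) by (auto simp: constant_on_def)
qed

lemma is_Arg_mult: "is_Arg v a \<Longrightarrow> is_Arg w b \<Longrightarrow> is_Arg (v * w) (a + b)"
  unfolding is_Arg_def norm_mult of_real_mult of_real_add distrib_left exp_add
  by (metis mult.assoc mult.left_commute)

lemma is_Arg_unique_mod:
  assumes "is_Arg w (2 * pi * a)" "is_Arg w (2 * pi * b)" "w \<noteq> 0"
  shows "a - b \<in> \<int>"
proof -
  have "exp (\<i> * of_real (2 * pi * a)) = exp (\<i> * of_real (2 * pi * b))"
    using assms unfolding is_Arg_def by (metis mult_left_cancel norm_eq_zero of_real_eq_0_iff)
  then obtain n :: int where "\<i> * of_real (2 * pi * a) = \<i> * of_real (2 * pi * b) + (of_int (2 * n) * pi) * \<i>"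
    unfolding exp_eq by blast
  then have "2 * pi * a = 2 * pi * b + of_int (2 * n) * pi"
    by (metis (no_types, lifting) Im_i_times Re_complex_of_real complex_i_mult_minus mult.commute
        of_real_add of_real_mult of_real_of_int_eq distrib_left mult_cancel_left complex_i_not_zero)
  then have "(a - b - of_int n) * (2 * pi) = 0" by (simp add: algebra_simps)
  then have "a - b = of_int n" by simp
  then show ?thesis by simp
qed

text \<open>A branch over a time interval of the angle of a curve about the origin, with a full turn
  as the unit.\<close>

definition angle_lift :: "real \<Rightarrow> real \<Rightarrow> (real \<Rightarrow> complex) \<Rightarrow> (real \<Rightarrow> real) \<Rightarrow> bool" where
  "angle_lift a b c \<theta> \<longleftrightarrow> continuous_on {a..b} \<theta> \<and> (\<forall>t\<in>{a..b}. is_Arg (c t) (2 * pi * \<theta> t))"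

lemma angle_lift_unique:
  assumes "angle_lift a b c \<theta>" "angle_lift a b c \<theta>'" "\<And>t. t \<in> {a..b} \<Longrightarrow> c t \<noteq> 0" "a \<le> b"
  shows "\<theta> b - \<theta> a = \<theta>' b - \<theta>' a"
proof -
  have "\<theta> a - \<theta>' a = \<theta> b - \<theta>' b"
  proof (intro continuous_Ints_imp_const[where S = "{a..b}" and f = "\<lambda>t. \<theta> t - \<theta>' t"])
    show "\<theta> t - \<theta>' t \<in> \<int>" if "t \<in> {a..b}" for t
      using assms that by (intro is_Arg_unique_mod[of "c t"]) (auto simp: angle_lift_def)
  qed (use assms in \<open>auto simp: angle_lift_def intro!: continuous_intros\<close>)
  then show ?thesis by simp
qed

lemma angle_lift_subinterval:
  "angle_lift a b c \<theta> \<Longrightarrow> a \<le> a' \<Longrightarrow> b' \<le> b \<Longrightarrow> angle_lift a' b' c \<theta>"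
  unfolding angle_lift_def by (auto intro: continuous_on_subset)

text \<open>A curve that stays within distance \<open>norm (c a)\<close> of its starting point stays in an open
  half plane bounded by a line through the origin, where the principal argument is a branch.\<close>

lemma angle_lift_short:
  assumes l: "angle_lift a b c \<theta>" and "a \<le> b" and c: "continuous_on {a..b} c"
    and near: "\<And>t. t \<in> {a..b} \<Longrightarrow> norm (c t - c a) < norm (c a)"
  shows "\<bar>\<theta> b - \<theta> a\<bar> \<le> 1"
proof -
  have ca: "c a \<noteq> 0" using near[of a] \<open>a \<le> b\<close> by auto
  have re: "Re (c t / c a) > 0" if "t \<in> {a..b}" for t
  proof -
    have "norm (c t / c a - 1) = norm (c t - c a) / norm (c a)"
      using ca by (simp add: norm_divide[symmetric] diff_divide_distrib)
    also have "\<dots> < 1" using near[OF that] ca by simp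
    finally have "\<bar>Re (c t / c a - 1)\<bar> < 1" using abs_Re_le_cmod[of "c t / c a - 1"] by linarith
    then show ?thesis unfolding minus_complex.sel one_complex.sel by linarith
  qed
  have nz: "c t \<noteq> 0" if "t \<in> {a..b}" for t using re[OF that] by auto
  have neg: "c t / c a \<notin> \<real>\<^sub>\<le>\<^sub>0" if "t \<in> {a..b}" for t
    using re[OF that] by (auto simp: complex_nonpos_Reals_iff)
  define f where "f t = Arg (c t / c a) / (2 * pi) + \<theta> a" for t
  have "angle_lift a b c f"
    unfolding angle_lift_def
  proof (intro conjI ballI)
    show "continuous_on {a..b} f"
      unfolding f_def using ca neg by (intro continuous_intros c) auto
    fix t assume t: "t \<in> {a..b}"
    have "is_Arg (c t / c a * c a) (Arg (c t / c a) + 2 * pi * \<theta> a)"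
      using l \<open>a \<le> b\<close> ca nz[OF t] by (intro is_Arg_mult is_Arg_Arg) (auto simp: angle_lift_def)
    then show "is_Arg (c t) (2 * pi * f t)"
      using ca by (simp add: f_def distrib_left)
  qed
  then have "\<theta> b - \<theta> a = f b - f a"
    using angle_lift_unique[OF l _ nz \<open>a \<le> b\<close>] by simp
  also have "\<dots> = Arg (c b / c a) / (2 * pi)" using ca by (simp add: f_def)
  also have "\<bar>\<dots>\<bar> \<le> 1"
    using mpi_less_Arg[of "c b / c a"] Arg_le_pi[of "c b / c a"] pi_gt_zero by (auto simp: abs_le_iff field_simps)
  finally show ?thesis .
qed

text \<open>Turning about the origin takes time for a curve of bounded speed that stays away from the
  origin: the time interval is cut into short pieces, each of which turns by less than one.\<close>

lemma angle_lift_Lipschitz: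
  assumes l: "angle_lift a b c \<theta>" and "a \<le> b" and "\<rho> > 0"
    and lip: "\<And>s t. s \<in> {a..b} \<Longrightarrow> t \<in> {a..b} \<Longrightarrow> norm (c s - c t) \<le> M * \<bar>s - t\<bar>"
    and far: "\<And>t. t \<in> {a..b} \<Longrightarrow> \<rho> \<le> norm (c t)"
  shows "\<bar>\<theta> b - \<theta> a\<bar> \<le> M * (b - a) / \<rho> + 2"
proof (cases "a = b")
  case False
  then have ab: "a < b" using \<open>a \<le> b\<close> by simp
  have M: "M \<ge> 0"
  proof -
    have "0 \<le> M * \<bar>a - b\<bar>" using ab by (intro order_trans[OF norm_ge_zero lip[of a b]]) auto
    then show ?thesis using ab by (simp add: zero_le_mult_iff)
  qed
  have cont: "continuous_on {a..b} c"
    using lip M by (intro lipschitz_on_continuous_on[of M] lipschitz_onI) (auto simp: dist_norm)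
  define N where "N = Suc (nat \<lfloor>M * (b - a) / \<rho>\<rfloor>)"
  have N: "M * (b - a) / \<rho> < N" "real N \<le> M * (b - a) / \<rho> + 1" "N > 0"
    using M ab \<open>\<rho> > 0\<close> by (auto simp: N_def) linarith+
  define t where "t i = a + real i * (b - a) / N" for i
  have t: "a \<le> t i" "t i \<le> t (Suc i)" for i
    using ab by (simp_all add: t_def divide_right_mono mult_right_mono)
  have tb: "t i \<le> b" if "i \<le> N" for i
  proof -
    have "real i * (b - a) \<le> N * (b - a)" using that ab by (intro mult_right_mono) auto
    then show ?thesis using N by (simp add: t_def field_simps)
  qed
  have tt: "t (Suc i) - t i = (b - a) / N" for i using N by (simp add: t_def field_simps)
  have "\<bar>\<theta> (t (Suc i)) - \<theta> (t i)\<bar> \<le> 1" if i: "i < N" for i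
  proof (rule angle_lift_short[of "t i" "t (Suc i)" c \<theta>])
    have sub: "{t i..t (Suc i)} \<subseteq> {a..b}" using t(1)[of i] tb[of "Suc i"] i by auto
    show "angle_lift (t i) (t (Suc i)) c \<theta>"
      using t(1)[of i] tb[of "Suc i"] i by (intro angle_lift_subinterval[OF l]) auto
    show "t i \<le> t (Suc i)" by (rule t)
    show "continuous_on {t i..t (Suc i)} c" using cont sub by (rule continuous_on_subset)
    fix s assume s: "s \<in> {t i..t (Suc i)}"
    have "norm (c s - c (t i)) \<le> M * \<bar>s - t i\<bar>" using s sub t(2)[of i] by (intro lip) auto
    also have "\<dots> \<le> M * ((b - a) / N)" using s tt[of i] M by (intro mult_left_mono) auto
    also have "\<dots> < \<rho>" using N \<open>\<rho> > 0\<close> by (simp add: field_simps)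
    also have "\<rho> \<le> norm (c (t i))" using sub t(2)[of i] by (intro far) auto
    finally show "norm (c s - c (t i)) < norm (c (t i))" .
  qed
  then have "\<bar>\<theta> (t i) - \<theta> (t 0)\<bar> \<le> real i" if "i \<le> N" for i
    using that
  proof (induction i)
    case (Suc i)
    then have "\<bar>\<theta> (t (Suc i)) - \<theta> (t i)\<bar> \<le> 1" "\<bar>\<theta> (t i) - \<theta> (t 0)\<bar> \<le> real i" by auto
    then show ?case by simp
  qed simp
  from this[of N] have "\<bar>\<theta> b - \<theta> a\<bar> \<le> real N" using N by (simp add: t_def)
  then show ?thesis using N by simp
qed simp

section \<open>Obstacles in the plane\<close>

text \<open>Dirichlet approximation of the slope \<open>y / x\<close>. The integer point has even coordinates because
  squares that differ by even numbers carry translated, not reflected, copies of the obstacle.\<close>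

lemma segment_near_even_point:
  fixes x y :: real
  assumes "\<bar>y\<bar> \<le> \<bar>x\<bar>" "2 * real N \<le> \<bar>x\<bar>" "N > 0"
  obtains a b :: int and t where "0 \<le> t" "t \<le> 1" "a \<noteq> 0" "\<bar>a\<bar> \<le> int N" "t * x = 2 * of_int a"
    "\<bar>2 * of_int b - t * y\<bar> \<le> 2 / N"
proof -
  have x0: "x \<noteq> 0" using assms by auto
  obtain h k where hk: "0 < k" "k \<le> int N" "\<bar>of_int k * (y / x) - of_int h\<bar> < 1 / N"
    using Dirichlet_approx[OF \<open>N > 0\<close>, of "y / x"] by metis
  define s :: int where "s = (if x > 0 then 1 else -1)"
  have s: "s = 1 \<or> s = -1" "\<bar>x\<bar> = of_int s * x" using x0 by (auto simp: s_def)
  define t where "t = 2 * of_int k / \<bar>x\<bar>"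
  have tx: "t * x = 2 * of_int (s * k)" using x0 by (auto simp: t_def s_def)
  have ty: "t * y = 2 * of_int s * (of_int k * (y / x))"
  proof -
    have "t * y = (t * x) * (y / x)" using x0 by simp
    then show ?thesis by (simp add: tx)
  qed
  show thesis
  proof
    show "0 \<le> t" using hk by (simp add: t_def)
    have "real_of_int k \<le> real N" using hk by linarith
    then show "t \<le> 1" using assms x0 by (simp add: t_def)
    show "s * k \<noteq> 0" "\<bar>s * k\<bar> \<le> int N" using hk s by auto
    show "t * x = 2 * of_int (s * k)" by (fact tx)
    have "\<bar>2 * of_int (s * h) - t * y\<bar> = 2 * \<bar>of_int k * (y / x) - of_int h\<bar>"
      unfolding ty using s(1) by (auto simp: abs_if)
    then show "\<bar>2 * of_int (s * h) - t * y\<bar> \<le> 2 / N" using hk by simp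
  qed
qed

lemma centre_origin: "centre (0, 0) = 0"
  by (simp add: centre_def complex_eq_iff)

text \<open>The geometric content of the assumptions on the obstacle: smoothness of the boundary
  enters as uniqueness of the outer normals.\<close>

locale small_obstacle =
  fixes K :: "complex set" and z :: complex and r \<rho> :: real
  assumes compact_K: "compact K" and convex_K: "convex K"
    and K_subset_cball: "K \<subseteq> cball 0 r" and r_less: "r < sqrt 2 / 4"
    and rho_pos: "\<rho> > 0" and cball_subset_K: "cball z \<rho> \<subseteq> K"
    and unique_normal: "a \<in> frontier K \<Longrightarrow> outer_unit_normal K a m \<Longrightarrow> outer_unit_normal K a n \<Longrightarrow> m = n"
begin

abbreviation ob :: "int \<times> int \<Rightarrow> complex set" where "ob \<equiv> obst K"

abbreviation zz :: "int \<times> int \<Rightarrow> complex" where "zz k \<equiv> place k z"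

lemma z_in_K: "z \<in> K" using cball_subset_K rho_pos by auto

lemma z_interior: "z \<in> interior K"
  using cball_subset_K rho_pos by (meson ball_subset_cball centre_in_ball interiorI open_ball subset_trans)

lemma r_nonneg: "0 \<le> r"
  using z_in_K K_subset_cball by (force intro: order_trans[OF norm_ge_zero])

lemma r_square: "8 * r\<^sup>2 < 1"
proof -
  have "r\<^sup>2 < (sqrt 2 / 4)\<^sup>2" using r_nonneg r_less by (intro power_strict_mono) auto
  then show ?thesis by (simp add: power_divide)
qed

lemma two_r_less_1: "2 * r < 1"
  using r_square by (rule_tac power2_less_imp_less) (auto simp: power_mult_distrib)

lemma K_subset_square: "K \<subseteq> unit_square"
proof
  fix x assume "x \<in> K"
  then have "norm x \<le> r" using K_subset_cball by auto
  then show "x \<in> unit_square"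
    unfolding unit_square_def mem_Collect_eq
    using abs_Re_le_cmod[of x] abs_Im_le_cmod[of x] two_r_less_1 by linarith
qed

lemma ob_near_centre: "x \<in> ob k \<Longrightarrow> dist x (centre k) \<le> r"
  using K_subset_cball by (auto simp: obst_def place_alt dist_norm)

lemma compact_ob: "compact (ob k)"
  unfolding obst_def by (intro compact_continuous_image compact_K continuous_intros)

lemma convex_ob: "convex (ob k)"
  unfolding obst_def place_image_eq
  by (intro convex_translation convex_linear_image linear_lin convex_K)

lemma ob_nonempty: "ob k \<noteq> {}"
  using z_in_K by (auto simp: obst_def)

lemma closed_ob: "closed (ob k)" by (simp add: compact_ob compact_imp_closed)

lemma cball_subset_ob: "cball (zz k) \<rho> \<subseteq> ob k"
proof
  fix x assume "x \<in> cball (zz k) \<rho>"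
  then have "dist (place k z) (place k (place (sq_inv k) x)) \<le> \<rho>" by simp
  then have "dist z (place (sq_inv k) x) \<le> \<rho>" unfolding dist_place .
  then have "place (sq_inv k) x \<in> K" using cball_subset_K by auto
  then show "x \<in> ob k" unfolding obst_def by (metis image_eqI place_inv(2))
qed

lemma zz_interior_ob: "zz k \<in> interior (ob k)"
  using z_interior by (simp add: obst_def interior_place)

lemma zz_in_ob: "zz k \<in> ob k" using zz_interior_ob interior_subset by blast

lemma dist_centre: "k \<noteq> l \<Longrightarrow> 1 \<le> dist (centre k) (centre l)"
proof -
  assume "k \<noteq> l"
  then have "fst k \<noteq> fst l \<or> snd k \<noteq> snd l" by (auto simp: prod_eq_iff)
  then have "1 \<le> \<bar>Re (centre k - centre l)\<bar> \<or> 1 \<le> \<bar>Im (centre k - centre l)\<bar>"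
    by (auto simp: centre_def)
  then show ?thesis
    using abs_Re_le_cmod[of "centre k - centre l"] abs_Im_le_cmod[of "centre k - centre l"]
    by (auto simp: dist_norm)
qed

lemma ob_apart:
  assumes "k \<noteq> l" "x \<in> ob k" "y \<in> ob l"
  shows "1 - 2 * r \<le> dist x y"
proof -
  have "dist (centre k) (centre l) \<le> dist (centre k) x + dist x y + dist y (centre l)"
    using dist_triangle[of "centre k" "centre l" x] dist_triangle[of x "centre l" y] by linarith
  then show ?thesis
    using dist_centre[OF assms(1)] ob_near_centre[OF assms(2)] ob_near_centre[OF assms(3)]
    by (simp add: dist_commute)
qed

lemma ob_disjoint: "k \<noteq> l \<Longrightarrow> ob k \<inter> ob l = {}"
proof -
  assume "k \<noteq> l"
  then have "1 - 2 * r \<le> dist x x" if "x \<in> ob k" "x \<in> ob l" for x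
    using that by (rule ob_apart)
  then show ?thesis using two_r_less_1 by auto
qed

lemma ob_index_unique: "x \<in> ob k \<Longrightarrow> x \<in> ob l \<Longrightarrow> k = l"
  using ob_disjoint by blast

lemma wrap_ob: "x \<in> ob k \<Longrightarrow> wrap x - z = lin k (x - zz k)"
proof -
  assume "x \<in> ob k"
  then obtain a where a: "x = place k a" "a \<in> K" by (auto simp: obst_def)
  then have "wrap x = a" using K_subset_square by (auto simp: wrap_id)
  then show ?thesis by (simp add: a place_diff)
qed

lemma wrap_eq_zD: "wrap x = z \<Longrightarrow> \<exists>k. x = zz k"
  by (metis wrap_preimage)

lemma norm_wrap_ge:
  assumes "\<And>k. x \<notin> interior (ob k)" shows "\<rho> \<le> norm (wrap x - z)"
proof (rule ccontr)
  assume "\<not> ?thesis"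
  then have "wrap x \<in> ball z \<rho>" by (simp add: dist_norm norm_minus_commute)
  then have "wrap x \<in> interior K"
    using cball_subset_K by (meson ball_subset_cball interiorI open_ball subset_trans)
  moreover obtain k where "x = place k (wrap x)" by (rule wrap_preimage)
  ultimately have "x \<in> interior (ob k)" unfolding obst_def interior_place by (metis imageI)
  then show False using assms by blast
qed

text \<open>The hull of two obstacles lies in the convex neighbourhood of radius \<open>r\<close> of the segment
  between the centres of their squares; in this way admissibility is tested on integer points.\<close>

lemma hull_near_segment:
  assumes "x \<in> convex hull (ob i \<union> ob j)"
  shows "\<exists>t\<in>{0..1}. dist x ((1 - t) *\<^sub>R centre i + t *\<^sub>R centre j) \<le> r"
proof -
  let ?S = "\<Union>x\<in>closed_segment (centre i) (centre j). \<Union>y\<in>cball 0 r. {x + y}"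
  have "ob k \<subseteq> ?S" if "k = i \<or> k = j" for k
  proof
    fix x assume "x \<in> ob k"
    then have "x - centre k \<in> cball 0 r" using ob_near_centre[of x k] by (auto simp: dist_norm norm_minus_commute)
    moreover have "centre k \<in> closed_segment (centre i) (centre j)" using that by auto
    moreover have "x = centre k + (x - centre k)" by simp
    ultimately show "x \<in> ?S" by blast
  qed
  then have "convex hull (ob i \<union> ob j) \<subseteq> ?S"
    by (intro hull_minimal convex_sums convex_closed_segment convex_cball) auto
  then obtain a y where a: "a \<in> closed_segment (centre i) (centre j)" "norm y \<le> r" "x = a + y"
    using assms by auto
  then obtain u where "u \<in> {0..1}" "a = (1 - u) *\<^sub>R centre i + u *\<^sub>R centre j"
    by (auto simp: closed_segment_def)
  then show ?thesis using a by (intro bexI[of _ u]) (simp_all add: dist_norm)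
qed

lemma between_near_segment:
  assumes "between K k i j"
  shows "\<exists>t\<in>{0..1}. dist (centre k) ((1 - t) *\<^sub>R centre i + t *\<^sub>R centre j) \<le> 2 * r"
proof -
  obtain x where "x \<in> ob k" "x \<in> convex hull (ob i \<union> ob j)" using assms by (auto simp: between_def)
  then obtain t where "t \<in> {0..1}" "dist x ((1 - t) *\<^sub>R centre i + t *\<^sub>R centre j) \<le> r"
    "dist x (centre k) \<le> r"
    using hull_near_segment ob_near_centre by blast
  then show ?thesis
    using dist_triangle[of "centre k" "(1 - t) *\<^sub>R centre i + t *\<^sub>R centre j" x]
    by (intro bexI[of _ t]) (simp_all add: dist_commute)
qed

text \<open>Here smallness of the obstacle enters. The steps \<open>i\<close> and \<open>j\<close> away from the origin form an
  angle of at most 90 degrees and have length at least 1, so the segment between them stays at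
  distance at least \<open>1 / sqrt 2\<close> from the origin, which exceeds \<open>2 * r\<close>.\<close>

lemma not_between_obtuse:
  assumes "i \<noteq> (0, 0)" "j \<noteq> (0, 0)" "fst i * fst j + snd i * snd j \<ge> 0"
  shows "\<not> between K (0, 0) i j"
proof
  assume "between K (0, 0) i j"
  then obtain t where t: "0 \<le> t" "t \<le> 1"
    and d: "norm ((1 - t) *\<^sub>R centre i + t *\<^sub>R centre j) \<le> 2 * r"
    using between_near_segment[of "(0, 0)" i j] by (auto simp: centre_origin)
  have ge1: "1 \<le> (of_int (fst k))\<^sup>2 + (of_int (snd k) :: real)\<^sup>2" if "k \<noteq> (0, 0)" for k :: "int \<times> int"
  proof -
    have "(fst k)\<^sup>2 + (snd k)\<^sup>2 \<noteq> 0" using that by (auto simp: prod_eq_iff)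
    then have "1 \<le> (fst k)\<^sup>2 + (snd k)\<^sup>2" by (smt (verit) zero_le_power2)
    then have "of_int 1 \<le> (of_int ((fst k)\<^sup>2 + (snd k)\<^sup>2) :: real)" by (simp only: of_int_le_iff)
    then show ?thesis by simp
  qed
  have ij: "0 \<le> of_int (fst i) * of_int (fst j) + of_int (snd i) * (of_int (snd j) :: real)"
    using assms(3) by (metis of_int_0_le_iff of_int_add of_int_mult)
  have "1 / 2 \<le> (1 - t)\<^sup>2 + t\<^sup>2" using zero_le_power2[of "2 * t - 1"] by (simp add: power2_eq_square algebra_simps)
  also have "\<dots> \<le> (1 - t)\<^sup>2 * ((of_int (fst i))\<^sup>2 + (of_int (snd i))\<^sup>2) + t\<^sup>2 * ((of_int (fst j))\<^sup>2 + (of_int (snd j))\<^sup>2)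
      + 2 * t * (1 - t) * (of_int (fst i) * of_int (fst j) + of_int (snd i) * (of_int (snd j) :: real))"
  proof -
    have "0 \<le> 2 * t * (1 - t) * (of_int (fst i) * of_int (fst j) + of_int (snd i) * (of_int (snd j) :: real))"
      using t ij by (intro mult_nonneg_nonneg) auto
    then show ?thesis
      using mult_left_mono[OF ge1[OF assms(1)], of "(1 - t)\<^sup>2"] mult_left_mono[OF ge1[OF assms(2)], of "t\<^sup>2"]
      by simp
  qed
  also have "\<dots> = (norm ((1 - t) *\<^sub>R centre i + t *\<^sub>R centre j))\<^sup>2"
    unfolding cmod_power2 by (simp add: centre_def power2_eq_square algebra_simps)
  also have "\<dots> \<le> (2 * r)\<^sup>2" using d by (intro power_mono) auto
  also have "\<dots> < 1 / 2" using r_square by (simp add: power_mult_distrib)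
  finally show False by simp
qed

lemma not_between_unit_step:
  assumes e: "\<bar>fst e\<bar> + \<bar>snd e\<bar> = 1"
  shows "\<not> between K j (0, 0) e"
proof
  assume b: "between K j (0, 0) e"
  then obtain t where t: "0 \<le> t" "t \<le> 1"
    and d: "norm (centre j - t *\<^sub>R centre e) \<le> 2 * r"
    using between_near_segment[OF b] by (auto simp: centre_origin dist_norm)
  have ne: "j \<noteq> (0, 0)" "j \<noteq> e" using b by (auto simp: between_def)
  consider "snd e = 0" "fst e = 1" | "snd e = 0" "fst e = -1" | "fst e = 0" "snd e = 1" | "fst e = 0" "snd e = -1"
    using e by linarith
  then have "1 \<le> \<bar>Re (centre j - t *\<^sub>R centre e)\<bar> \<or> 1 \<le> \<bar>Im (centre j - t *\<^sub>R centre e)\<bar>"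
  proof cases
    case 1
    then have "snd j = 0 \<Longrightarrow> fst j \<le> -1 \<or> fst j \<ge> 2" using ne by (cases j; cases e) auto
    then show ?thesis using t 1 by (cases "snd j = 0") (auto simp: centre_def)
  next
    case 2
    then have "snd j = 0 \<Longrightarrow> fst j \<ge> 1 \<or> fst j \<le> -2" using ne by (cases j; cases e) auto
    then show ?thesis using t 2 by (cases "snd j = 0") (auto simp: centre_def)
  next
    case 3
    then have "fst j = 0 \<Longrightarrow> snd j \<le> -1 \<or> snd j \<ge> 2" using ne by (cases j; cases e) auto
    then show ?thesis using t 3 by (cases "fst j = 0") (auto simp: centre_def)
  next
    case 4
    then have "fst j = 0 \<Longrightarrow> snd j \<ge> 1 \<or> snd j \<le> -2" using ne by (cases j; cases e) auto
    then show ?thesis using t 4 by (cases "fst j = 0") (auto simp: centre_def)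
  qed
  then show False
    using abs_Re_le_cmod[of "centre j - t *\<^sub>R centre e"] abs_Im_le_cmod[of "centre j - t *\<^sub>R centre e"]
      d two_r_less_1 by linarith
qed

text \<open>A very long segment between two obstacles passes close to a point \<open>zz k\<close> in its way, by
  Dirichlet approximation, and then meets the disc of radius \<open>\<rho>\<close> contained in the obstacle there.
  So the steps of admissible sequences are bounded.\<close>

lemma bounded_steps:
  obtains R where "\<And>i j x y. \<lbrakk>\<nexists>k. between K k i j; x \<in> ob i; y \<in> ob j\<rbrakk> \<Longrightarrow> dist x y \<le> R"
proof -
  obtain N :: nat where N: "N > 0" "2 / real N \<le> \<rho>"
  proof -
    obtain N :: nat where "2 / \<rho> < real N" using reals_Archimedean2 by blast
    then have "2 / \<rho> \<le> real (Suc N)" by simp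
    then show thesis using rho_pos by (intro that[of "Suc N"]) (auto simp: divide_le_eq mult.commute)
  qed
  have bnd: "\<bar>Re (zz j - zz i)\<bar> < 2 * real N + 1 \<and> \<bar>Im (zz j - zz i)\<bar> < 2 * real N + 1"
    if nb: "\<nexists>k. between K k i j" for i j
  proof -
    have no: False if t: "0 \<le> t" "t \<le> 1" and k: "k \<noteq> i" "k \<noteq> j"
      and d: "norm (zz k - (zz i + t *\<^sub>R (zz j - zz i))) \<le> \<rho>" for k t
    proof -
      have "zz i + t *\<^sub>R (zz j - zz i) \<in> cball (zz k) \<rho>" using d by (simp add: dist_norm)
      then have "zz i + t *\<^sub>R (zz j - zz i) \<in> ob k" using cball_subset_ob by blast
      moreover have "zz i + t *\<^sub>R (zz j - zz i) \<in> closed_segment (zz i) (zz j)"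
        using t by (auto simp: closed_segment_def algebra_simps intro!: exI[of _ t])
      moreover have "closed_segment (zz i) (zz j) \<subseteq> convex hull (ob i \<union> ob j)"
        using zz_in_ob unfolding segment_convex_hull by (intro hull_mono) auto
      ultimately have "between K k i j" using k unfolding between_def by blast
      then show False using nb by blast
    qed
    have even_shift: "zz (fst i + 2 * a, snd i + 2 * b) = zz i + Complex (2 * of_int a) (2 * of_int b)" for a b
      by (simp add: place_alt centre_def lin_def sg_def complex_eq_iff)
    have bound: "\<bar>x\<bar> < 2 * real N + 1" if le: "\<bar>y\<bar> \<le> \<bar>x\<bar>"
      and E: "E = Complex \<or> E = (\<lambda>a b. Complex b a)" and v: "zz j - zz i = E x y" for x y E
    proof (rule ccontr)
      assume big: "\<not> ?thesis"
      obtain a b t where ab: "0 \<le> t" "t \<le> 1" "a \<noteq> 0" "\<bar>a\<bar> \<le> int N" "t * x = 2 * of_int a"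
        "\<bar>2 * of_int b - t * y\<bar> \<le> 2 / N"
      proof -
        have "2 * real N \<le> \<bar>x\<bar>" using big by linarith
        from segment_near_even_point[OF le this N(1)] show thesis using that by blast
      qed
      have "\<exists>k. zz k = zz i + E (2 * of_int a) (2 * of_int b)"
        using E even_shift[of a b] even_shift[of b a] by blast
      then obtain k where k: "zz k = zz i + E (2 * of_int a) (2 * of_int b)" by blast
      have "zz k - (zz i + t *\<^sub>R (zz j - zz i)) = E 0 (2 * of_int b - t * y)"
        unfolding k v using E ab(5) by (auto simp: complex_eq_iff)
      moreover have "norm (E 0 (2 * of_int b - t * y)) \<le> \<rho>" using E ab(6) N by (auto simp: complex_norm)
      ultimately have "norm (zz k - (zz i + t *\<^sub>R (zz j - zz i))) \<le> \<rho>" by simp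
      moreover have "k \<noteq> i" using k E ab(3) by (auto simp: complex_eq_iff)
      moreover have "k \<noteq> j"
      proof
        assume "k = j"
        then have "E x y = E (2 * of_int a) (2 * of_int b)" using k v by (simp add: algebra_simps)
        then have "x = 2 * of_int a" using E by auto
        moreover have "\<bar>real_of_int a\<bar> \<le> real N" using ab(4) by linarith
        ultimately show False using big by (simp add: abs_mult)
      qed
      ultimately show False using no ab(1,2) by blast
    qed
    have "zz j - zz i = Complex (Re (zz j - zz i)) (Im (zz j - zz i))"
      by (rule complex_surj[symmetric])
    from bound[OF _ disjI1[OF refl] this] bound[OF _ disjI2[OF refl] this]
    show ?thesis by linarith
  qed
  have diam: "dist x (zz k) \<le> 1" if "x \<in> ob k" for x k
  proof -
    have "dist x (zz k) \<le> dist x (centre k) + dist (zz k) (centre k)" by (rule dist_triangle2)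
    then show ?thesis using ob_near_centre[OF that] ob_near_centre[OF zz_in_ob[of k]] two_r_less_1 by linarith
  qed
  show thesis
  proof
    fix i j x y assume nb: "\<nexists>k. between K k i j" and xy: "x \<in> ob i" "y \<in> ob j"
    have "norm (zz j - zz i) \<le> \<bar>Re (zz j - zz i)\<bar> + \<bar>Im (zz j - zz i)\<bar>" by (rule cmod_le)
    then have "dist (zz i) (zz j) \<le> 4 * real N + 2" using bnd[OF nb] by (simp add: dist_norm norm_minus_commute)
    moreover have "dist x y \<le> dist x (zz i) + dist (zz i) (zz j) + dist (zz j) y"
      using dist_triangle[of x y "zz i"] dist_triangle[of "zz i" y "zz j"] by linarith
    ultimately show "dist x y \<le> 4 * real N + 4" using diam[OF xy(1)] diam[OF xy(2)] by (simp add: dist_commute)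
  qed
qed

end

section \<open>Straight pieces and angles measured from a cut\<close>

lemma inner_pos_interior:
  fixes g :: "'a::euclidean_space"
  assumes "\<And>y. y \<in> S \<Longrightarrow> 0 \<le> g \<bullet> (y - p)" "g \<noteq> 0" "y \<in> interior S"
  shows "0 < g \<bullet> (y - p)"
proof -
  obtain e where e: "e > 0" "cball y e \<subseteq> S" using assms(3) by (auto simp: mem_interior_cball)
  have "y - (e / norm g) *\<^sub>R g \<in> cball y e" using e by (simp add: dist_norm)
  then have "0 \<le> g \<bullet> (y - (e / norm g) *\<^sub>R g - p)" using e assms(1) by blast
  also have "\<dots> = g \<bullet> (y - p) - e * norm g"
    using assms(2) by (simp add: inner_diff_right dot_square_norm power2_eq_square)
  finally show ?thesis using e assms(2) by (smt (verit) mult_pos_pos zero_less_norm_iff)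
qed

lemma angle_function_exists:
  fixes c :: "real \<Rightarrow> complex"
  assumes "continuous_on S c" "convex S" "\<And>t. t \<in> S \<Longrightarrow> c t \<noteq> 0"
  obtains \<theta> where "continuous_on S \<theta>" "\<And>t. t \<in> S \<Longrightarrow> is_Arg (c t) (2 * pi * \<theta> t)"
proof -
  obtain g where g: "continuous_on S g" "\<And>t. t \<in> S \<Longrightarrow> c t = exp (g t)"
    using continuous_logarithm_on_contractible[OF assms(1) convex_imp_contractible[OF assms(2)]] assms(3) by blast
  show thesis
  proof
    show "continuous_on S (\<lambda>t. Im (g t) / (2 * pi))" by (intro continuous_intros g) auto
    show "is_Arg (c t) (2 * pi * (Im (g t) / (2 * pi)))" if "t \<in> S" for t
      using g(2)[OF that] is_Arg_exp_Im[of "g t"] by simp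
  qed
qed

lemma straight_linepath:
  fixes c :: "real \<Rightarrow> complex"
  assumes "a \<le> b" "\<And>t. t \<in> {a..b} \<Longrightarrow> c t = c a + (t - a) *\<^sub>R v" "u \<in> {0..1}"
  shows "a + u * (b - a) \<in> {a..b}" "linepath (c a) (c b) u = c (a + u * (b - a))"
proof -
  have "0 \<le> u * (b - a)" "u * (b - a) \<le> b - a"
    using assms(1,3) by (auto intro!: mult_left_le_one_le mult_nonneg_nonneg)
  then show mem: "a + u * (b - a) \<in> {a..b}" by simp
  have "linepath (c a) (c b) u = c a + u *\<^sub>R (c b - c a)" by (simp add: linepath_def algebra_simps)
  also have "c b - c a = (b - a) *\<^sub>R v" using assms(2)[of b] assms(1) by simp
  finally show "linepath (c a) (c b) u = c (a + u * (b - a))" using assms(2)[OF mem] by simp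
qed

lemma straight_closed_segment:
  fixes c :: "real \<Rightarrow> complex"
  assumes "a \<le> b" "\<And>t. t \<in> {a..b} \<Longrightarrow> c t = c a + (t - a) *\<^sub>R v"
  shows "closed_segment (c a) (c b) \<subseteq> c ` {a..b}"
proof
  fix x assume "x \<in> closed_segment (c a) (c b)"
  then obtain u where u: "u \<in> {0..1}" "x = linepath (c a) (c b) u"
    by (auto simp: closed_segment_def linepath_def)
  then show "x \<in> c ` {a..b}" using straight_linepath[OF assms u(1)] by blast
qed

text \<open>The angle of \<open>x\<close> as seen from the copy \<open>place k z\<close> of \<open>z\<close>, measured from the direction
  \<open>- h\<close> and transported back to the square. The branch is cut along the ray in direction \<open>h\<close>.\<close>

definition ray_angle :: "complex \<Rightarrow> int \<times> int \<Rightarrow> complex \<Rightarrow> complex \<Rightarrow> real" where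
  "ray_angle z k h x = Arg (lin k (x - place k z) / lin k (- h)) / (2 * pi)"

lemma ray_angle_bound: "\<bar>ray_angle z k h x\<bar> \<le> 1/2"
  unfolding ray_angle_def using mpi_less_Arg Arg_le_pi pi_gt_zero
  by (auto simp: abs_le_iff divide_le_eq minus_divide_left less_imp_le minus_le_iff)

lemma ray_angle_is_Arg:
  assumes "x \<noteq> place k z" "h \<noteq> 0"
  shows "is_Arg (lin k (x - place k z)) (2 * pi * ray_angle z k h x + Arg (lin k (- h)))"
proof -
  have "is_Arg (lin k (x - place k z) / lin k (- h) * lin k (- h))
      (Arg (lin k (x - place k z) / lin k (- h)) + Arg (lin k (- h)))"
    using assms by (intro is_Arg_mult is_Arg_Arg) auto
  then show ?thesis using assms by (simp add: ray_angle_def)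
qed

lemma continuous_on_ray_angle:
  assumes "h \<noteq> 0" "\<And>t. 0 \<le> t \<Longrightarrow> place k z + t *\<^sub>R h \<notin> S"
  shows "continuous_on S (ray_angle z k h)"
proof -
  have "lin k (x - place k z) / lin k (- h) \<notin> \<real>\<^sub>\<le>\<^sub>0" if x: "x \<in> S" for x
  proof
    assume "lin k (x - place k z) / lin k (- h) \<in> \<real>\<^sub>\<le>\<^sub>0"
    then obtain t where t: "t \<le> 0" "lin k (x - place k z) / lin k (- h) = of_real t"
      by (auto elim: nonpos_Reals_cases)
    then have "lin k (x - place k z) = t *\<^sub>R lin k (- h)"
      using \<open>h \<noteq> 0\<close> by (simp add: divide_eq_eq scaleR_conv_of_real)
    then have "lin k (x - place k z) = lin k ((- t) *\<^sub>R h)" by (simp add: lin_minus lin_scaleR)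
    then have "x - place k z = (- t) *\<^sub>R h" by (metis lin_lin)
    then have "x = place k z + (- t) *\<^sub>R h" by (simp add: algebra_simps)
    then show False using assms(2)[of "- t"] t x by auto
  qed
  then show ?thesis using \<open>h \<noteq> 0\<close> unfolding ray_angle_def
    by (intro continuous_intros) auto
qed

context small_obstacle
begin

section \<open>Chains of reflection points\<close>

text \<open>The directional derivative of the length of the broken line \<open>a p b\<close> with respect to
  \<open>p \<in> S\<close> is nonnegative. At a point of reflection this is the law of reflection together with the
  fact that the path stays on the outer side.\<close>

definition critical :: "complex set \<Rightarrow> complex \<Rightarrow> complex \<Rightarrow> complex \<Rightarrow> bool" where
  "critical S a p b \<longleftrightarrow> (\<forall>y\<in>S. 0 \<le> (sgn (p - a) - sgn (b - p)) \<bullet> (y - p))"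

text \<open>Admissibility of a finite sequence without the condition on its first term, which makes
  the notion invariant under cutting and under the unfolding maps.\<close>

definition adm_type :: "nat \<Rightarrow> (nat \<Rightarrow> int \<times> int) \<Rightarrow> bool" where
  "adm_type s k \<longleftrightarrow> (\<forall>n<s. k (Suc n) \<noteq> k n \<and> (\<nexists>j. between K j (k n) (k (Suc n)))) \<and>
     (\<forall>n. Suc n < s \<longrightarrow> \<not> between K (k (Suc n)) (k n) (k (Suc (Suc n))))"

text \<open>The discrete form of a piece of an unfolded trajectory. Its length and its displacement
  are sums over its segments.\<close>

definition chain :: "nat \<Rightarrow> (nat \<Rightarrow> int \<times> int) \<Rightarrow> (nat \<Rightarrow> complex) \<Rightarrow> bool" where
  "chain s k p \<longleftrightarrow> (\<forall>i\<le>s. p i \<in> ob (k i)) \<and>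
     (\<forall>i. Suc i < s \<longrightarrow> critical (ob (k (Suc i))) (p i) (p (Suc i)) (p (Suc (Suc i)))) \<and>
     (\<forall>i<s. \<forall>j. closed_segment (p i) (p (Suc i)) \<inter> interior (ob j) = {})"

lemma chain_point: "chain s k p \<Longrightarrow> i \<le> s \<Longrightarrow> p i \<in> ob (k i)"
  and chain_critical: "chain s k p \<Longrightarrow> Suc i < s \<Longrightarrow> critical (ob (k (Suc i))) (p i) (p (Suc i)) (p (Suc (Suc i)))"
  and chain_segment: "chain s k p \<Longrightarrow> i < s \<Longrightarrow> closed_segment (p i) (p (Suc i)) \<inter> interior (ob j) = {}"
  unfolding chain_def by blast+

text \<open>A direction \<open>h\<close> pointing from the two neighbours to the obstacle \<open>j\<close> across a separating
  line. It exists since \<open>ob j\<close> is not between its neighbours, and the ray from \<open>zz j\<close> in this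
  direction is the cut used to measure angles about \<open>zz j\<close>.\<close>

definition separates :: "int \<times> int \<Rightarrow> int \<times> int \<Rightarrow> int \<times> int \<Rightarrow> complex \<Rightarrow> bool" where
  "separates i j l h \<longleftrightarrow> (\<exists>c. (\<forall>x\<in>ob j. h \<bullet> x > c) \<and> (\<forall>x\<in>ob i \<union> ob l. h \<bullet> x < c))"

definition back_dir :: "int \<times> int \<Rightarrow> int \<times> int \<Rightarrow> int \<times> int \<Rightarrow> complex" where
  "back_dir i j l = (SOME h. separates i j l h)"

lemma separates_back:
  assumes "i \<noteq> j" "l \<noteq> j" "\<not> between K j i l"
  shows "separates i j l (back_dir i j l)"
proof -
  have "ob j \<inter> convex hull (ob i \<union> ob l) = {}" using assms by (auto simp: between_def)
  moreover have "closed (convex hull (ob i \<union> ob l))"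
    by (intro compact_imp_closed compact_convex_hull compact_Un compact_ob)
  ultimately obtain a b where "\<forall>x\<in>ob j. a \<bullet> x < b" "\<forall>x\<in>convex hull (ob i \<union> ob l). a \<bullet> x > b"
    using separating_hyperplane_compact_closed[OF convex_ob compact_ob ob_nonempty convex_convex_hull] by metis
  then have "separates i j l (- a)" unfolding separates_def
    by (intro exI[of _ "- b"]) (auto intro: hull_inc)
  then show ?thesis unfolding back_dir_def by (rule someI)
qed

lemma separates_nonzero: "separates i j l h \<Longrightarrow> h \<noteq> 0"
  using zz_in_ob[of i] zz_in_ob[of j] by (fastforce simp: separates_def)

lemma separates_ray:
  assumes "separates i j l h" "0 \<le> t" "m = i \<or> m = l"
  shows "zz j + t *\<^sub>R h \<notin> ob m"
proof
  assume m: "zz j + t *\<^sub>R h \<in> ob m"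
  obtain c where c: "\<forall>x\<in>ob j. h \<bullet> x > c" "\<forall>x\<in>ob i \<union> ob l. h \<bullet> x < c"
    using assms(1) unfolding separates_def by blast
  have "h \<bullet> (zz j + t *\<^sub>R h) < c" using c(2) m assms(3) by blast
  moreover have "h \<bullet> (zz j + t *\<^sub>R h) = h \<bullet> zz j + t * (h \<bullet> h)" by (simp add: inner_add_right)
  moreover have "0 \<le> t * (h \<bullet> h)" using assms(2) by simp
  ultimately show False using c(1) zz_in_ob[of j] by force
qed

text \<open>The difference of the incoming and the outgoing direction points into the obstacle, so both
  adjacent segments lie on the other side of the tangent line.\<close>

lemma critical_segments:
  assumes x: "x \<in> closed_segment a p \<union> closed_segment p b"
  shows "(sgn (p - a) - sgn (b - p)) \<bullet> (x - p) \<le> 0"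
proof -
  define v w where "v = sgn (p - a)" and "w = sgn (b - p)"
  have vw: "norm v \<le> 1" "norm w \<le> 1" by (simp_all add: v_def w_def norm_sgn)
  have v: "p - a = norm (p - a) *\<^sub>R v" and w: "b - p = norm (b - p) *\<^sub>R w"
    by (cases "p = a"; cases "b = p"; simp add: v_def w_def sgn_div_norm)+
  have ww: "w \<bullet> w = 1 \<or> w = 0" "v \<bullet> v = 1 \<or> v = 0"
    by (auto simp: v_def w_def sgn_div_norm power2_norm_eq_inner[symmetric] power2_eq_square dot_square_norm)
  have le: "v \<bullet> w \<le> 1" using norm_cauchy_schwarz[of v w] vw
    by (smt (verit) mult_le_one norm_ge_zero)
  have "v \<bullet> w \<le> w \<bullet> w" "v \<bullet> w \<le> v \<bullet> v" using ww le by auto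
  then have le: "(v - w) \<bullet> w \<le> 0" "0 \<le> (v - w) \<bullet> v"
    by (simp_all add: inner_diff_left inner_commute[of w v])
  from x consider "x \<in> closed_segment a p" | "x \<in> closed_segment p b" by blast
  then show ?thesis
  proof cases
    case 1
    then obtain u where u: "0 \<le> u" "u \<le> 1" "x = (1 - u) *\<^sub>R a + u *\<^sub>R p" by (auto simp: closed_segment_def)
    have "x - p = (-(1 - u)) *\<^sub>R (p - a)" unfolding u(3) by (simp add: algebra_simps)
    also have "\<dots> = (-((1 - u) * norm (p - a))) *\<^sub>R v"
      by (subst v) (simp only: scaleR_scaleR mult_minus_left)
    finally have "(v - w) \<bullet> (x - p) = - ((1 - u) * norm (p - a) * ((v - w) \<bullet> v))"
      by simp
    then show ?thesis unfolding v_def[symmetric] w_def[symmetric] using u le(2) by simp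
  next
    case 2
    then obtain u where u: "0 \<le> u" "u \<le> 1" "x = (1 - u) *\<^sub>R p + u *\<^sub>R b" by (auto simp: closed_segment_def)
    have "x - p = u *\<^sub>R (b - p)" unfolding u(3) by (simp add: algebra_simps)
    also have "\<dots> = (u * norm (b - p)) *\<^sub>R w" by (subst w) simp
    finally have "(v - w) \<bullet> (x - p) = u * norm (b - p) * ((v - w) \<bullet> w)"
      by simp
    then show ?thesis unfolding v_def[symmetric] w_def[symmetric] using u le(1) by (simp add: mult_nonneg_nonpos)
  qed
qed

lemma critical_deflection_pos:
  assumes "critical (ob j) a p b" "a \<in> ob i" "p \<in> ob j" "b \<in> ob l" "separates i j l h"
  shows "0 < (sgn (p - a) - sgn (b - p)) \<bullet> h"
proof -
  obtain c where c: "\<forall>x\<in>ob j. h \<bullet> x > c" "\<forall>x\<in>ob i \<union> ob l. h \<bullet> x < c"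
    using assms(5) unfolding separates_def by blast
  have "h \<bullet> (p - a) > 0" "h \<bullet> (b - p) < 0" using c assms(2-4) by (force simp: inner_diff_right)+
  moreover have "a \<noteq> p" "b \<noteq> p" using calculation by auto
  ultimately have "h \<bullet> sgn (p - a) > 0" "h \<bullet> sgn (b - p) < 0"
    by (simp_all add: sgn_div_norm mult_pos_neg)
  then show ?thesis by (simp add: inner_diff_left inner_diff_right inner_commute[of _ h])
qed

text \<open>The cut lies strictly on the inner side of the tangent line at the point of reflection: its
  origin is an interior point of the obstacle, and its direction points inwards because the path
  turns back at the obstacle. The adjacent segments lie on the outer side.\<close>

lemma critical_ray:
  assumes cr: "critical (ob j) a p b" and "a \<in> ob i" "p \<in> ob j" "b \<in> ob l" and h: "separates i j l h"
    and t: "0 \<le> t"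
  shows "zz j + t *\<^sub>R h \<notin> closed_segment a p" "zz j + t *\<^sub>R h \<notin> closed_segment p b"
proof -
  let ?g = "sgn (p - a) - sgn (b - p)"
  have gh: "0 < ?g \<bullet> h" using critical_deflection_pos[OF assms(1-5)] .
  then have "?g \<noteq> 0" by auto
  then have "0 < ?g \<bullet> (zz j - p)"
    using cr zz_interior_ob by (intro inner_pos_interior[of "ob j"]) (auto simp: critical_def)
  moreover have "?g \<bullet> (zz j + t *\<^sub>R h - p) = ?g \<bullet> (zz j - p) + t * (?g \<bullet> h)"
    by (simp add: inner_diff_right inner_add_right)
  ultimately have "0 < ?g \<bullet> (zz j + t *\<^sub>R h - p)" using gh t by (simp add: add_pos_nonneg)
  then show "zz j + t *\<^sub>R h \<notin> closed_segment a p" "zz j + t *\<^sub>R h \<notin> closed_segment p b"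
    using critical_segments[of "zz j + t *\<^sub>R h" a p b] by (auto simp: not_le[symmetric])
qed

lemma wrap_nonzero_outside:
  assumes "\<And>j. x \<noteq> zz j" shows "wrap x - z \<noteq> 0"
  using assms wrap_eq_zD[of x] by (metis eq_iff_diff_eq_0)

section \<open>Displacement along a segment\<close>

text \<open>The displacement along the folded segment.\<close>

definition segdisp :: "complex \<Rightarrow> complex \<Rightarrow> real" where
  "segdisp p q = (THE d. \<exists>\<theta>. angle_lift 0 1 (\<lambda>t. wrap (linepath p q t) - z) \<theta> \<and> d = \<theta> 1 - \<theta> 0)"

lemma segdisp_eq:
  assumes "\<And>j. closed_segment p q \<inter> interior (ob j) = {}"
    and l: "angle_lift 0 1 (\<lambda>t. wrap (linepath p q t) - z) \<theta>"
  shows "segdisp p q = \<theta> 1 - \<theta> 0"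
  unfolding segdisp_def
proof (rule the_equality)
  show "\<exists>\<theta>'. angle_lift 0 1 (\<lambda>t. wrap (linepath p q t) - z) \<theta>' \<and> \<theta> 1 - \<theta> 0 = \<theta>' 1 - \<theta>' 0"
    using l by blast
  fix d assume "\<exists>\<theta>. angle_lift 0 1 (\<lambda>t. wrap (linepath p q t) - z) \<theta> \<and> d = \<theta> 1 - \<theta> 0"
  then obtain \<theta>' where l': "angle_lift 0 1 (\<lambda>t. wrap (linepath p q t) - z) \<theta>'" "d = \<theta>' 1 - \<theta>' 0" by blast
  have "wrap (linepath p q t) - z \<noteq> 0" if "t \<in> {0..1}" for t
  proof (rule wrap_nonzero_outside)
    fix j
    have "linepath p q t \<in> closed_segment p q" using that by (auto simp: linepath_in_path)
    then show "linepath p q t \<noteq> zz j" using assms(1)[of j] zz_interior_ob[of j] by auto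
  qed
  then show "d = \<theta> 1 - \<theta> 0" using angle_lift_unique[OF l'(1) l] l'(2) by simp
qed

lemma segdisp_straight:
  assumes st: "a \<le> b" "\<And>t. t \<in> {a..b} \<Longrightarrow> c t = c a + (t - a) *\<^sub>R v"
    and avoid: "\<And>j. closed_segment (c a) (c b) \<inter> interior (ob j) = {}"
    and l: "angle_lift a b (\<lambda>t. wrap (c t) - z) \<theta>"
  shows "segdisp (c a) (c b) = \<theta> b - \<theta> a"
proof -
  define f where "f u = a + u * (b - a)" for u
  have f: "f u \<in> {a..b}" "linepath (c a) (c b) u = c (f u)" if "u \<in> {0..1}" for u
    using straight_linepath[OF st that] by (simp_all add: f_def)
  have "angle_lift 0 1 (\<lambda>u. wrap (linepath (c a) (c b) u) - z) (\<theta> \<circ> f)"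
    unfolding angle_lift_def
  proof (intro conjI ballI)
    have "continuous_on {0..1} f" unfolding f_def by (intro continuous_intros)
    moreover have "continuous_on {a..b} \<theta>" "f ` {0..1} \<subseteq> {a..b}"
      using l f(1) by (auto simp: angle_lift_def)
    then have "continuous_on (f ` {0..1}) \<theta>" by (rule continuous_on_subset)
    ultimately show "continuous_on {0..1} (\<theta> \<circ> f)" by (rule continuous_on_compose)
    show "is_Arg (wrap (linepath (c a) (c b) u) - z) (2 * pi * (\<theta> \<circ> f) u)" if "u \<in> {0..1}" for u
      using l f[OF that] by (simp add: angle_lift_def)
  qed
  from segdisp_eq[OF avoid this] show ?thesis by (simp add: f_def)
qed

lemma segdisp_exists:
  assumes "\<And>j. closed_segment p q \<inter> interior (ob j) = {}"
  obtains \<theta> where "angle_lift 0 1 (\<lambda>t. wrap (linepath p q t) - z) \<theta>"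
proof -
  have "continuous_on {0..1} (\<lambda>t. wrap (linepath p q t) - z)"
    by (intro continuous_intros continuous_on_linepath)
  moreover have "wrap (linepath p q t) - z \<noteq> 0" if "t \<in> {0..1}" for t
  proof (rule wrap_nonzero_outside)
    fix j
    have "linepath p q t \<in> closed_segment p q" using that by (auto simp: linepath_in_path)
    then show "linepath p q t \<noteq> zz j" using assms(1)[of j] zz_interior_ob[of j] by auto
  qed
  ultimately show thesis
    using angle_function_exists[of "{0..1}" "\<lambda>t. wrap (linepath p q t) - z"] that
    unfolding angle_lift_def by (metis convex_real_interval(5))
qed

lemma segdisp_bound:
  assumes "\<And>j. closed_segment p q \<inter> interior (ob j) = {}"
  shows "\<bar>segdisp p q\<bar> \<le> dist p q / \<rho> + 2"
proof -
  obtain \<theta> where l: "angle_lift 0 1 (\<lambda>t. wrap (linepath p q t) - z) \<theta>" using segdisp_exists[OF assms] .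
  have "\<bar>\<theta> 1 - \<theta> 0\<bar> \<le> dist p q * (1 - 0) / \<rho> + 2"
  proof (rule angle_lift_Lipschitz[OF l _ rho_pos])
    fix s t :: real assume st: "s \<in> {0..1}" "t \<in> {0..1}"
    have "norm (wrap (linepath p q s) - z - (wrap (linepath p q t) - z)) = dist (wrap (linepath p q s)) (wrap (linepath p q t))"
      by (simp add: dist_norm)
    also have "\<dots> \<le> dist (linepath p q s) (linepath p q t)" by (rule wrap_dist)
    also have "linepath p q s - linepath p q t = (s - t) *\<^sub>R (q - p)" by (simp add: linepath_def algebra_simps)
    then have "dist (linepath p q s) (linepath p q t) = dist p q * \<bar>s - t\<bar>"
      by (simp add: dist_norm norm_minus_commute)
    finally show "norm (wrap (linepath p q s) - z - (wrap (linepath p q t) - z)) \<le> dist p q * \<bar>s - t\<bar>" .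
  next
    fix t :: real assume "t \<in> {0..1}"
    then have "linepath p q t \<in> closed_segment p q" by (auto simp: linepath_in_path)
    then show "\<rho> \<le> norm (wrap (linepath p q t) - z)" using assms by (intro norm_wrap_ge) auto
  qed simp
  then show ?thesis using segdisp_eq[OF assms l] by simp
qed

lemma segdisp_place: "segdisp (place g p) (place g q) = segdisp p q"
  unfolding segdisp_def by (simp add: place_linepath[symmetric])

text \<open>On the hull of two consecutive obstacles the map \<open>wrap x - z\<close> vanishes exactly at \<open>zz i\<close>
  and \<open>zz j\<close>, where it agrees locally with the factor \<open>lin i (x - zz i)\<close> or \<open>lin j (x - zz j)\<close>.
  The quotient by both factors therefore extends to a continuous map without zeros on a convex set,
  and this map has a logarithm.\<close>

lemma log_of_fold_minus_centres:
  assumes ij: "i \<noteq> j" and nb: "\<nexists>k. between K k i j"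
  obtains \<gamma> where "continuous_on (convex hull (ob i \<union> ob j)) \<gamma>"
    "\<And>x. x \<in> convex hull (ob i \<union> ob j) \<Longrightarrow> wrap x - z = exp (\<gamma> x) * (lin i (x - zz i) * lin j (x - zz j))"
    "\<And>x. x \<in> ob i \<Longrightarrow> exp (\<gamma> x) * lin j (x - zz j) = 1"
    "\<And>x. x \<in> ob j \<Longrightarrow> exp (\<gamma> x) * lin i (x - zz i) = 1"
proof -
  define H where "H = convex hull (ob i \<union> ob j)"
  define G where "G x = (if x \<in> ob i then 1 / lin j (x - zz j) else if x \<in> ob j then 1 / lin i (x - zz i)
    else (wrap x - z) / (lin i (x - zz i) * lin j (x - zz j)))" for x
  have sub: "ob i \<subseteq> H" "ob j \<subseteq> H" by (auto simp: H_def hull_inc)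
  have nij: "x \<notin> ob j" if "x \<in> ob i" for x using ob_disjoint[OF ij] that by blast
  have zi: "zz i \<notin> ob j" "zz j \<notin> ob i" using nij zz_in_ob by blast+
  have other: "x \<notin> ob k" if "x \<in> H" "k \<noteq> i" "k \<noteq> j" for x k
    using nb that unfolding between_def H_def by blast
  have G1: "G x = 1 / lin j (x - zz j)" if "x \<in> ob i" for x using that by (simp add: G_def)
  have G2: "G x = 1 / lin i (x - zz i)" if "x \<in> ob j" for x using that nij by (auto simp: G_def)
  have G3: "G x = (wrap x - z) / (lin i (x - zz i) * lin j (x - zz j))" if "x \<noteq> zz i" "x \<noteq> zz j" for x
    using that wrap_ob[of x i] wrap_ob[of x j] by (auto simp: G_def)
  have nz: "G x \<noteq> 0" if x: "x \<in> H" for x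
  proof (cases "x = zz i \<or> x = zz j")
    case True
    then show ?thesis using zi G1[of "zz i"] G2[of "zz j"] zz_in_ob[of i] zz_in_ob[of j] by auto
  next
    case False
    have "x \<noteq> zz k" for k using other[OF x, of k] zz_in_ob[of k] False by blast
    then have "wrap x - z \<noteq> 0" by (rule wrap_nonzero_outside)
    then show ?thesis using False by (simp add: G3)
  qed
  have cont1: "continuous_on (H - {zz i, zz j}) G"
  proof (rule continuous_on_cong[THEN iffD2, OF refl])
    show "continuous_on (H - {zz i, zz j}) (\<lambda>x. (wrap x - z) / (lin i (x - zz i) * lin j (x - zz j)))"
      by (intro continuous_intros) auto
  qed (auto simp: G3)
  have cont2: "continuous_on (interior (ob i)) G"
  proof (rule continuous_on_cong[THEN iffD2, OF refl])
    show "continuous_on (interior (ob i)) (\<lambda>x. 1 / lin j (x - zz j))"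
      using zi interior_subset by (intro continuous_intros) auto
  qed (use interior_subset[of "ob i"] in \<open>auto simp: G1\<close>)
  have cont3: "continuous_on (interior (ob j)) G"
  proof (rule continuous_on_cong[THEN iffD2, OF refl])
    show "continuous_on (interior (ob j)) (\<lambda>x. 1 / lin i (x - zz i))"
      using zi interior_subset by (intro continuous_intros) auto
  qed (use interior_subset[of "ob j"] in \<open>auto simp: G2\<close>)
  have "continuous_on H G"
    unfolding continuous_on_eq_continuous_within
  proof
    fix x assume x: "x \<in> H"
    consider "x = zz i" | "x = zz j" | "x \<noteq> zz i" "x \<noteq> zz j" by blast
    then show "continuous (at x within H) G"
    proof cases
      case 1
      then have "continuous (at x) G"
        using cont2 zz_interior_ob by (simp add: continuous_on_eq_continuous_at)
      then show ?thesis by (rule continuous_at_imp_continuous_at_within)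
    next
      case 2
      then have "continuous (at x) G"
        using cont3 zz_interior_ob by (simp add: continuous_on_eq_continuous_at)
      then show ?thesis by (rule continuous_at_imp_continuous_at_within)
    next
      case 3
      have "continuous (at x within H - {zz i, zz j}) G"
        using cont1 x 3 by (auto simp: continuous_on_eq_continuous_within)
      moreover have "at x within H - {zz i, zz j} = at x within H"
        using 3 by (intro at_within_nhd[of _ "- {zz i, zz j}"]) (auto intro: open_Compl)
      ultimately show ?thesis by simp
    qed
  qed
  moreover have "contractible H" unfolding H_def by (intro convex_imp_contractible convex_convex_hull)
  ultimately obtain \<gamma> where \<gamma>: "continuous_on H \<gamma>" "\<And>x. x \<in> H \<Longrightarrow> G x = exp (\<gamma> x)"
    using continuous_logarithm_on_contractible[of H G] nz by blast
  show thesis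
  proof
    show "continuous_on (convex hull (ob i \<union> ob j)) \<gamma>" using \<gamma>(1) by (simp add: H_def)
    fix x assume "x \<in> ob i"
    then show "exp (\<gamma> x) * lin j (x - zz j) = 1"       using \<gamma>(2)[of x, symmetric] G1[of x] sub zi by auto
  next
    fix x assume "x \<in> ob j"
    then show "exp (\<gamma> x) * lin i (x - zz i) = 1"       using \<gamma>(2)[of x, symmetric] G2[of x] sub zi by auto
  next
    fix x assume "x \<in> convex hull (ob i \<union> ob j)"
    then have x: "x \<in> H" by (simp add: H_def)
    have "wrap (zz k) = z" for k using z_in_K K_subset_square by (auto simp: wrap_id)
    then show "wrap x - z = exp (\<gamma> x) * (lin i (x - zz i) * lin j (x - zz j))"
      using \<gamma>(2)[OF x] G3[of x] by (cases "x = zz i \<or> x = zz j") auto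
  qed
qed

lemma log_angle_constant:
  assumes "connected S" "continuous_on S f" "x \<in> S" "y \<in> S"
    and "\<And>x. x \<in> S \<Longrightarrow> is_Arg (g x) (2 * pi * (f x + b))" "\<And>x. x \<in> S \<Longrightarrow> g x = 1"
  shows "f x = f y"
proof -
  have "f x + b = f y + b"
  proof (rule continuous_Ints_imp_const[OF assms(1) _ _ assms(3,4)])
    show "continuous_on S (\<lambda>x. f x + b)" using assms(2) by (intro continuous_intros)
    have "is_Arg 1 (2 * pi * 0)" by (simp add: is_Arg_def)
    then show "f x + b \<in> \<int>" if "x \<in> S" for x
      using is_Arg_unique_mod[of 1 "f x + b" 0] assms(5,6)[OF that] by simp
  qed
  then show ?thesis by simp
qed

text \<open>Up to a constant that depends only on the two squares and the two cuts, the displacement is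
  the difference of the angles at the end points. The displacement is the increment of the imaginary
  part of the logarithm plus those of the two ray angles. On \<open>ob i\<close> the logarithm and the ray angle
  about \<open>zz j\<close> have a constant sum, since there \<open>wrap x - z\<close> is the factor of \<open>i\<close> alone; similarly on
  \<open>ob j\<close>. Hence only the angle of each end point about the centre of its own obstacle survives.\<close>

lemma segment_displacement_formula:
  assumes ij: "i \<noteq> j" and nb: "\<nexists>k. between K k i j" and h: "h \<noteq> 0" "h' \<noteq> 0"
    and rays: "\<And>t. 0 \<le> t \<Longrightarrow> zz i + t *\<^sub>R h \<notin> ob j" "\<And>t. 0 \<le> t \<Longrightarrow> zz j + t *\<^sub>R h' \<notin> ob i"
  obtains M where "\<And>p q. \<lbrakk>p \<in> ob i; q \<in> ob j; \<And>m. closed_segment p q \<inter> interior (ob m) = {};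
      \<And>t. 0 \<le> t \<Longrightarrow> zz i + t *\<^sub>R h \<notin> closed_segment p q; \<And>t. 0 \<le> t \<Longrightarrow> zz j + t *\<^sub>R h' \<notin> closed_segment p q\<rbrakk>
    \<Longrightarrow> segdisp p q = ray_angle z j h' q - ray_angle z i h p + M"
proof -
  obtain \<gamma> where \<gamma>: "continuous_on (convex hull (ob i \<union> ob j)) \<gamma>"
    "\<And>x. x \<in> convex hull (ob i \<union> ob j) \<Longrightarrow> wrap x - z = exp (\<gamma> x) * (lin i (x - zz i) * lin j (x - zz j))"
    "\<And>x. x \<in> ob i \<Longrightarrow> exp (\<gamma> x) * lin j (x - zz j) = 1"
    "\<And>x. x \<in> ob j \<Longrightarrow> exp (\<gamma> x) * lin i (x - zz i) = 1"
    using log_of_fold_minus_centres[OF ij nb] by blast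
  define A where "A = ray_angle z i h"
  define B where "B = ray_angle z j h'"
  define \<alpha> where "\<alpha> = Arg (lin i (- h)) / (2 * pi)"
  define \<beta> where "\<beta> = Arg (lin j (- h')) / (2 * pi)"
  define \<Gamma> where "\<Gamma> x = Im (\<gamma> x) / (2 * pi)" for x
  have Aarg: "is_Arg (lin i (x - zz i)) (2 * pi * (A x + \<alpha>))" if "x \<noteq> zz i" for x
    using ray_angle_is_Arg[OF that h(1)] by (simp add: A_def \<alpha>_def distrib_left)
  have Barg: "is_Arg (lin j (x - zz j)) (2 * pi * (B x + \<beta>))" if "x \<noteq> zz j" for x
    using ray_angle_is_Arg[OF that h(2)] by (simp add: B_def \<beta>_def distrib_left)
  have \<Gamma>arg: "is_Arg (exp (\<gamma> x)) (2 * pi * \<Gamma> x)" for x using is_Arg_exp_Im[of "\<gamma> x"] by (simp add: \<Gamma>_def)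
  have \<Gamma>cont: "continuous_on S \<Gamma>" if "S \<subseteq> convex hull (ob i \<union> ob j)" for S
    unfolding \<Gamma>_def using continuous_on_subset[OF \<gamma>(1) that] by (intro continuous_intros) auto
  have sub: "ob i \<subseteq> convex hull (ob i \<union> ob j)" "ob j \<subseteq> convex hull (ob i \<union> ob j)"
    by (auto simp: hull_inc)
  have z0: "zz i + 0 *\<^sub>R h \<notin> ob j" "zz j + 0 *\<^sub>R h' \<notin> ob i" by (intro rays order_refl)+
  have zne: "x \<noteq> zz j" if "x \<in> ob i" for x using z0(2) that by auto
  have zne': "x \<noteq> zz i" if "x \<in> ob j" for x using z0(1) that by auto
  have const_i: "\<Gamma> x + B x = \<Gamma> (zz i) + B (zz i)" if x: "x \<in> ob i" for x
  proof (rule log_angle_constant[OF convex_connected[OF convex_ob] _ x zz_in_ob _ \<gamma>(3)])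
    have "continuous_on (ob i) B"
      unfolding B_def using rays(2) by (intro continuous_on_ray_angle h) auto
    then show "continuous_on (ob i) (\<lambda>x. \<Gamma> x + B x)" by (intro continuous_intros \<Gamma>cont sub)
    fix x assume x: "x \<in> ob i"
    have "is_Arg (exp (\<gamma> x) * lin j (x - zz j)) (2 * pi * \<Gamma> x + 2 * pi * (B x + \<beta>))"
      using zne[OF x] by (intro is_Arg_mult \<Gamma>arg Barg)
    then show "is_Arg (exp (\<gamma> x) * lin j (x - zz j)) (2 * pi * (\<Gamma> x + B x + \<beta>))"
      by (simp add: algebra_simps)
  qed
  have const_j: "\<Gamma> x + A x = \<Gamma> (zz j) + A (zz j)" if x: "x \<in> ob j" for x
  proof (rule log_angle_constant[OF convex_connected[OF convex_ob] _ x zz_in_ob _ \<gamma>(4)])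
    have "continuous_on (ob j) A"
      unfolding A_def using rays(1) by (intro continuous_on_ray_angle h) auto
    then show "continuous_on (ob j) (\<lambda>x. \<Gamma> x + A x)" by (intro continuous_intros \<Gamma>cont sub)
    fix x assume x: "x \<in> ob j"
    have "is_Arg (exp (\<gamma> x) * lin i (x - zz i)) (2 * pi * \<Gamma> x + 2 * pi * (A x + \<alpha>))"
      using zne'[OF x] by (intro is_Arg_mult \<Gamma>arg Aarg)
    then show "is_Arg (exp (\<gamma> x) * lin i (x - zz i)) (2 * pi * (\<Gamma> x + A x + \<alpha>))"
      by (simp add: algebra_simps)
  qed
  define M where "M = (\<Gamma> (zz j) + A (zz j)) - (\<Gamma> (zz i) + B (zz i))"
  show thesis
  proof
    fix p q assume p: "p \<in> ob i" and q: "q \<in> ob j"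
      and avoid: "\<And>m. closed_segment p q \<inter> interior (ob m) = {}"
      and r1: "\<And>t. 0 \<le> t \<Longrightarrow> zz i + t *\<^sub>R h \<notin> closed_segment p q"
      and r2: "\<And>t. 0 \<le> t \<Longrightarrow> zz j + t *\<^sub>R h' \<notin> closed_segment p q"
    define \<theta> where "\<theta> t = \<Gamma> (linepath p q t) + A (linepath p q t) + B (linepath p q t) + \<alpha> + \<beta>" for t
    have img: "linepath p q ` {0..1} = closed_segment p q" using path_image_linepath[of p q] by (simp add: path_image_def)
    have seg: "closed_segment p q \<subseteq> convex hull (ob i \<union> ob j)"
      unfolding segment_convex_hull using p q by (intro hull_mono) auto
    have "angle_lift 0 1 (\<lambda>t. wrap (linepath p q t) - z) \<theta>"
      unfolding angle_lift_def
    proof (intro conjI ballI)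
      have "continuous_on (closed_segment p q) A" "continuous_on (closed_segment p q) B"
        unfolding A_def B_def using r1 r2 by (intro continuous_on_ray_angle h; auto)+
      then have "continuous_on {0..1} (A \<circ> linepath p q)" "continuous_on {0..1} (B \<circ> linepath p q)"
        "continuous_on {0..1} (\<Gamma> \<circ> linepath p q)"
        using \<Gamma>cont[OF seg] img continuous_on_compose[OF continuous_on_linepath] by metis+
      then show "continuous_on {0..1} \<theta>" unfolding \<theta>_def o_def by (intro continuous_intros)
      fix t :: real assume t: "t \<in> {0..1}"
      define x where "x = linepath p q t"
      have x: "x \<in> closed_segment p q" using t img unfolding x_def by blast
      then have "x \<in> convex hull (ob i \<union> ob j)" using seg by blast
      have "x \<noteq> zz m" for m using avoid[of m] x zz_interior_ob[of m] by blast
      then have "is_Arg (exp (\<gamma> x) * (lin i (x - zz i) * lin j (x - zz j)))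
          (2 * pi * \<Gamma> x + (2 * pi * (A x + \<alpha>) + 2 * pi * (B x + \<beta>)))"
        by (intro is_Arg_mult \<Gamma>arg Aarg Barg)
      then show "is_Arg (wrap (linepath p q t) - z) (2 * pi * \<theta> t)"
        unfolding \<theta>_def x_def[symmetric] \<gamma>(2)[OF \<open>x \<in> convex hull (ob i \<union> ob j)\<close>] by (simp add: algebra_simps)
    qed
    then have "segdisp p q = \<theta> 1 - \<theta> 0" by (rule segdisp_eq[OF avoid])
    also have "\<dots> = (\<Gamma> q + A q) + B q - (\<Gamma> p + B p) - A p"
      by (simp add: \<theta>_def linepath_0' linepath_1')
    also have "\<dots> = B q - A p + M" unfolding const_i[OF p] const_j[OF q] M_def by simp
    finally show "segdisp p q = ray_angle z j h' q - ray_angle z i h p + M" by (simp add: A_def B_def)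
  qed
qed

section \<open>Comparing chains of the same type\<close>

definition chain_length :: "(nat \<Rightarrow> complex) \<Rightarrow> nat \<Rightarrow> real" where
  "chain_length p s = (\<Sum>i<s. dist (p i) (p (Suc i)))"

definition chain_disp :: "(nat \<Rightarrow> complex) \<Rightarrow> nat \<Rightarrow> real" where
  "chain_disp p s = (\<Sum>i<s. segdisp (p i) (p (Suc i)))"

lemma ob_diameter: "x \<in> ob k \<Longrightarrow> y \<in> ob k \<Longrightarrow> dist x y \<le> 1"
  using ob_near_centre[of x k] ob_near_centre[of y k] dist_triangle2[of x y "centre k"] two_r_less_1 by linarith

text \<open>The length is a convex function of the vertices, and a chain is critical at its inner
  vertices; so it is almost the shortest broken line through the obstacles, the error coming from
  its two free ends. By the inequality of Cauchy and Schwarz, each segment of \<open>q\<close> is at least as long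
  as its projection to the direction of the corresponding segment of \<open>p\<close>, and the criticality
  conditions sum up the differences.\<close>

lemma chain_length_le:
  assumes "chain s k p" and q: "\<And>i. i \<le> s \<Longrightarrow> q i \<in> ob (k i)"
  shows "chain_length p s \<le> chain_length q s + 2"
proof (cases s)
  case 0
  then show ?thesis by (simp add: chain_length_def)
next
  case (Suc m)
  define w where "w i = sgn (p (Suc i) - p i)" for i
  define e where "e i = q i - p i" for i
  have p: "\<And>i. i \<le> s \<Longrightarrow> p i \<in> ob (k i)" using assms(1) by (simp add: chain_def)
  have wn: "norm (w i) \<le> 1" for i by (simp add: w_def norm_sgn)
  have e1: "norm (e i) \<le> 1" if "i \<le> s" for i
    using ob_diameter[OF q[OF that] p[OF that]] by (simp add: e_def dist_norm)
  have we: "\<bar>w i \<bullet> e j\<bar> \<le> 1" if "j \<le> s" for i j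
    using Cauchy_Schwarz_ineq2[of "w i" "e j"] mult_mono[OF wn[of i] e1[OF that]] by simp
  have step: "dist (p i) (p (Suc i)) + w i \<bullet> (e (Suc i) - e i) \<le> dist (q i) (q (Suc i))" for i
  proof -
    have "w i \<bullet> (p (Suc i) - p i) = dist (p i) (p (Suc i))"
      by (cases "p (Suc i) = p i")
        (simp_all add: w_def sgn_div_norm dist_norm dot_square_norm power2_eq_square norm_minus_commute)
    then have "dist (p i) (p (Suc i)) + w i \<bullet> (e (Suc i) - e i) = w i \<bullet> (q (Suc i) - q i)"
      by (simp add: e_def inner_diff_right)
    also have "\<dots> \<le> norm (w i) * norm (q (Suc i) - q i)" by (rule norm_cauchy_schwarz)
    also have "\<dots> \<le> 1 * norm (q (Suc i) - q i)" using wn by (intro mult_right_mono) auto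
    finally show ?thesis by (simp add: dist_norm norm_minus_commute)
  qed
  have "w n \<bullet> e (Suc n) - w 0 \<bullet> e 0 \<le> (\<Sum>i<Suc n. w i \<bullet> (e (Suc i) - e i))" if "n < s" for n
    using that
  proof (induction n)
    case (Suc n)
    have "critical (ob (k (Suc n))) (p n) (p (Suc n)) (p (Suc (Suc n)))"
      using assms(1) Suc.prems by (simp add: chain_def)
    then have "0 \<le> (w n - w (Suc n)) \<bullet> e (Suc n)"
      using q[of "Suc n"] Suc.prems by (auto simp: critical_def w_def e_def)
    then show ?case using Suc by (simp add: inner_diff_left inner_diff_right)
  qed (simp add: inner_diff_right)
  from this[of m] have "-2 \<le> (\<Sum>i<s. w i \<bullet> (e (Suc i) - e i))"
    using we[of s m] we[of 0 0] Suc by auto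
  moreover have "chain_length p s + (\<Sum>i<s. w i \<bullet> (e (Suc i) - e i)) \<le> chain_length q s"
    unfolding chain_length_def sum.distrib[symmetric] by (intro sum_mono step)
  ultimately show ?thesis by simp
qed

lemma chain_length_compare:
  "chain s k p \<Longrightarrow> chain s k q \<Longrightarrow> \<bar>chain_length p s - chain_length q s\<bar> \<le> 2"
  using chain_length_le[of s k p q] chain_length_le[of s k q p] by (auto simp: chain_def)

definition vertex_dir :: "(nat \<Rightarrow> int \<times> int) \<Rightarrow> nat \<Rightarrow> complex" where
  "vertex_dir k i = back_dir (k (i - 1)) (k i) (k (Suc i))"

definition vertex_angle :: "(nat \<Rightarrow> int \<times> int) \<Rightarrow> (nat \<Rightarrow> complex) \<Rightarrow> nat \<Rightarrow> real" where
  "vertex_angle k p i = ray_angle z (k i) (vertex_dir k i) (p i)"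

lemma separates_vertex_dir:
  assumes "adm_type s k" "Suc i < s"
  shows "separates (k i) (k (Suc i)) (k (Suc (Suc i))) (vertex_dir k (Suc i))"
proof -
  have "k (Suc i) \<noteq> k i" "k (Suc (Suc i)) \<noteq> k (Suc i)" "\<not> between K (k (Suc i)) (k i) (k (Suc (Suc i)))"
    using assms unfolding adm_type_def by auto
  then show ?thesis unfolding vertex_dir_def by (auto intro!: separates_back)
qed

lemma chain_ray_avoids:
  assumes "chain s k p" "adm_type s k" "Suc i < s" "0 \<le> t"
  shows "zz (k (Suc i)) + t *\<^sub>R vertex_dir k (Suc i) \<notin> closed_segment (p i) (p (Suc i))"
    "zz (k (Suc i)) + t *\<^sub>R vertex_dir k (Suc i) \<notin> closed_segment (p (Suc i)) (p (Suc (Suc i)))"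
  using critical_ray[OF _ _ _ _ separates_vertex_dir[OF assms(2,3)] assms(4), of "p i" "p (Suc i)" "p (Suc (Suc i))"]
    assms(1,3) unfolding chain_def by auto

text \<open>The cut at a vertex serves the segment that arrives there and the segment that leaves, so
  these differences telescope along a chain.\<close>

lemma interior_segment_compare:
  assumes k: "adm_type s k" and p: "chain s k p" and q: "chain s k q" and i: "Suc (Suc i) < s"
  shows "segdisp (p (Suc i)) (p (Suc (Suc i))) - segdisp (q (Suc i)) (q (Suc (Suc i))) =
     (vertex_angle k p (Suc (Suc i)) - vertex_angle k q (Suc (Suc i)))
     - (vertex_angle k p (Suc i) - vertex_angle k q (Suc i))"
proof -
  have sep: "separates (k i) (k (Suc i)) (k (Suc (Suc i))) (vertex_dir k (Suc i))"
    "separates (k (Suc i)) (k (Suc (Suc i))) (k (Suc (Suc (Suc i)))) (vertex_dir k (Suc (Suc i)))"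
    using i by (auto intro!: separates_vertex_dir[OF k])
  have ne: "k (Suc i) \<noteq> k (Suc (Suc i))" "\<nexists>j. between K j (k (Suc i)) (k (Suc (Suc i)))"
    using k i unfolding adm_type_def by (metis Suc_lessD)+
  obtain M where M: "\<And>p q. \<lbrakk>p \<in> ob (k (Suc i)); q \<in> ob (k (Suc (Suc i))); \<And>m. closed_segment p q \<inter> interior (ob m) = {};
      \<And>t. 0 \<le> t \<Longrightarrow> zz (k (Suc i)) + t *\<^sub>R vertex_dir k (Suc i) \<notin> closed_segment p q;
      \<And>t. 0 \<le> t \<Longrightarrow> zz (k (Suc (Suc i))) + t *\<^sub>R vertex_dir k (Suc (Suc i)) \<notin> closed_segment p q\<rbrakk>
    \<Longrightarrow> segdisp p q = ray_angle z (k (Suc (Suc i))) (vertex_dir k (Suc (Suc i))) q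
       - ray_angle z (k (Suc i)) (vertex_dir k (Suc i)) p + M"
    using segment_displacement_formula[OF ne separates_nonzero[OF sep(1)] separates_nonzero[OF sep(2)]
      separates_ray[OF sep(1)] separates_ray[OF sep(2)]] by blast
  have *: "segdisp (p (Suc i)) (p (Suc (Suc i))) = vertex_angle k p (Suc (Suc i)) - vertex_angle k p (Suc i) + M"
    if "chain s k p" for p
    unfolding vertex_angle_def
  proof (rule M)
    show "p (Suc i) \<in> ob (k (Suc i))" "p (Suc (Suc i)) \<in> ob (k (Suc (Suc i)))"
      using chain_point[OF that] i by auto
    show "closed_segment (p (Suc i)) (p (Suc (Suc i))) \<inter> interior (ob m) = {}" for m
      using chain_segment[OF that, of "Suc i"] i by auto
  qed (use chain_ray_avoids[OF that k] i in auto)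
  show ?thesis unfolding *[OF p] *[OF q] by simp
qed

text \<open>The first and the last vertex have no separating direction. Their segments contribute at
  most \<open>B\<close> each to either chain, and the remaining differences telescope to those at the second and
  the last but one vertex.\<close>

lemma chain_disp_compare:
  assumes k: "adm_type s k" and p: "chain s k p" and q: "chain s k q"
    and B: "\<And>i. i < s \<Longrightarrow> \<bar>segdisp (p i) (p (Suc i))\<bar> \<le> B \<and> \<bar>segdisp (q i) (q (Suc i))\<bar> \<le> B"
    and "0 \<le> B"
  shows "\<bar>chain_disp p s - chain_disp q s\<bar> \<le> 2 + 4 * B"
proof -
  define A where "A i = vertex_angle k p i - vertex_angle k q i" for i
  define d where "d i = segdisp (p i) (p (Suc i)) - segdisp (q i) (q (Suc i))" for i
  have A: "\<bar>A i\<bar> \<le> 1" for i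
    using ray_angle_bound[of z "k i" "vertex_dir k i" "p i"] ray_angle_bound[of z "k i" "vertex_dir k i" "q i"]
    unfolding A_def vertex_angle_def by linarith
  have dB: "\<bar>d i\<bar> \<le> 2 * B" if "i < s" for i using B[OF that] unfolding d_def by linarith
  have eq: "chain_disp p s - chain_disp q s = (\<Sum>i<s. d i)"
    unfolding chain_disp_def d_def by (simp add: sum_subtractf)
  have mid: "(\<Sum>i<n. d (Suc i)) = A (Suc n) - A 1" if "Suc n < s" for n
    using that
  proof (induction n)
    case (Suc n)
    then have "d (Suc n) = A (Suc (Suc n)) - A (Suc n)"
      unfolding d_def A_def by (intro interior_segment_compare[OF k p q])
    then show ?case using Suc by simp
  qed simp
  consider "s = 0" | "s = 1" | n where "s = Suc (Suc n)"
    by (metis One_nat_def not0_implies_Suc)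
  then show ?thesis
  proof cases
    case 1
    then show ?thesis using \<open>0 \<le> B\<close> eq by simp
  next
    case 2
    then show ?thesis using dB[of 0] eq by simp
  next
    case (3 n)
    have "(\<Sum>i<s. d i) = d 0 + (\<Sum>i<n. d (Suc i)) + d (Suc n)"
      unfolding 3 sum.lessThan_Suc[of d "Suc n"] sum.lessThan_Suc_shift[of d n] ..
    also have "\<dots> = d 0 + (A (Suc n) - A 1) + d (Suc n)" using mid[of n] 3 by simp
    finally have "chain_disp p s - chain_disp q s = d 0 + (A (Suc n) - A 1) + d (Suc n)" using eq by simp
    then show ?thesis using A[of "Suc n"] A[of 1] dB[of 0] dB[of "Suc n"] 3 by auto
  qed
qed

end

section \<open>Words of steps\<close>

text \<open>The square reached after \<open>n\<close> steps of the word \<open>w\<close>, each step being taken in the local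
  coordinates of the square where it starts.\<close>

definition pos :: "(int \<times> int) list \<Rightarrow> nat \<Rightarrow> int \<times> int" where
  "pos w n = foldl (\<odot>) (0, 0) (take n w)"

lemma foldl_sq_mult: "foldl (\<odot>) (g \<odot> k) w = g \<odot> foldl (\<odot>) k w"
  by (induction w arbitrary: k) (simp_all add: sq_mult_assoc)

lemma pos_0 [simp]: "pos w 0 = (0, 0)"
  by (simp add: pos_def)

lemma pos_Suc: "n < length w \<Longrightarrow> pos w (Suc n) = pos w n \<odot> w ! n"
  by (simp add: pos_def take_Suc_conv_app_nth)

lemma pos_append_left: "n \<le> length v \<Longrightarrow> pos (v @ w) n = pos v n"
  by (simp add: pos_def)

lemma pos_append_right: "pos (v @ w) (length v + i) = pos v (length v) \<odot> pos w i"
  using foldl_sq_mult[of "foldl (\<odot>) (0, 0) v" "(0, 0)" "take i w"] by (simp add: pos_def)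

context small_obstacle
begin

lemma adm_type_mono: "adm_type s k \<Longrightarrow> m \<le> s \<Longrightarrow> adm_type m k"
  unfolding adm_type_def by (meson less_le_trans)

lemma adm_type_cong: "adm_type s k \<Longrightarrow> (\<And>i. i \<le> s \<Longrightarrow> k i = k' i) \<Longrightarrow> adm_type s k'"
  unfolding adm_type_def by (simp add: Suc_le_eq)

lemma chain_cong: "chain s k p \<Longrightarrow> (\<And>i. i \<le> s \<Longrightarrow> k i = k' i) \<Longrightarrow> chain s k' p"
  unfolding chain_def by (metis less_imp_le_nat)

lemma chain_mono: "chain s k p \<Longrightarrow> m \<le> s \<Longrightarrow> chain m k p"
  unfolding chain_def by (meson less_le_trans order_trans)

lemma chain_shift: "chain (m + s) k p \<Longrightarrow> chain s (\<lambda>i. k (m + i)) (\<lambda>i. p (m + i))"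
  using chain_point[of "m + s" k p] chain_critical[of "m + s" k p] chain_segment[of "m + s" k p]
  unfolding chain_def[of s] by simp

lemma critical_place:
  "critical S a p b \<Longrightarrow> critical (place g ` S) (place g a) (place g p) (place g b)"
  unfolding critical_def by (auto simp: place_diff lin_sgn[symmetric] lin_diff[symmetric])

lemma chain_place:
  assumes "chain s k p"
  shows "chain s (\<lambda>i. g \<odot> k i) (\<lambda>i. place g (p i))"
  unfolding chain_def
proof (intro conjI allI impI)
  show "place g (p i) \<in> ob (g \<odot> k i)" if "i \<le> s" for i
    using chain_point[OF assms that] by (simp flip: place_image_comp)
  show "critical (ob (g \<odot> k (Suc i))) (place g (p i)) (place g (p (Suc i))) (place g (p (Suc (Suc i))))"
    if "Suc i < s" for i
    using critical_place[OF chain_critical[OF assms that]] by (simp add: place_image_comp)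
  show "closed_segment (place g (p i)) (place g (p (Suc i))) \<inter> interior (ob j) = {}" if "i < s" for i j
  proof -
    have "ob j = place g ` ob (sq_inv g \<odot> j)" by (simp add: place_image_comp)
    then have "closed_segment (place g (p i)) (place g (p (Suc i))) \<inter> interior (ob j)
      = place g ` (closed_segment (p i) (p (Suc i)) \<inter> interior (ob (sq_inv g \<odot> j)))"
      by (simp only: place_closed_segment[symmetric] interior_place image_Int[OF inj_place])
    then show ?thesis using chain_segment[OF assms that] by simp
  qed
qed

text \<open>In local coordinates the conditions of admissibility concern single steps and pairs of
  consecutive steps only, whence the admissible sequences are the infinite paths in a graph.\<close>

definition good_step :: "int \<times> int \<Rightarrow> bool" where
  "good_step l \<longleftrightarrow> l \<noteq> (0, 0) \<and> (\<nexists>j. between K j (0, 0) l)"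

definition good_turn :: "int \<times> int \<Rightarrow> int \<times> int \<Rightarrow> bool" where
  "good_turn l m \<longleftrightarrow> \<not> between K (0, 0) (sq_inv l) m"

definition good_word :: "(int \<times> int) list \<Rightarrow> bool" where
  "good_word w \<longleftrightarrow> (\<forall>l\<in>set w. good_step l) \<and> successively good_turn w"

lemma good_step_iff: "good_step l \<longleftrightarrow> g \<odot> l \<noteq> g \<and> (\<nexists>j. between K j g (g \<odot> l))"
proof -
  have "(\<exists>j. between K j g (g \<odot> l)) \<longleftrightarrow> (\<exists>j. between K j (0, 0) l)"
    using between_place[of K g _ "(0, 0)" l] by (metis sq_mult_origin(2) sq_mult_inv_cancel(2))
  then show ?thesis unfolding good_step_def by (metis sq_mult_left_cancel sq_mult_origin(2))
qed

lemma good_turn_iff: "good_turn l m \<longleftrightarrow> \<not> between K (g \<odot> l) g (g \<odot> l \<odot> m)"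
proof -
  have "g = g \<odot> l \<odot> sq_inv l" by (simp add: sq_mult_assoc)
  then show ?thesis unfolding good_turn_def
    using between_place[of K "g \<odot> l" "(0, 0)" "sq_inv l" m] by simp
qed

lemma good_word_iff_adm_type: "good_word w \<longleftrightarrow> adm_type (length w) (pos w)"
proof -
  have 1: "good_step (w ! n) \<longleftrightarrow> pos w (Suc n) \<noteq> pos w n \<and> (\<nexists>j. between K j (pos w n) (pos w (Suc n)))"
    if "n < length w" for n
    using that good_step_iff[of "w ! n" "pos w n"] by (simp add: pos_Suc)
  have 2: "good_turn (w ! n) (w ! Suc n) \<longleftrightarrow> \<not> between K (pos w (Suc n)) (pos w n) (pos w (Suc (Suc n)))"
    if "Suc n < length w" for n
    using that good_turn_iff[of "w ! n" "w ! Suc n" "pos w n"] by (simp add: pos_Suc)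
  show ?thesis
    unfolding good_word_def adm_type_def all_set_conv_all_nth successively_conv_nth
    using 1 2 by metis
qed

lemma word_of_type:
  assumes "k 0 = (0, 0)" "adm_type s k"
  obtains w where "length w = s" "good_word w" "\<And>n. n \<le> s \<Longrightarrow> pos w n = k n"
proof -
  define w where "w = map (\<lambda>n. sq_inv (k n) \<odot> k (Suc n)) [0..<s]"
  have len: "length w = s" by (simp add: w_def)
  have pos: "pos w n = k n" if "n \<le> s" for n
    using that
  proof (induction n)
    case (Suc n)
    then show ?case using pos_Suc[of n w] len by (simp add: w_def)
  qed (simp add: assms)
  have "good_word w" unfolding good_word_iff_adm_type len
    using adm_type_cong[OF assms(2)] pos by metis
  with len pos show thesis by (intro that)
qed

definition realizes :: "(int \<times> int) list \<Rightarrow> real \<Rightarrow> real \<Rightarrow> bool" where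
  "realizes w d T \<longleftrightarrow> (\<exists>p. chain (length w) (pos w) p \<and> d = chain_disp p (length w) \<and> T = chain_length p (length w))"

text \<open>The second part of a chain is carried back to the origin by an unfolding map, which leaves
  lengths and displacements unchanged.\<close>

lemma realizes_append:
  assumes "realizes (v @ w) d T"
  obtains d1 T1 d2 T2 where "realizes v d1 T1" "realizes w d2 T2" "d = d1 + d2" "T = T1 + T2"
proof -
  obtain p where p: "chain (length v + length w) (pos (v @ w)) p"
    "d = chain_disp p (length v + length w)" "T = chain_length p (length v + length w)"
    using assms unfolding realizes_def by auto
  have v: "realizes v (chain_disp p (length v)) (chain_length p (length v))"
    unfolding realizes_def using chain_cong[OF chain_mono[OF p(1), of "length v"], of "pos v"]
    by (auto simp: pos_append_left)
  define g where "g = pos v (length v)"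
  define q where "q i = place (sq_inv g) (p (length v + i))" for i
  have "chain (length w) (\<lambda>i. sq_inv g \<odot> pos (v @ w) (length v + i)) q"
    unfolding q_def by (rule chain_place[OF chain_shift[OF p(1)]])
  then have "chain (length w) (pos w) q" by (simp add: pos_append_right g_def)
  then have w: "realizes w (chain_disp q (length w)) (chain_length q (length w))"
    unfolding realizes_def by blast
  have split: "sum f {..<length v + n} = sum f {..<length v} + (\<Sum>i<n. f (length v + i))" for f :: "nat \<Rightarrow> real" and n
    by (induction n) simp_all
  have "chain_disp p (length v + length w) = chain_disp p (length v) + chain_disp q (length w)"
    "chain_length p (length v + length w) = chain_length p (length v) + chain_length q (length w)"
    unfolding chain_disp_def chain_length_def split q_def by (simp_all add: segdisp_place)
  then show thesis using that[OF v w] p(2,3) by simp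
qed

text \<open>Since the steps are bounded, so are the displacements along single segments, and the
  comparison of two chains of the same type costs an error that does not grow with their length.\<close>

lemma uniform_bounds:
  obtains C where "C \<ge> 0"
    "\<And>w d T d' T'. \<lbrakk>good_word w; realizes w d T; realizes w d' T'\<rbrakk> \<Longrightarrow> \<bar>d - d'\<bar> \<le> C \<and> \<bar>T - T'\<bar> \<le> C"
    "\<And>l d T. \<lbrakk>good_step l; realizes [l] d T\<rbrakk> \<Longrightarrow> \<bar>d\<bar> \<le> C \<and> \<bar>T\<bar> \<le> C"
proof -
  obtain R0 where R0: "\<And>i j x y. \<lbrakk>\<nexists>k. between K k i j; x \<in> ob i; y \<in> ob j\<rbrakk> \<Longrightarrow> dist x y \<le> R0"
    using bounded_steps by metis
  define R where "R = max R0 0"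
  define B where "B = R / \<rho> + 2"
  have R: "R \<ge> 0" and B: "B \<ge> 0" using rho_pos by (auto simp: R_def B_def)
  have step: "dist (p i) (p (Suc i)) \<le> R \<and> \<bar>segdisp (p i) (p (Suc i))\<bar> \<le> B"
    if p: "chain s k p" and k: "adm_type s k" and i: "i < s" for s k p i
  proof -
    have "dist (p i) (p (Suc i)) \<le> R0"
      using k i chain_point[OF p, of i] chain_point[OF p, of "Suc i"] unfolding adm_type_def by (intro R0) auto
    then have "dist (p i) (p (Suc i)) \<le> R" by (simp add: R_def)
    moreover from this have "dist (p i) (p (Suc i)) / \<rho> \<le> R / \<rho>" using rho_pos by (simp add: divide_right_mono)
    ultimately show ?thesis using segdisp_bound[OF chain_segment[OF p i]] unfolding B_def by linarith
  qed
  show thesis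
  proof (rule that[of "2 + 4 * B + R"])
    show "0 \<le> 2 + 4 * B + R" using B R by simp
  next
    fix w d T d' T' assume w: "good_word w" and "realizes w d T" "realizes w d' T'"
    then obtain p q where pq: "chain (length w) (pos w) p" "chain (length w) (pos w) q"
      "d = chain_disp p (length w)" "T = chain_length p (length w)"
      "d' = chain_disp q (length w)" "T' = chain_length q (length w)"
      unfolding realizes_def by blast
    have k: "adm_type (length w) (pos w)" using w by (simp add: good_word_iff_adm_type)
    have "\<bar>d - d'\<bar> \<le> 2 + 4 * B" unfolding pq(3,5)
      using step[OF pq(1) k] step[OF pq(2) k] B by (intro chain_disp_compare[OF k pq(1,2)]) auto
    moreover have "\<bar>T - T'\<bar> \<le> 2" unfolding pq(4,6) by (rule chain_length_compare[OF pq(1,2)])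
    ultimately show "\<bar>d - d'\<bar> \<le> 2 + 4 * B + R \<and> \<bar>T - T'\<bar> \<le> 2 + 4 * B + R" using B R by auto
  next
    fix l d T assume l: "good_step l" and "realizes [l] d T"
    then obtain p where p: "chain 1 (pos [l]) p" "d = chain_disp p 1" "T = chain_length p 1"
      unfolding realizes_def by auto
    have "adm_type 1 (pos [l])" using good_word_iff_adm_type[of "[l]"] l by (simp add: good_word_def)
    then have "dist (p 0) (p 1) \<le> R" "\<bar>segdisp (p 0) (p 1)\<bar> \<le> B" using step[OF p(1), of 0] by auto
    then show "\<bar>d\<bar> \<le> 2 + 4 * B + R \<and> \<bar>T\<bar> \<le> 2 + 4 * B + R"
      using B R p(2,3) by (auto simp: chain_disp_def chain_length_def)
  qed
qed

text \<open>A block starts with a vertical and ends with a horizontal step. Such steps of any two blocks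
  are orthogonal, so that blocks can be concatenated in any order.\<close>

definition block :: "(int \<times> int) list \<Rightarrow> bool" where
  "block w \<longleftrightarrow> good_word w \<and> w \<noteq> [] \<and> fst (hd w) = 0 \<and> snd (last w) = 0"

lemma good_step_unit: "\<bar>fst e\<bar> + \<bar>snd e\<bar> = 1 \<Longrightarrow> good_step e"
  using not_between_unit_step unfolding good_step_def by auto

lemma good_turn_obtuse:
  assumes "l \<noteq> (0, 0)" "m \<noteq> (0, 0)" "fst (sq_inv l) * fst m + snd (sq_inv l) * snd m \<ge> 0"
  shows "good_turn l m"
proof -
  have "sq_inv l \<noteq> (0, 0)" using assms(1) sq_mult_inv(1)[of l] by (metis sq_mult_origin(2))
  then show ?thesis unfolding good_turn_def using assms by (intro not_between_obtuse)
qed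

lemma block_append:
  assumes "block v" "block w" shows "block (v @ w)"
proof -
  have "last v \<noteq> (0, 0)" "hd w \<noteq> (0, 0)"
    using assms unfolding block_def good_word_def good_step_def by auto
  then have "good_turn (last v) (hd w)"
    using assms by (intro good_turn_obtuse) (auto simp: block_def sq_inv_def)
  then show ?thesis using assms by (auto simp: block_def good_word_def successively_append_iff)
qed

text \<open>The sign of the added vertical step is chosen such that it forms an angle of at most 90
  degrees, in local coordinates, with the first step of the word; similarly at the end.\<close>

lemma block_extension:
  assumes w: "good_word w" "w \<noteq> []"
  obtains a b where "good_step a" "good_step b" "block ([a] @ w @ [b])"
proof -
  define a :: "int \<times> int" where "a = (0, if snd (hd w) \<ge> 0 then 1 else -1)"
  define b :: "int \<times> int" where "b = (if fst (sq_inv (last w)) \<ge> 0 then 1 else -1, 0)"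
  have ab: "good_step a" "good_step b" by (auto simp: a_def b_def intro!: good_step_unit)
  have nz: "hd w \<noteq> (0, 0)" "last w \<noteq> (0, 0)"
    using w unfolding good_word_def good_step_def by auto
  have "good_turn a (hd w)" using nz by (intro good_turn_obtuse) (auto simp: a_def sq_inv_def sg_def)
  moreover have "good_turn (last w) b" using nz by (intro good_turn_obtuse) (auto simp: b_def)
  ultimately have "block ([a] @ w @ [b])"
    using w ab by (auto simp: block_def good_word_def successively_append_iff successively_Cons a_def b_def)
  with ab show thesis by (rule that)
qed

lemma limit_of_words:
  assumes P: "\<And>m. good_word (P m)" "\<And>m. P (Suc m) = P m @ b m" "\<And>m. b m \<noteq> []"
  obtains k where "k 0 = (0, 0)" "\<And>s. adm_type s k" "\<And>m n. n \<le> length (P m) \<Longrightarrow> k n = pos (P m) n"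
proof -
  have len: "m \<le> length (P m)" for m
  proof (induction m)
    case (Suc m)
    have "0 < length (b m)" using P(3) by blast
    then have "Suc (length (P m)) \<le> length (P (Suc m))" unfolding P(2) length_append by linarith
    with Suc show ?case by linarith
  qed simp
  have pre: "\<exists>v. P (m + j) = P m @ v" for m j
    by (induction j) (auto simp: P(2))
  have agree: "pos (P m) n = pos (P m') n" if "n \<le> length (P m)" "n \<le> length (P m')" for m m' n
  proof (cases "m \<le> m'")
    case True
    then obtain v where "P m' = P m @ v" using pre[of m "m' - m"] by auto
    then show ?thesis using that by (simp add: pos_append_left)
  next
    case False
    then obtain v where "P m = P m' @ v" using pre[of m' "m - m'"] by auto
    then show ?thesis using that by (simp add: pos_append_left)
  qed
  define k where "k n = pos (P n) n" for n
  have k: "k n = pos (P m) n" if "n \<le> length (P m)" for m n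
    unfolding k_def using agree[OF len that] .
  show thesis
  proof
    show "k 0 = (0, 0)" by (simp add: k_def)
    show "k n = pos (P m) n" if "n \<le> length (P m)" for m n by (rule k[OF that])
    fix s
    have "adm_type s (pos (P s))" using P(1)[of s] len[of s] adm_type_mono by (simp add: good_word_iff_adm_type)
    then show "adm_type s k" using k[of _ s] len[of s] by (auto intro: adm_type_cong)
  qed
qed

end

section \<open>From trajectory pieces to chains\<close>

lemma velocities_right_unique:
  assumes "velocities I c t v w" "velocities I c t v' w'" "t < b" "{t..b} \<subseteq> I"
  shows "w = w'"
proof -
  obtain e where e: "e > 0" "\<forall>s\<in>{0..e}. t + s \<in> I \<longrightarrow> c (t + s) = c t + s *\<^sub>R w"
    using assms(1) unfolding velocities_def by blast
  obtain e' where e': "e' > 0" "\<forall>s\<in>{0..e'}. t + s \<in> I \<longrightarrow> c (t + s) = c t + s *\<^sub>R w'"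
    using assms(2) unfolding velocities_def by blast
  define s where "s = min (min e e') (b - t)"
  have s: "s > 0" "s \<in> {0..e}" "s \<in> {0..e'}" "t + s \<in> I"
    using e(1) e'(1) assms(3,4) by (auto simp: s_def)
  then have "s *\<^sub>R w = s *\<^sub>R w'" using e(2) e'(2) by (metis add_left_cancel)
  then show ?thesis using s(1) by simp
qed

lemma velocities_left_unique:
  assumes "velocities I c t v w" "velocities I c t v' w'" "a < t" "{a..t} \<subseteq> I"
  shows "v = v'"
proof -
  obtain e where e: "e > 0" "\<forall>s\<in>{0..e}. t - s \<in> I \<longrightarrow> c (t - s) = c t - s *\<^sub>R v"
    using assms(1) unfolding velocities_def by blast
  obtain e' where e': "e' > 0" "\<forall>s\<in>{0..e'}. t - s \<in> I \<longrightarrow> c (t - s) = c t - s *\<^sub>R v'"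
    using assms(2) unfolding velocities_def by blast
  define s where "s = min (min e e') (t - a)"
  have s: "s > 0" "s \<in> {0..e}" "s \<in> {0..e'}" "t - s \<in> I"
    using e(1) e'(1) assms(3,4) by (auto simp: s_def)
  then have "c t - s *\<^sub>R v = c t - s *\<^sub>R v'" using e(2) e'(2) by metis
  then show ?thesis using s(1) by simp
qed

lemma velocities_subset: "velocities I c t v w \<Longrightarrow> J \<subseteq> I \<Longrightarrow> velocities J c t v w"
  unfolding velocities_def by blast

lemma straight_velocities:
  assumes "a < b" "norm w = 1" "\<And>t. t \<in> {a..b} \<Longrightarrow> c t = c a + (t - a) *\<^sub>R w"
  shows "velocities {a..b} c a u w \<longleftrightarrow> norm u = 1" "velocities {a..b} c b w u \<longleftrightarrow> norm u = 1"
proof -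
  have "velocities {a..b} c a u w" if "norm u = 1"
    unfolding velocities_def using assms(1,2) that
    by (intro conjI exI[of _ 1] ballI impI) (auto simp: assms(3)[of "a + _"])
  then show "velocities {a..b} c a u w \<longleftrightarrow> norm u = 1" by (auto simp: velocities_def)
  have "velocities {a..b} c b w u" if u: "norm u = 1"
    unfolding velocities_def
  proof (intro conjI exI[of _ 1] ballI impI u assms(2))
    fix s :: real assume "s \<in> {0..1}" "b - s \<in> {a..b}"
    then have "c (b - s) = c a + (b - s - a) *\<^sub>R w" "c b = c a + (b - a) *\<^sub>R w"
      using assms(1) by (auto intro!: assms(3))
    then show "c (b - s) = c b - s *\<^sub>R w" by (simp only:) (simp add: algebra_simps)
  next
    fix s :: real assume "s \<in> {0..1}" "b + s \<in> {a..b}"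
    then have "s = 0" by simp
    then show "c (b + s) = c b + s *\<^sub>R u" by simp
  qed simp
  then show "velocities {a..b} c b w u \<longleftrightarrow> norm u = 1" by (auto simp: velocities_def)
qed

text \<open>Straightness is a local property that passes to unions of adjacent intervals, because no
  change of velocity occurs where they meet; Bolzano's bisection principle makes it global.\<close>

lemma straight_between_reflections:
  assumes ab: "a < b" and vel: "\<And>t. t \<in> {a..b} \<Longrightarrow> \<exists>v w. velocities {a..b} c t v w"
    and same: "\<And>t v w. \<lbrakk>a < t; t < b; velocities {a..b} c t v w\<rbrakk> \<Longrightarrow> v = w"
  obtains w where "norm w = 1" "\<And>t. t \<in> {a..b} \<Longrightarrow> c t = c a + (t - a) *\<^sub>R w"
proof -
  define P where "P x y \<longleftrightarrow> (a \<le> x \<and> x \<le> y \<and> y \<le> b \<longrightarrow>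
    (\<exists>w. norm w = 1 \<and> (\<forall>t\<in>{x..y}. c t = c x + (t - x) *\<^sub>R w)))" for x y
  have "P a b"
  proof (rule Bolzano)
    show "a \<le> b" using ab by simp
  next
    fix x y u assume 1: "P x y" and 2: "P y u" and xyu: "x \<le> y" "y \<le> u"
    show "P x u"
      unfolding P_def
    proof
      assume xu: "a \<le> x \<and> x \<le> u \<and> u \<le> b"
      consider "x = y" | "y = u" | "x < y" "y < u" using xyu by linarith
      then show "\<exists>w. norm w = 1 \<and> (\<forall>t\<in>{x..u}. c t = c x + (t - x) *\<^sub>R w)"
      proof cases
        case 3
        obtain w1 where w1: "norm w1 = 1" "\<And>t. t \<in> {x..y} \<Longrightarrow> c t = c x + (t - x) *\<^sub>R w1"
        proof -
          have "a \<le> x \<and> x \<le> y \<and> y \<le> b" using xu xyu by auto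
          then show thesis using 1 that unfolding P_def by blast
        qed
        obtain w2 where w2: "norm w2 = 1" "\<And>t. t \<in> {y..u} \<Longrightarrow> c t = c y + (t - y) *\<^sub>R w2"
        proof -
          have "a \<le> y \<and> y \<le> u \<and> u \<le> b" using xu xyu by auto
          then show thesis using 2 that unfolding P_def by blast
        qed
        obtain v w where vw: "velocities {a..b} c y v w" using vel[of y] xu xyu by auto
        have "v = w" using same[OF _ _ vw] 3 xu by auto
        moreover have "velocities {x..y} c y v w" using vw xu xyu by (elim velocities_subset) auto
        then have "v = w1"
          using straight_velocities(2)[OF 3(1) w1, of w1] w1(1) 3(1) by (intro velocities_left_unique[of "{x..y}" c y v w w1 w1 x]) auto
        moreover have "velocities {y..u} c y v w" using vw xu xyu by (elim velocities_subset) auto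
        then have "w = w2"
          using straight_velocities(1)[OF 3(2) w2, of w2] w2(1) 3(2) by (intro velocities_right_unique[of "{y..u}" c y v w w2 w2 u]) auto
        ultimately have "w2 = w1" by simp
        have "c t = c x + (t - x) *\<^sub>R w1" if t: "t \<in> {x..u}" for t
        proof (cases "t \<le> y")
          case True
          then show ?thesis using w1(2)[of t] t by simp
        next
          case False
          then have "c t = c y + (t - y) *\<^sub>R w1" using w2(2)[of t] t \<open>w2 = w1\<close> by simp
          then show ?thesis using w1(2)[of y] xyu by (simp add: algebra_simps)
        qed
        then show ?thesis using w1(1) by blast
      qed (use 1 2 xu in \<open>simp_all add: P_def\<close>)
    qed
  next
    fix x assume x: "a \<le> x" "x \<le> b"
    obtain v w where vw: "velocities {a..b} c x v w" using vel[of x] x by auto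
    then obtain e where e: "e > 0" "\<And>s. s \<in> {0..e} \<Longrightarrow> x - s \<in> {a..b} \<Longrightarrow> c (x - s) = c x - s *\<^sub>R v"
       "\<And>s. s \<in> {0..e} \<Longrightarrow> x + s \<in> {a..b} \<Longrightarrow> c (x + s) = c x + s *\<^sub>R w" and n: "norm v = 1" "norm w = 1"
      unfolding velocities_def by blast
    define u where "u = (if x = a then w else v)"
    have "P x1 x2" if x12: "x1 \<le> x" "x \<le> x2" "x2 - x1 < e" for x1 x2
      unfolding P_def
    proof
      assume ax: "a \<le> x1 \<and> x1 \<le> x2 \<and> x2 \<le> b"
      have eq: "c t = c x + (t - x) *\<^sub>R u" if t: "t \<in> {x1..x2}" for t
      proof (cases "t \<le> x")
        case True
        then have "c (x - (x - t)) = c x - (x - t) *\<^sub>R v" using t x12 ax by (intro e(2)) auto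
        moreover have "x = a \<Longrightarrow> t = x" using True t ax by simp
        ultimately show ?thesis by (auto simp: u_def algebra_simps)
      next
        case False
        then have "c (x + (t - x)) = c x + (t - x) *\<^sub>R w" using t x12 ax by (intro e(3)) auto
        moreover have "x \<noteq> a \<Longrightarrow> v = w" using same[OF _ _ vw] False t ax x by auto
        ultimately show ?thesis by (auto simp: u_def)
      qed
      have "norm u = 1" using n by (simp add: u_def)
      moreover have "c t = c x1 + (t - x1) *\<^sub>R u" if "t \<in> {x1..x2}" for t
      proof -
        have "c x1 = c x + (x1 - x) *\<^sub>R u" using x12 by (intro eq) simp
        then show ?thesis unfolding eq[OF that] by (simp add: algebra_simps)
      qed
      ultimately show "\<exists>w. norm w = 1 \<and> (\<forall>t\<in>{x1..x2}. c t = c x1 + (t - x1) *\<^sub>R w)" by blast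
    qed
    then show "\<exists>d>0. \<forall>x1 x2. x1 \<le> x \<and> x \<le> x2 \<and> x2 - x1 < d \<longrightarrow> P x1 x2" using e(1) by blast
  qed
  then have "\<exists>w. norm w = 1 \<and> (\<forall>t\<in>{a..b}. c t = c a + (t - a) *\<^sub>R w)" using ab by (simp add: P_def)
  then show thesis using that by blast
qed

lemma unit_speed_Lipschitz:
  assumes ab: "a \<le> b" and vel: "\<And>t. t \<in> {a..b} \<Longrightarrow> \<exists>v w. velocities {a..b} c t v w"
  shows "dist (c a) (c b) \<le> b - a"
proof -
  define P where "P x y \<longleftrightarrow> (a \<le> x \<and> x \<le> y \<and> y \<le> b \<longrightarrow> dist (c x) (c y) \<le> y - x)" for x y
  have "P a b"
  proof (rule Bolzano[OF ab])
    fix x y u assume "P x y" "P y u" "x \<le> y" "y \<le> u"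
    then show "P x u" using dist_triangle[of "c x" "c u" "c y"] unfolding P_def by auto
  next
    fix x assume x: "a \<le> x" "x \<le> b"
    obtain v w where "velocities {a..b} c x v w" using vel[of x] x by auto
    then obtain e where e: "e > 0" "\<And>s. s \<in> {0..e} \<Longrightarrow> x - s \<in> {a..b} \<Longrightarrow> c (x - s) = c x - s *\<^sub>R v"
       "\<And>s. s \<in> {0..e} \<Longrightarrow> x + s \<in> {a..b} \<Longrightarrow> c (x + s) = c x + s *\<^sub>R w" and n: "norm v = 1" "norm w = 1"
      unfolding velocities_def by blast
    have "P x1 x2" if x12: "x1 \<le> x" "x \<le> x2" "x2 - x1 < e" for x1 x2
      unfolding P_def
    proof
      assume ax: "a \<le> x1 \<and> x1 \<le> x2 \<and> x2 \<le> b"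
      have "c (x - (x - x1)) = c x - (x - x1) *\<^sub>R v" using x12 ax by (intro e(2)) auto
      then have 1: "dist (c x1) (c x) = x - x1" using x12 n by (simp add: dist_norm)
      have "c (x + (x2 - x)) = c x + (x2 - x) *\<^sub>R w" using x12 ax by (intro e(3)) auto
      then have 2: "dist (c x2) (c x) = x2 - x" using x12 n by (simp add: dist_norm)
      show "dist (c x1) (c x2) \<le> x2 - x1" using dist_triangle2[of "c x1" "c x2" "c x"] 1 2 by simp
    qed
    then show "\<exists>d>0. \<forall>x1 x2. x1 \<le> x \<and> x \<le> x2 \<and> x2 - x1 < d \<longrightarrow> P x1 x2" using e(1) by blast
  qed
  then show ?thesis using ab by (simp add: P_def)
qed

text \<open>If the backward ray from \<open>p\<close> is disjoint from the interior of \<open>S\<close> near \<open>p\<close>, then by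
  convexity it is so everywhere, and a line through \<open>p\<close> separates it from \<open>S\<close>. The normal of this line
  is an outer normal at \<open>p\<close>, hence the given one.\<close>

lemma arrival_against_normal:
  fixes S :: "complex set"
  assumes S: "convex S" "closed S" "interior S \<noteq> {}" and p: "p \<in> frontier S"
    and n: "outer_unit_normal S p n" and unique: "\<And>m. outer_unit_normal S p m \<Longrightarrow> m = n"
    and e: "e > 0" "\<And>s. 0 < s \<Longrightarrow> s \<le> e \<Longrightarrow> p - s *\<^sub>R v \<notin> interior S"
  shows "n \<bullet> v \<le> 0"
proof -
  define R where "R = (\<lambda>s. p - s *\<^sub>R v) ` {0..}"
  have pS: "p \<in> S" "p \<notin> interior S" using p S(2) by (auto simp: frontier_def)
  have "convex R"
  proof -
    have "R = (+) p ` (\<lambda>s. s *\<^sub>R (- v)) ` {0..}" by (auto simp: R_def image_image)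
    moreover have "linear (\<lambda>s. s *\<^sub>R (- v))" by (intro linearI) (auto simp: algebra_simps)
    ultimately show ?thesis by (simp add: convex_linear_image convex_translation)
  qed
  have "interior S \<inter> R = {}"
  proof (rule ccontr)
    assume "interior S \<inter> R \<noteq> {}"
    then obtain s where s: "s \<ge> 0" "p - s *\<^sub>R v \<in> interior S" by (auto simp: R_def)
    then have s0: "s > 0" using pS by (cases "s = 0") auto
    define u where "u = min 1 (e / s)"
    have u: "0 < u" "u \<le> 1" "u * s \<le> e" using e(1) s0 by (auto simp: u_def min_def field_simps)
    have "p - u *\<^sub>R (p - (p - s *\<^sub>R v)) \<in> interior S"
      by (rule mem_interior_convex_shrink[OF S(1) s(2) pS(1) u(1,2)])
    then show False using e(2)[of "u * s"] u s0 by simp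
  qed
  moreover have "R \<noteq> {}" by (auto simp: R_def)
  ultimately obtain m b where m: "m \<noteq> 0" "\<And>x. x \<in> interior S \<Longrightarrow> m \<bullet> x \<le> b" "\<And>x. x \<in> R \<Longrightarrow> m \<bullet> x \<ge> b"
    using separating_hyperplane_sets[OF convex_interior[OF S(1)] \<open>convex R\<close> S(3)] by metis
  have "S \<subseteq> closure (interior S)" using convex_closure_interior[OF S(1,3)] closure_subset by auto
  also have "\<dots> \<subseteq> {x. m \<bullet> x \<le> b}" using m(2) by (intro closure_minimal closed_halfspace_le) auto
  finally have mS: "m \<bullet> x \<le> b" if "x \<in> S" for x using that by blast
  have "p \<in> R" "p - v \<in> R" unfolding R_def by (force intro: image_eqI[of _ _ 0] image_eqI[of _ _ 1])+
  then have pb: "m \<bullet> p = b" "m \<bullet> v \<le> 0" using m(3)[of p] m(3)[of "p - v"] mS[OF pS(1)]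
    by (auto simp: inner_diff_right)
  have "outer_unit_normal S p (sgn m)"
    unfolding outer_unit_normal_def using m(1) mS pb(1)
    by (auto simp: norm_sgn sgn_div_norm inner_diff_right intro!: mult_nonneg_nonpos)
  then have "sgn m = n" by (rule unique)
  then show ?thesis using pb(2) m(1) by (auto simp: sgn_div_norm intro!: mult_nonneg_nonpos)
qed

lemma outer_unit_normal_place:
  "outer_unit_normal (place g ` S) (place g a) n \<longleftrightarrow> outer_unit_normal S a (lin g n)"
proof -
  have "n \<bullet> lin g w = lin g n \<bullet> w" for w using inner_lin[of g n "lin g w"] by simp
  then show ?thesis by (simp add: outer_unit_normal_def place_diff)
qed

lemma reflect_lin: "lin g (reflect n v) = reflect (lin g n) (lin g v)"
  by (simp add: reflect_def lin_diff lin_scaleR)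

context small_obstacle
begin

lemma frontier_ob: "x \<in> frontier (ob k) \<Longrightarrow> x \<in> ob k"
  using closed_ob frontier_subset_eq by blast

lemma unique_normal_ob:
  assumes "x \<in> frontier (ob k)" "outer_unit_normal (ob k) x m" "outer_unit_normal (ob k) x n"
  shows "m = n"
proof -
  obtain a where a: "x = place k a" "a \<in> frontier K" using assms(1) by (auto simp: obst_def frontier_place)
  then have "lin k m = lin k n"
    using assms(2,3) unique_normal[OF a(2)] by (simp add: obst_def outer_unit_normal_place)
  then show ?thesis by (metis lin_lin)
qed

lemma wrap_unfolding: "unfolding_of K I c \<Gamma> \<Longrightarrow> square_trajectory K I c \<Longrightarrow> t \<in> I \<Longrightarrow> wrap (\<Gamma> t) = c t"
  unfolding unfolding_of_def square_trajectory_def billiard_path_def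
  by (metis Diff_iff wrap_id wrap_place)

text \<open>Between reflections the unfolding is straight, so the points of reflection form a broken
  line. At a reflection the velocity changes by a multiple of the outer normal \<open>n\<close>, and the sign of
  the multiple, which criticality needs, comes from the fact that the path arrives from outside.\<close>

theorem chain_of_piece:
  assumes adm: "admissible K (enat s) k" and piece: "piece_of_type K s k T c"
    and disp: "has_displacement z c T d"
  obtains p where "k 0 = (0, 0)" "adm_type s k" "chain s k p" "T = chain_length p s" "d = chain_disp p s"
proof -
  have k0: "k 0 = (0, 0)" and k: "adm_type s k"
    using adm unfolding admissible_def adm_type_def by (simp_all add: Suc_le_eq)
  obtain \<Gamma> \<tau> where sq: "square_trajectory K {0..T} c" and unf: "unfolding_of K {0..T} c \<Gamma>"
    and mono: "strict_mono_on {0..s} \<tau>" and \<tau>0: "\<tau> 0 = 0" and \<tau>s: "\<tau> s = T"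
    and fr: "\<And>n. n \<le> s \<Longrightarrow> \<Gamma> (\<tau> n) \<in> frontier (ob (k n))"
    and refl: "{t. 0 < t \<and> t < T \<and> reflects_at {0..T} \<Gamma> t} = \<tau> ` {1..<s}"
    using piece unfolding piece_of_type_def by auto
  have plane: "\<And>t. t \<in> {0..T} \<Longrightarrow> (\<forall>j. \<Gamma> t \<notin> interior (ob j)) \<and>
      (\<exists>v w. velocities {0..T} \<Gamma> t v w \<and> plane_law K (\<Gamma> t) v w)"
    using unf unfolding unfolding_of_def plane_trajectory_def billiard_path_def by blast
  have less: "\<tau> i < \<tau> j" if "i < j" "j \<le> s" for i j
    using mono that by (intro strict_mono_onD[OF mono]) auto
  have range: "0 \<le> \<tau> i" "\<tau> i \<le> T" if "i \<le> s" for i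
    using less[of 0 i] less[of i s] that \<tau>0 \<tau>s by (cases "i = 0"; cases "i = s"; force)+
  have sub: "{\<tau> i..\<tau> (Suc i)} \<subseteq> {0..T}" if "i < s" for i
    using range[of i] range[of "Suc i"] that by auto
  define p where "p i = \<Gamma> (\<tau> i)" for i
  have "\<exists>w. norm w = 1 \<and> (\<forall>t\<in>{\<tau> i..\<tau> (Suc i)}. \<Gamma> t = \<Gamma> (\<tau> i) + (t - \<tau> i) *\<^sub>R w)" if i: "i < s" for i
  proof -
    have lt: "\<tau> i < \<tau> (Suc i)" using less i by simp
    show ?thesis
    proof (rule straight_between_reflections[OF lt])
      fix t assume "t \<in> {\<tau> i..\<tau> (Suc i)}"
      then show "\<exists>v w. velocities {\<tau> i..\<tau> (Suc i)} \<Gamma> t v w"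
        using plane[of t] sub[OF i] velocities_subset by blast
    next
      fix t v w assume t: "\<tau> i < t" "t < \<tau> (Suc i)" and vel: "velocities {\<tau> i..\<tau> (Suc i)} \<Gamma> t v w"
      have tT: "0 < t" "t < T" using t range[of i] range[of "Suc i"] i by auto
      have "t \<noteq> \<tau> j" if "j \<in> {1..<s}" for j
        using t less[of j i] less[of "Suc i" j] that i by (cases "j < i"; cases "j = i"; cases "j = Suc i"; force)
      then have "\<not> reflects_at {0..T} \<Gamma> t" using refl tT by blast
      moreover obtain v' w' where vw': "velocities {0..T} \<Gamma> t v' w'" using plane[of t] tT by auto
      ultimately have "v' = w'" unfolding reflects_at_def by blast
      moreover have v': "velocities {\<tau> i..\<tau> (Suc i)} \<Gamma> t v' w'" using vw' sub[OF i] by (rule velocities_subset)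
      moreover have "v = v'" using t by (intro velocities_left_unique[OF vel v', of "\<tau> i"]) auto
      moreover have "w = w'" using t by (intro velocities_right_unique[OF vel v', of "\<tau> (Suc i)"]) auto
      ultimately show "v = w" by simp
    qed (use that in blast)
  qed
  then obtain w where w: "\<And>i. i < s \<Longrightarrow> norm (w i) = 1"
    "\<And>i t. \<lbrakk>i < s; t \<in> {\<tau> i..\<tau> (Suc i)}\<rbrakk> \<Longrightarrow> \<Gamma> t = p i + (t - \<tau> i) *\<^sub>R w i"
    unfolding p_def by metis
  have straight_eq: "\<Gamma> t = \<Gamma> (\<tau> i) + (t - \<tau> i) *\<^sub>R w i" if "i < s" "t \<in> {\<tau> i..\<tau> (Suc i)}" for i t
    using w(2)[OF that] by (simp add: p_def)
  have straight: "velocities {\<tau> i..\<tau> (Suc i)} \<Gamma> (\<tau> i) (w i) (w i)"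
    "velocities {\<tau> i..\<tau> (Suc i)} \<Gamma> (\<tau> (Suc i)) (w i) (w i)" if i: "i < s" for i
  proof -
    note sv = straight_velocities[OF less[of i "Suc i"] w(1)[OF i] straight_eq[OF i], of "w i"]
    show "velocities {\<tau> i..\<tau> (Suc i)} \<Gamma> (\<tau> i) (w i) (w i)"
      "velocities {\<tau> i..\<tau> (Suc i)} \<Gamma> (\<tau> (Suc i)) (w i) (w i)"
      using sv w(1)[OF i] i by simp_all
  qed
  have diff: "p (Suc i) - p i = (\<tau> (Suc i) - \<tau> i) *\<^sub>R w i" if "i < s" for i
    using w(2)[OF that, of "\<tau> (Suc i)"] less[of i "Suc i"] that by (simp add: p_def)
  have sgn: "sgn (p (Suc i) - p i) = w i" if "i < s" for i
    unfolding diff[OF that] using w(1)[OF that] less[of i "Suc i"] that by (simp add: sgn_scaleR sgn_div_norm)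
  have dist: "dist (p i) (p (Suc i)) = \<tau> (Suc i) - \<tau> i" if "i < s" for i
  proof -
    have "dist (p i) (p (Suc i)) = norm (p (Suc i) - p i)" by (simp add: dist_norm norm_minus_commute)
    then show ?thesis unfolding diff[OF that] using w(1)[OF that] less[of i "Suc i"] that by simp
  qed
  have chain: "chain s k p"
    unfolding chain_def
  proof (intro conjI allI impI)
    show "p i \<in> ob (k i)" if "i \<le> s" for i using fr[OF that] frontier_ob by (simp add: p_def)
    show "closed_segment (p i) (p (Suc i)) \<inter> interior (ob j) = {}" if i: "i < s" for i j
    proof -
      have "\<tau> i \<le> \<tau> (Suc i)" using less[of i "Suc i"] i by simp
      then have "closed_segment (p i) (p (Suc i)) \<subseteq> \<Gamma> ` {\<tau> i..\<tau> (Suc i)}"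
        unfolding p_def by (rule straight_closed_segment[OF _ straight_eq[OF i]])
      also have "\<dots> \<subseteq> \<Gamma> ` {0..T}" using sub[OF i] by (rule image_mono)
      finally show ?thesis using plane by blast
    qed
    fix i assume i: "Suc i < s"
    define t where "t = \<tau> (Suc i)"
    have t: "t \<in> {0..T}" "\<tau> i < t" "t < \<tau> (Suc (Suc i))" using i range[of "Suc i"] less[of i "Suc i"] less[of "Suc i" "Suc (Suc i)"] by (auto simp: t_def)
    obtain v' w' where vel: "velocities {0..T} \<Gamma> t v' w'" and law: "plane_law K (\<Gamma> t) v' w'" using plane[OF t(1)] by blast
    have v': "v' = w i"
    proof (rule velocities_left_unique[of "{\<tau> i..t}" \<Gamma> t v' w' _ "w i" "\<tau> i"])
      show "velocities {\<tau> i..t} \<Gamma> t v' w'" using vel sub[of i] i by (elim velocities_subset) (auto simp: t_def)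
      show "velocities {\<tau> i..t} \<Gamma> t (w i) (w i)"
        using straight(2)[of i] i by (simp add: t_def)
    qed (use t in auto)
    have w': "w' = w (Suc i)"
    proof (rule velocities_right_unique[of "{t..\<tau> (Suc (Suc i))}" \<Gamma> t v' w' "w (Suc i)" _ "\<tau> (Suc (Suc i))"])
      show "velocities {t..\<tau> (Suc (Suc i))} \<Gamma> t v' w'" using vel sub[of "Suc i"] i by (elim velocities_subset) (auto simp: t_def)
      show "velocities {t..\<tau> (Suc (Suc i))} \<Gamma> t (w (Suc i)) (w (Suc i))"
        using straight(1)[of "Suc i"] i by (simp add: t_def)
    qed (use t in auto)
    have ft: "\<Gamma> t \<in> frontier (ob (k (Suc i)))" using fr[of "Suc i"] i by (simp add: t_def)
    then obtain j n where j: "\<Gamma> t \<in> frontier (ob j)" "outer_unit_normal (ob j) (\<Gamma> t) n" "w' = reflect n v'"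
    proof -
      have "\<exists>j. \<Gamma> t \<in> frontier (ob j)" using ft by blast
      then show thesis using law that unfolding plane_law_def by (simp only: if_True) blast
    qed
    have jk: "j = k (Suc i)" using ob_index_unique[OF frontier_ob[OF j(1)] frontier_ob[OF ft]] .
    have "n \<bullet> v' \<le> 0"
    proof (rule arrival_against_normal[OF convex_ob closed_ob _ j(1,2)])
      show "interior (ob j) \<noteq> {}" using zz_interior_ob by blast
      show "m = n" if "outer_unit_normal (ob j) (\<Gamma> t) m" for m using unique_normal_ob[OF j(1) that j(2)] .
      show "0 < t - \<tau> i" using t by simp
      fix u assume u: "0 < u" "u \<le> t - \<tau> i"
      have "\<Gamma> (t - u) = p i + (t - u - \<tau> i) *\<^sub>R w i" "\<Gamma> t = p i + (t - \<tau> i) *\<^sub>R w i"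
        using w(2)[of i "t - u"] w(2)[of i t] i u t by (auto simp: t_def)
      then have "\<Gamma> t - u *\<^sub>R v' = \<Gamma> (t - u)"
        unfolding v' by (simp only:) (simp add: algebra_simps)
      moreover have "t - u \<in> {0..T}" using u t range[of i] i by auto
      ultimately show "\<Gamma> t - u *\<^sub>R v' \<notin> interior (ob j)" using plane by metis
    qed
    moreover have "n \<bullet> (y - p (Suc i)) \<le> 0" if "y \<in> ob (k (Suc i))" for y
      using j(2) that jk by (simp add: outer_unit_normal_def t_def p_def)
    moreover have "sgn (p (Suc i) - p i) - sgn (p (Suc (Suc i)) - p (Suc i)) = (2 * (v' \<bullet> n)) *\<^sub>R n"
    proof -
      have "w (Suc i) = w i - (2 * (w i \<bullet> n)) *\<^sub>R n" using j(3) unfolding v' w' reflect_def .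
      then show ?thesis using sgn[of i] sgn[of "Suc i"] i v' by simp
    qed
    ultimately show "critical (ob (k (Suc i))) (p i) (p (Suc i)) (p (Suc (Suc i)))"
      unfolding critical_def by (auto simp: inner_commute intro!: mult_nonpos_nonpos)
  qed
  have len: "chain_length p n = \<tau> n" if "n \<le> s" for n
    using that by (induction n) (simp_all add: chain_length_def \<tau>0 dist)
  obtain \<theta> where \<theta>: "continuous_on {0..T} \<theta>" "\<And>t. t \<in> {0..T} \<Longrightarrow> is_Arg (c t - z) (2 * pi * \<theta> t)" "d = \<theta> T - \<theta> 0"
    using disp unfolding has_displacement_def by blast
  have wc: "wrap (\<Gamma> t) = c t" if "t \<in> {0..T}" for t using wrap_unfolding[OF unf sq that] .
  have segd: "segdisp (p i) (p (Suc i)) = \<theta> (\<tau> (Suc i)) - \<theta> (\<tau> i)" if i: "i < s" for i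
    unfolding p_def
  proof (rule segdisp_straight[OF _ straight_eq[OF i]])
    show "\<tau> i \<le> \<tau> (Suc i)" using less[of i "Suc i"] i by simp
    show "closed_segment (\<Gamma> (\<tau> i)) (\<Gamma> (\<tau> (Suc i))) \<inter> interior (ob j) = {}" for j
      using chain_segment[OF chain i, of j] by (simp add: p_def)
    show "angle_lift (\<tau> i) (\<tau> (Suc i)) (\<lambda>t. wrap (\<Gamma> t) - z) \<theta>"
      unfolding angle_lift_def using \<theta>(2) wc sub[OF i] by (auto intro: continuous_on_subset[OF \<theta>(1)])
  qed
  have "chain_disp p n = \<theta> (\<tau> n) - \<theta> 0" if "n \<le> s" for n
    using that by (induction n) (simp_all add: chain_disp_def \<tau>0 segd)
  then show thesis using that[OF k0 k chain] len \<tau>s \<theta>(3) by simp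
qed

end

section \<open>Chains in equilibrium\<close>

lemma norm_add_le_first_order:
  fixes a u :: "'a::real_inner"
  assumes "a \<noteq> 0"
  shows "norm (a + u) \<le> norm a + sgn a \<bullet> u + (norm u)\<^sup>2 / (2 * norm a)"
proof -
  have m: "norm a > 0" using assms by simp
  have "(norm (a + u))\<^sup>2 = (norm a)\<^sup>2 + 2 * (a \<bullet> u) + (norm u)\<^sup>2"
    by (simp add: power2_norm_eq_inner inner_add_left inner_add_right inner_commute)
  moreover have "2 * norm (a + u) * norm a \<le> (norm (a + u))\<^sup>2 + (norm a)\<^sup>2" by (rule sum_squares_bound)
  ultimately have "2 * norm (a + u) * norm a \<le> 2 * (norm a)\<^sup>2 + 2 * (a \<bullet> u) + (norm u)\<^sup>2" by simp
  then have "norm (a + u) \<le> (2 * (norm a)\<^sup>2 + 2 * (a \<bullet> u) + (norm u)\<^sup>2) / (2 * norm a)"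
    using m by (simp add: pos_le_divide_eq mult.commute mult.left_commute)
  also have "\<dots> = norm a + sgn a \<bullet> u + (norm u)\<^sup>2 / (2 * norm a)"
  proof -
    have "sgn a \<bullet> u = (a \<bullet> u) / norm a" by (simp add: sgn_div_norm divide_inverse mult.commute)
    moreover have "2 * (norm a)\<^sup>2 / (2 * norm a) = norm a" using m by (simp add: power2_eq_square)
    ultimately show ?thesis by (simp add: add_divide_distrib)
  qed
  finally show ?thesis .
qed

lemma nonneg_linear_term:
  fixes G C :: real
  assumes "\<And>t. 0 < t \<Longrightarrow> t \<le> 1 \<Longrightarrow> 0 \<le> t * G + t\<^sup>2 * C"
  shows "0 \<le> G"
proof (rule ccontr)
  assume "\<not> 0 \<le> G"
  then have G: "G < 0" by simp
  define t where "t = min 1 (- G / (2 * (\<bar>C\<bar> + 1)))"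
  have t: "0 < t" "t \<le> 1" "t \<le> - G / (2 * (\<bar>C\<bar> + 1))"
    using divide_pos_pos[of "- G" "2 * (\<bar>C\<bar> + 1)"] G by (auto simp: t_def)
  have "t * (2 * (\<bar>C\<bar> + 1)) \<le> - G" 
  proof -
    have "0 < 2 * (\<bar>C\<bar> + 1)" by simp
    from pos_le_divide_eq[OF this, of t "- G"] t(3) show ?thesis by (simp only:)
  qed
  moreover have "t * C \<le> t * (\<bar>C\<bar> + 1)" using t(1) by (intro mult_left_mono) auto
  ultimately have "G + t * C < 0" using G by (simp add: algebra_simps)
  then have "t * (G + t * C) < 0" using t(1) by (simp add: mult_pos_neg)
  then show False using assms[OF t(1,2)] by (simp add: power2_eq_square algebra_simps)
qed

text \<open>The convention for \<open>i = 0\<close> makes the free initial point of a broken line a vertex without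
  incoming segment; being in equilibrium there means that the path leaves the first obstacle
  perpendicularly.\<close>

definition deflection :: "(nat \<Rightarrow> complex) \<Rightarrow> nat \<Rightarrow> complex" where
  "deflection p i = (if i = 0 then 0 else sgn (p i - p (i - 1))) - sgn (p (Suc i) - p i)"

text \<open>The first variation of the length when one vertex is moved; only the two segments at this
  vertex change.\<close>

lemma variation_of_length:
  fixes p :: "nat \<Rightarrow> complex"
  assumes ne: "\<And>n. p (Suc n) \<noteq> p n" and i: "i < m"
  shows "\<exists>C. \<forall>t. 0 \<le> t \<longrightarrow> (\<Sum>n<m. dist ((p(i := p i + t *\<^sub>R v)) n) ((p(i := p i + t *\<^sub>R v)) (Suc n)))
      \<le> (\<Sum>n<m. dist (p n) (p (Suc n))) + (t * (deflection p i \<bullet> v) + t\<^sup>2 * C)"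
proof -
  define D where "D n = (norm v)\<^sup>2 / (2 * dist (p n) (p (Suc n)))" for n
  define C where "C = D i + (if i = 0 then 0 else D (i - 1))"
  have "(\<Sum>n<m. dist ((p(i := p i + t *\<^sub>R v)) n) ((p(i := p i + t *\<^sub>R v)) (Suc n)))
      \<le> (\<Sum>n<m. dist (p n) (p (Suc n))) + (t * (deflection p i \<bullet> v) + t\<^sup>2 * C)" if t: "0 \<le> t" for t
  proof -
    let ?q = "p(i := p i + t *\<^sub>R v)"
    define A where "A = - t * (sgn (p (Suc i) - p i) \<bullet> v) + t\<^sup>2 * D i"
    define B where "B = t * (sgn (p i - p (i - 1)) \<bullet> v) + t\<^sup>2 * D (i - 1)"
    have first_order: "dist (x + t *\<^sub>R v) y \<le> dist x y + t * (sgn (x - y) \<bullet> v) + t\<^sup>2 * ((norm v)\<^sup>2 / (2 * dist x y))"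
      if "x \<noteq> y" for x y :: complex
      using norm_add_le_first_order[of "x - y" "t *\<^sub>R v"] that
      by (simp add: dist_norm algebra_simps power_mult_distrib)
    have "dist (?q n) (?q (Suc n)) \<le> dist (p n) (p (Suc n)) + ((if n = i then A else 0) + (if Suc n = i then B else 0))" for n
    proof -
      consider "n = i" | "Suc n = i" | "n \<noteq> i" "Suc n \<noteq> i" by blast
      then show ?thesis
      proof cases
        case 1
        have "sgn (p i - p (Suc i)) = - sgn (p (Suc i) - p i)" by (metis minus_diff_eq sgn_minus)
        then show ?thesis using first_order[of "p i" "p (Suc i)"] ne[of i] 1 by (auto simp: A_def D_def)
      next
        case 2
        then show ?thesis using first_order[of "p i" "p n"] ne[of n] by (auto simp: B_def D_def dist_commute)
      qed simp
    qed
    then have "(\<Sum>n<m. dist (?q n) (?q (Suc n)))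
       \<le> (\<Sum>n<m. dist (p n) (p (Suc n)) + ((if n = i then A else 0) + (if Suc n = i then B else 0)))"
      by (intro sum_mono)
    also have "\<dots> = (\<Sum>n<m. dist (p n) (p (Suc n))) + ((\<Sum>n<m. if n = i then A else 0) + (\<Sum>n<m. if Suc n = i then B else 0))"
      by (simp add: sum.distrib)
    also have "(\<Sum>n<m. if n = i then A else 0) = A" using i by simp
    also have "(\<Sum>n<m. if Suc n = i then B else 0) = (if i = 0 then 0 else B)" using i by (cases i) auto
    also have "A + (if i = 0 then 0 else B) = t * (deflection p i \<bullet> v) + t\<^sup>2 * C"
      by (simp add: A_def B_def C_def deflection_def inner_diff_left algebra_simps)
    finally show ?thesis .
  qed
  then show ?thesis by blast
qed

context small_obstacle
begin

text \<open>For each \<open>m\<close>, the broken line with vertices in the obstacles whose first \<open>m\<close> segments have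
  the least total length is in equilibrium at its first \<open>m\<close> vertices. The conditions of equilibrium
  are closed in the product of the obstacles, which is compact by Tychonoff's theorem, so all of them
  can be met at once.\<close>

lemma equilibrium_exists:
  assumes ne: "\<And>n. k (Suc n) \<noteq> k n"
  obtains p where "\<And>i. p i \<in> ob (k i)" "\<And>i y. y \<in> ob (k i) \<Longrightarrow> 0 \<le> deflection p i \<bullet> (y - p i)"
proof -
  define X where "X = Pi\<^sub>E UNIV (\<lambda>i. ob (k i))"
  have XI: "p \<in> X \<longleftrightarrow> (\<forall>i. p i \<in> ob (k i))" for p by (auto simp: X_def PiE_iff)
  have compX: "compact X"
  proof -
    have "compactin (product_topology (\<lambda>i. euclidean) UNIV) X"
      unfolding X_def compactin_PiE using compact_ob by simp
    then show ?thesis unfolding euclidean_product_topology by simp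
  qed
  have closedX: "closed X" using compX by (rule compact_imp_closed)
  have "(\<lambda>i. zz (k i)) \<in> X" by (simp add: XI zz_in_ob)
  then have neX: "X \<noteq> {}" by blast
  have coord: "continuous_on X (\<lambda>p. p i :: complex)" for i
    by (rule continuous_on_subset[OF continuous_on_product_coordinates]) simp
  have pne: "p (Suc i) \<noteq> p i" if "p \<in> X" for p i
    using that ne[of i] ob_index_unique[of "p i" "k (Suc i)" "k i"] unfolding XI by metis
  have contdefl: "continuous_on X (\<lambda>p. deflection p i)" for i
    unfolding deflection_def
    by (cases i) (auto intro!: continuous_intros coord simp: pne)
  define E where "E i = {p \<in> X. \<forall>y\<in>ob (k i). 0 \<le> deflection p i \<bullet> (y - p i)}" for i
  have closedE: "closed (E i)" for i
  proof -
    have "E i = (\<Inter>y\<in>ob (k i). {p \<in> X. 0 \<le> deflection p i \<bullet> (y - p i)})"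
      using ob_nonempty[of "k i"] by (auto simp: E_def)
    also have "closed \<dots>"
      by (intro closed_INT ballI continuous_on_closed_Collect_le continuous_intros contdefl coord closedX)
    finally show ?thesis .
  qed
  have "X \<inter> \<Inter> (E ` UNIV) \<noteq> {}"
  proof (rule compact_imp_fip_image[OF compX closedE])
    fix I' :: "nat set" assume "finite I'"
    then obtain m where m: "\<And>i. i \<in> I' \<Longrightarrow> i < m"
      by (meson finite_nat_iff_bounded lessThan_iff subsetD)
    define L where "L p = (\<Sum>n<m. dist (p n) (p (Suc n)))" for p :: "nat \<Rightarrow> complex"
    have "continuous_on X L" unfolding L_def by (intro continuous_intros coord)
    then obtain p where p: "p \<in> X" "\<And>q. q \<in> X \<Longrightarrow> L p \<le> L q"
      using continuous_attains_inf[OF compX neX] by blast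
    have "p \<in> E i" if i: "i \<in> I'" for i
    proof -
      have "0 \<le> deflection p i \<bullet> (y - p i)" if y: "y \<in> ob (k i)" for y
      proof -
        define v where "v = y - p i"
        obtain C where C: "\<And>t. 0 \<le> t \<Longrightarrow> L (p(i := p i + t *\<^sub>R v)) \<le> L p + (t * (deflection p i \<bullet> v) + t\<^sup>2 * C)"
          using variation_of_length[of p i m v] pne[OF p(1)] m[OF i] unfolding L_def by blast
        have "0 \<le> t * (deflection p i \<bullet> v) + t\<^sup>2 * C" if t: "0 < t" "t \<le> 1" for t
        proof -
          have "(1 - t) *\<^sub>R p i + t *\<^sub>R y \<in> ob (k i)"
            using convexD_alt[OF convex_ob, of "p i" "k i" y t] p(1) y t by (simp add: XI)
          then have "p i + t *\<^sub>R v \<in> ob (k i)" by (simp add: v_def algebra_simps)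
          then have "p(i := p i + t *\<^sub>R v) \<in> X" using p(1) by (simp add: XI)
          from p(2)[OF this] C[of t] t show ?thesis by linarith
        qed
        then show ?thesis unfolding v_def[symmetric] by (rule nonneg_linear_term)
      qed
      then show ?thesis using p(1) by (simp add: E_def)
    qed
    then show "X \<inter> \<Inter> (E ` I') \<noteq> {}" using p(1) by blast
  qed
  then obtain p where "p \<in> X" "\<And>i. p \<in> E i" by blast
  then show thesis by (intro that[of p]) (auto simp: XI E_def)
qed

end

section \<open>The trajectory along an equilibrium\<close>

locale equilibrium = small_obstacle +
  fixes k :: "nat \<Rightarrow> int \<times> int" and p :: "nat \<Rightarrow> complex"
  assumes adm: "adm_type s k" and pt: "p i \<in> ob (k i)"
    and eq: "y \<in> ob (k i) \<Longrightarrow> 0 \<le> deflection p i \<bullet> (y - p i)"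
begin

definition w :: "nat \<Rightarrow> complex" where "w i = sgn (p (Suc i) - p i)"

definition \<tau> :: "nat \<Rightarrow> real" where "\<tau> n = chain_length p n"

lemma k_ne: "k (Suc i) \<noteq> k i" and no_between: "\<not> between K j (k i) (k (Suc i))"
  and no_middle: "\<not> between K (k (Suc i)) (k i) (k (Suc (Suc i)))"
  using adm[of "Suc (Suc i)"] unfolding adm_type_def by (meson lessI less_SucI)+

lemma p_ne: "p (Suc i) \<noteq> p i"
  using ob_index_unique[of "p i" "k (Suc i)" "k i"] pt k_ne by metis

lemma norm_w [simp]: "norm (w i) = 1"
  using p_ne by (simp add: w_def norm_sgn)

lemma w_inner_self [simp]: "w i \<bullet> w i = 1"
  using norm_w[of i] by (simp add: dot_square_norm)

lemma deflection_Suc: "deflection p (Suc i) = w i - w (Suc i)" and deflection_0: "deflection p 0 = - w 0"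
  by (simp_all add: deflection_def w_def)

lemma critical_vertex: "critical (ob (k (Suc i))) (p i) (p (Suc i)) (p (Suc (Suc i)))"
  using eq[of _ "Suc i"] unfolding critical_def deflection_Suc w_def by blast

text \<open>A vanishing deflection would put the obstacle between its neighbours; so each vertex is a
  genuine reflection.\<close>

lemma w_neq: "w i \<noteq> w (Suc i)"
proof -
  have "k (Suc (Suc i)) \<noteq> k (Suc i)" "k i \<noteq> k (Suc i)" using k_ne by metis+
  from critical_deflection_pos[OF critical_vertex pt pt pt separates_back[OF this(2,1) no_middle]]
  show ?thesis by (auto simp: w_def)
qed

lemma w_inner_less: "w i \<bullet> w (Suc i) < 1"
proof -
  have "0 < (w i - w (Suc i)) \<bullet> (w i - w (Suc i))" using w_neq by (simp only: inner_gt_zero_iff) simp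
  then show ?thesis by (simp add: inner_diff_left inner_diff_right inner_commute)
qed

lemma deflection_out: "deflection p i \<bullet> w i < 0"
  using w_inner_less by (cases i) (simp_all add: deflection_Suc deflection_0 inner_diff_left)

lemma deflection_in: "0 < deflection p (Suc i) \<bullet> w i"
  using w_inner_less[of i] by (simp add: deflection_Suc inner_diff_left inner_commute[of "w (Suc i)" "w i"])

lemma deflection_nonzero: "deflection p i \<noteq> 0"
  using deflection_out[of i] by auto

lemma p_frontier: "p i \<in> frontier (ob (k i))"
proof -
  have "p i \<notin> interior (ob (k i))"
    using inner_pos_interior[of "ob (k i)" "deflection p i" "p i" "p i"] eq deflection_nonzero by auto
  then show ?thesis using pt closed_ob by (simp add: frontier_def)
qed

lemma \<tau>_0 [simp]: "\<tau> 0 = 0" and \<tau>_Suc: "\<tau> (Suc n) = \<tau> n + dist (p n) (p (Suc n))"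
  by (simp_all add: \<tau>_def chain_length_def)

lemma p_Suc: "p (Suc n) = p n + (\<tau> (Suc n) - \<tau> n) *\<^sub>R w n"
  using p_ne[of n] by (simp add: \<tau>_Suc w_def sgn_div_norm dist_norm norm_minus_commute)

lemma gap: "1 - 2 * r \<le> \<tau> (Suc n) - \<tau> n"
  using ob_apart[OF not_sym[OF k_ne] pt pt, of n] by (simp add: \<tau>_Suc)

lemma \<tau>_less: "\<tau> n < \<tau> (Suc n)"
  using gap[of n] two_r_less_1 by linarith

lemma strict_mono_\<tau>: "strict_mono \<tau>"
  by (simp add: strict_mono_Suc_iff \<tau>_less)

lemma \<tau>_ge: "real n * (1 - 2 * r) \<le> \<tau> n"
proof (induction n)
  case (Suc n)
  then show ?case using gap[of n] by (simp add: algebra_simps)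
qed simp

lemma \<tau>_unbounded: "\<exists>n. t < \<tau> n"
proof -
  have "0 < 1 - 2 * r" using two_r_less_1 by simp
  then obtain n where "t < real n * (1 - 2 * r)" using reals_Archimedean3 by blast
  then show ?thesis using \<tau>_ge[of n] by (intro exI[of _ n]) linarith
qed

lemma \<tau>_nonneg: "0 \<le> \<tau> n"
  using strict_mono_\<tau> \<tau>_0 by (metis le0 strict_mono_less_eq)

lemma segment_index:
  assumes "0 \<le> t" obtains n where "\<tau> n \<le> t" "t < \<tau> (Suc n)"
proof -
  define m where "m = (LEAST m. t < \<tau> m)"
  have m: "t < \<tau> m" unfolding m_def using \<tau>_unbounded by (rule LeastI_ex)
  then have "m \<noteq> 0" using assms by (metis \<tau>_0 not_less)
  then obtain n where n: "m = Suc n" by (cases m) auto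
  have "\<not> t < \<tau> n" using not_less_Least[of n "\<lambda>m. t < \<tau> m"] n by (simp add: m_def)
  then show thesis using that[of n] m n by simp
qed

text \<open>A segment lies in the hull of its two obstacles and so meets no other one. It does not
  return to the obstacles at its end points either, since it leaves their tangent lines there.\<close>

lemma outside_obstacles:
  assumes "\<tau> n < t" "t < \<tau> (Suc n)"
  shows "p n + (t - \<tau> n) *\<^sub>R w n \<notin> ob j"
proof
  let ?x = "p n + (t - \<tau> n) *\<^sub>R w n"
  assume x: "?x \<in> ob j"
  define u where "u = (t - \<tau> n) / (\<tau> (Suc n) - \<tau> n)"
  have "t - \<tau> n = u * (\<tau> (Suc n) - \<tau> n)" using \<tau>_less[of n] by (simp add: u_def)
  then have "?x = (1 - u) *\<^sub>R p n + u *\<^sub>R p (Suc n)"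
    unfolding p_Suc by (simp only: scaleR_scaleR[symmetric]) (simp add: algebra_simps)
  moreover have "0 \<le> u" "u \<le> 1" using assms by (auto simp: u_def)
  ultimately have "?x \<in> closed_segment (p n) (p (Suc n))" unfolding closed_segment_def by blast
  also have "\<dots> \<subseteq> convex hull (ob (k n) \<union> ob (k (Suc n)))"
    unfolding segment_convex_hull using pt by (intro hull_mono) auto
  finally have "j = k n \<or> j = k (Suc n)" using no_between[of j n] x unfolding between_def by blast
  then show False
  proof
    assume "j = k n"
    then have "0 \<le> deflection p n \<bullet> (?x - p n)" using eq x by blast
    also have "\<dots> = (t - \<tau> n) * (deflection p n \<bullet> w n)" by simp
    finally show False using deflection_out[of n] assms by (simp add: zero_le_mult_iff)
  next
    assume "j = k (Suc n)"
    then have "0 \<le> deflection p (Suc n) \<bullet> (?x - p (Suc n))" using eq x by blast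
    also have "?x - p (Suc n) = (t - \<tau> (Suc n)) *\<^sub>R w n" unfolding p_Suc by (simp add: algebra_simps)
    also have "deflection p (Suc n) \<bullet> \<dots> = (t - \<tau> (Suc n)) * (deflection p (Suc n) \<bullet> w n)" by simp
    finally show False using deflection_in[of n] assms by (simp add: zero_le_mult_iff)
  qed
qed

definition \<Gamma> :: "real \<Rightarrow> complex" where
  "\<Gamma> t = (let n = (LEAST n. t < \<tau> (Suc n)) in p n + (t - \<tau> n) *\<^sub>R w n)"

lemma \<Gamma>_eq:
  assumes "\<tau> n \<le> t" "t \<le> \<tau> (Suc n)"
  shows "\<Gamma> t = p n + (t - \<tau> n) *\<^sub>R w n"
proof -
  have *: "\<Gamma> t = p n + (t - \<tau> n) *\<^sub>R w n" if "\<tau> n \<le> t" "t < \<tau> (Suc n)" for n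
  proof -
    have "(LEAST n. t < \<tau> (Suc n)) = n"
    proof (rule Least_equality)
      show "n \<le> m" if "t < \<tau> (Suc m)" for m
      proof -
        have "\<tau> n < \<tau> (Suc m)" using \<open>\<tau> n \<le> t\<close> that by linarith
        then show ?thesis using strict_mono_less[OF strict_mono_\<tau>] by simp
      qed
    qed (rule that)
    then show ?thesis by (simp add: \<Gamma>_def Let_def)
  qed
  show ?thesis
  proof (cases "t = \<tau> (Suc n)")
    case True
    then show ?thesis using *[of "Suc n"] \<tau>_less[of "Suc n"] p_Suc[of n] by simp
  qed (use assms * in auto)
qed

lemma \<Gamma>_\<tau> [simp]: "\<Gamma> (\<tau> n) = p n"
  using \<Gamma>_eq[of n "\<tau> n"] \<tau>_less[of n] by simp

lemma velocities_inside:
  assumes "\<tau> n < t" "t < \<tau> (Suc n)"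
  shows "velocities {0..} \<Gamma> t (w n) (w n)"
  unfolding velocities_def
proof (intro conjI exI[of _ "min (t - \<tau> n) (\<tau> (Suc n) - t)"] ballI impI)
  fix s assume s: "s \<in> {0..min (t - \<tau> n) (\<tau> (Suc n) - t)}"
  have "\<Gamma> (t - s) = p n + (t - s - \<tau> n) *\<^sub>R w n" "\<Gamma> (t + s) = p n + (t + s - \<tau> n) *\<^sub>R w n"
    "\<Gamma> t = p n + (t - \<tau> n) *\<^sub>R w n"
    using s assms by (auto intro!: \<Gamma>_eq)
  then show "\<Gamma> (t - s) = \<Gamma> t - s *\<^sub>R w n" "\<Gamma> (t + s) = \<Gamma> t + s *\<^sub>R w n"
    by (simp_all only:) (simp_all add: algebra_simps)
qed (use assms in auto)

lemma velocities_vertex: "velocities {0..} \<Gamma> (\<tau> (Suc n)) (w n) (w (Suc n))"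
  unfolding velocities_def
proof (intro conjI exI[of _ "min (\<tau> (Suc n) - \<tau> n) (\<tau> (Suc (Suc n)) - \<tau> (Suc n))"] ballI impI)
  fix s assume s: "s \<in> {0..min (\<tau> (Suc n) - \<tau> n) (\<tau> (Suc (Suc n)) - \<tau> (Suc n))}"
  have "\<Gamma> (\<tau> (Suc n) - s) = p n + (\<tau> (Suc n) - s - \<tau> n) *\<^sub>R w n" using s by (intro \<Gamma>_eq) auto
  then show "\<Gamma> (\<tau> (Suc n) - s) = \<Gamma> (\<tau> (Suc n)) - s *\<^sub>R w n"
    by (simp add: p_Suc[of n] algebra_simps)
  have "\<Gamma> (\<tau> (Suc n) + s) = p (Suc n) + (\<tau> (Suc n) + s - \<tau> (Suc n)) *\<^sub>R w (Suc n)" using s by (intro \<Gamma>_eq) auto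
  then show "\<Gamma> (\<tau> (Suc n) + s) = \<Gamma> (\<tau> (Suc n)) + s *\<^sub>R w (Suc n)" by simp
qed (use \<tau>_less in auto)

text \<open>Nothing precedes time 0, so any unit vector can serve as the incoming velocity.\<close>

lemma velocities_start: "norm v = 1 \<Longrightarrow> velocities {0..} \<Gamma> 0 v (w 0)"
  unfolding velocities_def
proof (intro conjI exI[of _ "\<tau> 1"] ballI impI)
  fix s assume s: "s \<in> {0..\<tau> 1}"
  show "\<Gamma> (0 - s) = \<Gamma> 0 - s *\<^sub>R v" if "0 - s \<in> {0..}" using s that by simp
  show "\<Gamma> (0 + s) = \<Gamma> 0 + s *\<^sub>R w 0" using s \<Gamma>_eq[of 0 s] \<Gamma>_\<tau>[of 0] by simp
qed (use \<tau>_less[of 0] in auto)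

lemma time_cases:
  assumes "0 \<le> t"
  obtains "t = 0" | n where "t = \<tau> (Suc n)" | n where "\<tau> n < t" "t < \<tau> (Suc n)"
proof -
  obtain n where n: "\<tau> n \<le> t" "t < \<tau> (Suc n)" using segment_index[OF assms] .
  show thesis
  proof (cases "t = \<tau> n")
    case True
    then show thesis using that(1,2) by (cases n) auto
  next
    case False
    then show thesis using that(3)[of n] n by simp
  qed
qed

lemma normal_vertex: "outer_unit_normal (ob (k i)) (p i) (- sgn (deflection p i))"
  unfolding outer_unit_normal_def using eq[of _ i] deflection_nonzero[of i]
  by (auto simp: norm_sgn sgn_div_norm)

lemma reflect_vertex: "reflect (- sgn (deflection p (Suc i))) (w i) = w (Suc i)"
proof -
  define g where "g = deflection p (Suc i)"
  have gg: "g \<bullet> g = 2 * (w i \<bullet> g)"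
    unfolding g_def deflection_Suc by (simp add: inner_diff_left inner_diff_right inner_commute)
  have "g \<noteq> 0" by (simp add: g_def deflection_nonzero)
  then have "(2 * (w i \<bullet> (- sgn g))) *\<^sub>R (- sgn g) = (2 * (w i \<bullet> g) / (g \<bullet> g)) *\<^sub>R g"
    by (simp add: sgn_div_norm dot_square_norm power2_eq_square field_simps)
  also have "\<dots> = g" using gg \<open>g \<noteq> 0\<close> by (simp flip: gg)
  finally show ?thesis unfolding reflect_def g_def[symmetric] by (simp add: g_def deflection_Suc)
qed

text \<open>The initial velocity is itself the outer normal, as if the trajectory had arrived along the
  same line.\<close>

lemma reflect_start: "reflect (- sgn (deflection p 0)) (- w 0) = w 0"
proof -
  have "- sgn (deflection p 0) = w 0" by (simp add: deflection_0 sgn_minus sgn_div_norm)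
  then show ?thesis by (simp add: reflect_def scaleR_conv_of_real)
qed

lemma velocities_law:
  assumes "0 \<le> t"
  obtains (vertex) v w' i where "velocities {0..} \<Gamma> t v w'" "\<Gamma> t = p i"
      "w' = reflect (- sgn (deflection p i)) v"
  | (free) v where "velocities {0..} \<Gamma> t v v" "\<And>j. \<Gamma> t \<notin> ob j"
  using assms
proof (cases rule: time_cases)
  case 1
  show ?thesis
  proof (rule vertex)
    show "velocities {0..} \<Gamma> t (- w 0) (w 0)" unfolding 1 by (rule velocities_start) simp
    show "\<Gamma> t = p 0" using \<Gamma>_\<tau>[of 0] by (simp only: 1 \<tau>_0)
    show "w 0 = reflect (- sgn (deflection p 0)) (- w 0)" by (rule reflect_start[symmetric])
  qed
next
  case (2 n)
  show ?thesis
  proof (rule vertex)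
    show "velocities {0..} \<Gamma> t (w n) (w (Suc n))" unfolding 2 by (rule velocities_vertex)
    show "\<Gamma> t = p (Suc n)" unfolding 2 by (rule \<Gamma>_\<tau>)
    show "w (Suc n) = reflect (- sgn (deflection p (Suc n))) (w n)" by (rule reflect_vertex[symmetric])
  qed
next
  case (3 n)
  show ?thesis
  proof (rule free)
    show "velocities {0..} \<Gamma> t (w n) (w n)" by (rule velocities_inside[OF 3])
    show "\<Gamma> t \<notin> ob j" for j using outside_obstacles[OF 3] \<Gamma>_eq[of n t] 3 by simp
  qed
qed

end

text \<open>A straight passage through a wall of the grid is folded to a reflection from a side of the
  square, and through a vertex of the grid to the reversal at a vertex; so a trajectory in the plane
  folds to a trajectory in the square.\<close>

lemma wrap_velocities:
  assumes vel: "velocities I \<Gamma> t v w" and k: "\<Gamma> t = place k (wrap (\<Gamma> t))"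
  obtains v' w' where "velocities I (wrap \<circ> \<Gamma>) t v' w'"
    "v = w \<Longrightarrow> w' = Complex (if \<bar>Re (wrap (\<Gamma> t))\<bar> = 1/2 then - Re v' else Re v')
                    (if \<bar>Im (wrap (\<Gamma> t))\<bar> = 1/2 then - Im v' else Im v')"
    "\<bar>Re (wrap (\<Gamma> t))\<bar> < 1/2 \<Longrightarrow> \<bar>Im (wrap (\<Gamma> t))\<bar> < 1/2 \<Longrightarrow> v' = lin k v \<and> w' = lin k w"
proof -
  define x y where "x = Re (\<Gamma> t)" and "y = Im (\<Gamma> t)"
  have xy: "Re (wrap (\<Gamma> t)) = wrap1 x" "Im (wrap (\<Gamma> t)) = wrap1 y" by (simp_all add: wrap_def x_def y_def)
  have "x = of_int (fst k) + of_int (sg (fst k)) * wrap1 x"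
    using arg_cong[OF k, of Re] xy by (simp add: x_def place_alt centre_def lin_def)
  from wrap1_local[OF this, of "Re v" "Re w"]
  obtain v1 w1 e1 where 1: "\<bar>v1\<bar> = \<bar>Re v\<bar>" "\<bar>w1\<bar> = \<bar>Re w\<bar>"
    "Re v = Re w \<longrightarrow> w1 = (if \<bar>wrap1 x\<bar> = 1/2 then - v1 else v1)"
    "\<bar>wrap1 x\<bar> < 1/2 \<longrightarrow> v1 = of_int (sg (fst k)) * Re v \<and> w1 = of_int (sg (fst k)) * Re w"
    "e1 > 0" "\<forall>s\<in>{0..e1}. wrap1 (x - s * Re v) = wrap1 x - s * v1 \<and> wrap1 (x + s * Re w) = wrap1 x + s * w1"
    by blast
  have "y = of_int (snd k) + of_int (sg (snd k)) * wrap1 y"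
    using arg_cong[OF k, of Im] xy by (simp add: y_def place_alt centre_def lin_def)
  from wrap1_local[OF this, of "Im v" "Im w"]
  obtain v2 w2 e2 where 2: "\<bar>v2\<bar> = \<bar>Im v\<bar>" "\<bar>w2\<bar> = \<bar>Im w\<bar>"
    "Im v = Im w \<longrightarrow> w2 = (if \<bar>wrap1 y\<bar> = 1/2 then - v2 else v2)"
    "\<bar>wrap1 y\<bar> < 1/2 \<longrightarrow> v2 = of_int (sg (snd k)) * Im v \<and> w2 = of_int (sg (snd k)) * Im w"
    "e2 > 0" "\<forall>s\<in>{0..e2}. wrap1 (y - s * Im v) = wrap1 y - s * v2 \<and> wrap1 (y + s * Im w) = wrap1 y + s * w2"
    by blast
  obtain e where e: "e > 0" "\<forall>s\<in>{0..e}. (t - s \<in> I \<longrightarrow> \<Gamma> (t - s) = \<Gamma> t - s *\<^sub>R v) \<and> (t + s \<in> I \<longrightarrow> \<Gamma> (t + s) = \<Gamma> t + s *\<^sub>R w)"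
    and n: "norm v = 1" "norm w = 1"
    using vel unfolding velocities_def by blast
  have sq: "v1\<^sup>2 = (Re v)\<^sup>2" "v2\<^sup>2 = (Im v)\<^sup>2" "w1\<^sup>2 = (Re w)\<^sup>2" "w2\<^sup>2 = (Im w)\<^sup>2"
    using 1(1,2) 2(1,2) by (metis power2_abs)+
  have "velocities I (wrap \<circ> \<Gamma>) t (Complex v1 v2) (Complex w1 w2)"
    unfolding velocities_def
  proof (intro conjI exI[of _ "min e (min e1 e2)"] ballI impI)
    show "norm (Complex v1 v2) = 1" "norm (Complex w1 w2) = 1"
      using n unfolding complex_norm sq by (simp_all add: cmod_def)
    show "0 < min e (min e1 e2)" using e(1) 1(5) 2(5) by simp
    fix s assume s: "s \<in> {0..min e (min e1 e2)}"
    {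
      assume "t - s \<in> I"
      then have "\<Gamma> (t - s) = \<Gamma> t - s *\<^sub>R v" using e(2) s by simp
      then have "wrap (\<Gamma> (t - s)) = Complex (wrap1 (x - s * Re v)) (wrap1 (y - s * Im v))"
        by (simp add: wrap_def x_def y_def)
      also have "\<dots> = wrap (\<Gamma> t) - s *\<^sub>R Complex v1 v2"
        using s 1(6) 2(6) xy by (simp add: complex_eq_iff)
      finally show "(wrap \<circ> \<Gamma>) (t - s) = (wrap \<circ> \<Gamma>) t - s *\<^sub>R Complex v1 v2" by simp
    }
    {
      assume "t + s \<in> I"
      then have "\<Gamma> (t + s) = \<Gamma> t + s *\<^sub>R w" using e(2) s by simp
      then have "wrap (\<Gamma> (t + s)) = Complex (wrap1 (x + s * Re w)) (wrap1 (y + s * Im w))"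
        by (simp add: wrap_def x_def y_def)
      also have "\<dots> = wrap (\<Gamma> t) + s *\<^sub>R Complex w1 w2"
        using s 1(6) 2(6) xy by (simp add: complex_eq_iff)
      finally show "(wrap \<circ> \<Gamma>) (t + s) = (wrap \<circ> \<Gamma>) t + s *\<^sub>R Complex w1 w2" by simp
    }
  qed
  moreover have "v = w \<Longrightarrow> Complex w1 w2 = Complex (if \<bar>Re (wrap (\<Gamma> t))\<bar> = 1/2 then - v1 else v1)
                    (if \<bar>Im (wrap (\<Gamma> t))\<bar> = 1/2 then - v2 else v2)"
    unfolding xy using 1(3) 2(3) by simp
  moreover have "Complex v1 v2 = lin k v \<and> Complex w1 w2 = lin k w"
    if "\<bar>Re (wrap (\<Gamma> t))\<bar> < 1/2" "\<bar>Im (wrap (\<Gamma> t))\<bar> < 1/2"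
    using that 1(4) 2(4) unfolding xy by (simp add: lin_def)
  ultimately show thesis by (intro that[of "Complex v1 v2" "Complex w1 w2"]) simp_all
qed

context equilibrium
begin

lemma plane_trajectory_\<Gamma>: "plane_trajectory K {0..} \<Gamma>"
  unfolding plane_trajectory_def billiard_path_def
proof (intro ballI conjI)
  fix t :: real assume "t \<in> {0..}"
  then have "0 \<le> t" by simp
  then show "\<exists>v w. velocities {0..} \<Gamma> t v w \<and> plane_law K (\<Gamma> t) v w"
  proof (cases rule: velocities_law)
    case (vertex v w' i)
    have "\<Gamma> t \<in> frontier (ob (k i))" "outer_unit_normal (ob (k i)) (\<Gamma> t) (- sgn (deflection p i))"
      unfolding vertex(2) by (rule p_frontier normal_vertex)+
    moreover from this have "\<exists>j. \<Gamma> t \<in> frontier (ob j)" by blast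
    ultimately have "plane_law K (\<Gamma> t) v w'" unfolding plane_law_def using vertex(3)
      by (simp only: if_True) blast
    then show ?thesis using vertex(1) by blast
  next
    case (free v)
    then have "\<not> (\<exists>j. \<Gamma> t \<in> frontier (ob j))" using frontier_ob by blast
    then have "plane_law K (\<Gamma> t) v v" unfolding plane_law_def by (simp only: if_False)
    then show ?thesis using free(1) by blast
  qed
  show "\<Gamma> t \<in> - (\<Union>k. interior (ob k))"
    using \<open>0 \<le> t\<close>
  proof (cases rule: velocities_law)
    case (vertex v w' i)
    have "p i \<notin> interior (ob j)" for j
    proof
      assume "p i \<in> interior (ob j)"
      moreover from this have "j = k i" using interior_subset ob_index_unique pt by blast
      ultimately show False using p_frontier[of i] by (simp add: frontier_def)
    qed
    then show ?thesis using vertex(2) by simp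
  next
    case (free v)
    then show ?thesis using interior_subset by blast
  qed
qed

lemma \<Gamma>_outside: "0 \<le> t \<Longrightarrow> \<Gamma> t \<notin> interior (ob j)"
proof -
  assume "0 \<le> t"
  then have "\<Gamma> t \<in> - (\<Union>k. interior (ob k))"
    using plane_trajectory_\<Gamma> unfolding plane_trajectory_def billiard_path_def by simp
  then show ?thesis by blast
qed

lemma unfolding_\<Gamma>: "unfolding_of K {0..} (wrap \<circ> \<Gamma>) \<Gamma>"
  unfolding unfolding_of_def using plane_trajectory_\<Gamma> wrap_preimage by (metis comp_apply)

lemma square_trajectory_\<Gamma>: "square_trajectory K {0..} (wrap \<circ> \<Gamma>)"
  unfolding square_trajectory_def billiard_path_def
proof (intro ballI conjI)
  fix t :: real assume "t \<in> {0..}"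
  then have t: "0 \<le> t" by simp
  have "wrap (\<Gamma> t) \<notin> interior K"
  proof
    assume i: "wrap (\<Gamma> t) \<in> interior K"
    obtain j where "\<Gamma> t = place j (wrap (\<Gamma> t))" by (rule wrap_preimage)
    then have "\<Gamma> t \<in> interior (ob j)" using i unfolding obst_def interior_place by (metis imageI)
    then show False using \<Gamma>_outside[OF t] by blast
  qed
  then show "(wrap \<circ> \<Gamma>) t \<in> unit_square - interior K" using wrap_in_square by simp
  show "\<exists>v w. velocities {0..} (wrap \<circ> \<Gamma>) t v w \<and> square_law K ((wrap \<circ> \<Gamma>) t) v w"
    using t
  proof (cases rule: velocities_law)
    case (vertex v w' i)
    obtain a where a: "p i = place (k i) a" "a \<in> frontier K"
      using p_frontier[of i] by (auto simp: obst_def frontier_place)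
    have aK: "a \<in> K" using a(2) compact_K by (metis compact_imp_closed frontier_subset_closed subsetD)
    then have wa: "wrap (\<Gamma> t) = a" using K_subset_square unfolding vertex(2) a(1) by (auto simp: wrap_id)
    have "norm a < 1/2" using aK K_subset_cball two_r_less_1 by force
    then have "\<bar>Re a\<bar> < 1/2" "\<bar>Im a\<bar> < 1/2" using abs_Re_le_cmod[of a] abs_Im_le_cmod[of a] by linarith+
    moreover have "\<Gamma> t = place (k i) (wrap (\<Gamma> t))" using wa vertex(2) a(1) by metis
    then obtain v1 w1 where "velocities {0..} (wrap \<circ> \<Gamma>) t v1 w1"
      "\<bar>Re (wrap (\<Gamma> t))\<bar> < 1/2 \<Longrightarrow> \<bar>Im (wrap (\<Gamma> t))\<bar> < 1/2 \<Longrightarrow> v1 = lin (k i) v \<and> w1 = lin (k i) w'"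
      using wrap_velocities[OF vertex(1), of "k i"] by blast
    ultimately have "velocities {0..} (wrap \<circ> \<Gamma>) t (lin (k i) v) (lin (k i) w')" unfolding wa by simp
    moreover have "square_law K a (lin (k i) v) (lin (k i) w')"
    proof -
      have "outer_unit_normal K a (lin (k i) (- sgn (deflection p i)))"
        using normal_vertex[of i] unfolding a(1) obst_def outer_unit_normal_place .
      moreover have "lin (k i) w' = reflect (lin (k i) (- sgn (deflection p i))) (lin (k i) v)"
        unfolding vertex(3) by (rule reflect_lin)
      ultimately show ?thesis using a(2) unfolding square_law_def by (simp only: if_True) blast
    qed
    ultimately show ?thesis using wa by auto
  next
    case (free v)
    obtain j where j: "\<Gamma> t = place j (wrap (\<Gamma> t))" by (rule wrap_preimage)
    obtain v' w' where vw: "velocities {0..} (wrap \<circ> \<Gamma>) t v' w'"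
      "w' = Complex (if \<bar>Re (wrap (\<Gamma> t))\<bar> = 1/2 then - Re v' else Re v')
                    (if \<bar>Im (wrap (\<Gamma> t))\<bar> = 1/2 then - Im v' else Im v')"
      using wrap_velocities[OF free(1) j] by blast
    have "wrap (\<Gamma> t) \<notin> K" using free(2)[of j] j unfolding obst_def by (metis imageI)
    then have "wrap (\<Gamma> t) \<notin> frontier K" using compact_K by (metis compact_imp_closed frontier_subset_closed subsetD)
    then have "square_law K (wrap (\<Gamma> t)) v' w'" unfolding square_law_def using vw(2) by simp
    then show ?thesis using vw(1) by auto
  qed
qed

lemma reflection_times: "{t. 0 < t \<and> reflects_at {0..} \<Gamma> t} = \<tau> ` {1..}"
proof (intro equalityI subsetI)
  fix t assume "t \<in> {t. 0 < t \<and> reflects_at {0..} \<Gamma> t}"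
  then have t: "0 < t" and "reflects_at {0..} \<Gamma> t" by auto
  then obtain v w' where vw: "velocities {0..} \<Gamma> t v w'" "v \<noteq> w'" unfolding reflects_at_def by blast
  from t have "0 \<le> t" by simp
  then show "t \<in> \<tau> ` {1..}"
  proof (cases rule: time_cases)
    case (3 n)
    have "v = w n" using t by (intro velocities_left_unique[OF vw(1) velocities_inside[OF 3], of 0]) auto
    moreover have "w' = w n" using t by (intro velocities_right_unique[OF vw(1) velocities_inside[OF 3], of "t + 1"]) auto
    ultimately show ?thesis using vw(2) by simp
  qed (use t in auto)
next
  fix t assume "t \<in> \<tau> ` {1..}"
  then obtain m where "t = \<tau> m" "1 \<le> m" by auto
  then obtain n where n: "t = \<tau> (Suc n)" by (cases m) auto
  then have "reflects_at {0..} \<Gamma> t" unfolding reflects_at_def using velocities_vertex[of n] w_neq[of n] by blast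
  moreover have "0 < t" using n strict_mono_less[OF strict_mono_\<tau>, of 0 "Suc n"] by simp
  ultimately show "t \<in> {t. 0 < t \<and> reflects_at {0..} \<Gamma> t}" by simp
qed

lemma trajectory_of_type_\<Gamma>: "k 0 = (0, 0) \<Longrightarrow> trajectory_of_type K k (wrap \<circ> \<Gamma>)"
  unfolding trajectory_of_type_def
proof (intro conjI exI[of _ \<Gamma>] exI[of _ \<tau>] allI)
  show "\<Gamma> (\<tau> n) \<in> frontier (ob (k n))" for n unfolding \<Gamma>_\<tau> by (rule p_frontier)
qed (rule square_trajectory_\<Gamma> unfolding_\<Gamma> strict_mono_\<tau> \<tau>_0 reflection_times | assumption)+

lemma \<Gamma>_Lipschitz: "0 \<le> a \<Longrightarrow> a \<le> b \<Longrightarrow> dist (\<Gamma> a) (\<Gamma> b) \<le> b - a"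
proof (rule unit_speed_Lipschitz)
  fix t assume "0 \<le> a" "a \<le> b" "t \<in> {a..b}"
  then show "\<exists>v w. velocities {a..b} \<Gamma> t v w"
    using velocities_law[of t] velocities_subset[of "{0..}" \<Gamma> t _ _ "{a..b}"]
    by (metis atLeastAtMost_iff atLeast_iff order_trans subsetI)
qed

lemma wrap_\<Gamma>_Lipschitz:
  assumes "0 \<le> s" "0 \<le> t" shows "dist (wrap (\<Gamma> s)) (wrap (\<Gamma> t)) \<le> \<bar>s - t\<bar>"
proof -
  have "dist (wrap (\<Gamma> s)) (wrap (\<Gamma> t)) \<le> dist (\<Gamma> s) (\<Gamma> t)" by (rule wrap_dist)
  also have "\<dots> \<le> \<bar>s - t\<bar>" using \<Gamma>_Lipschitz[of s t] \<Gamma>_Lipschitz[of t s] assms by (cases "s \<le> t") (auto simp: dist_commute)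
  finally show ?thesis .
qed

lemma norm_wrap_\<Gamma>: "0 \<le> t \<Longrightarrow> \<rho> \<le> norm (wrap (\<Gamma> t) - z)"
  by (intro norm_wrap_ge \<Gamma>_outside)

lemma \<Gamma>_straight: "t \<in> {\<tau> i..\<tau> (Suc i)} \<Longrightarrow> \<Gamma> t = \<Gamma> (\<tau> i) + (t - \<tau> i) *\<^sub>R w i"
  using \<Gamma>_eq[of i t] by simp

lemma chain_p: "chain s k p"
  unfolding chain_def
proof (intro conjI allI impI)
  show "p i \<in> ob (k i)" for i by (rule pt)
  show "critical (ob (k (Suc i))) (p i) (p (Suc i)) (p (Suc (Suc i)))" for i by (rule critical_vertex)
  fix i j
  have "x \<notin> interior (ob j)" if "x \<in> closed_segment (p i) (p (Suc i))" for x
  proof -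
    have "x \<in> \<Gamma> ` {\<tau> i..\<tau> (Suc i)}"
      using straight_closed_segment[OF less_imp_le[OF \<tau>_less] \<Gamma>_straight, of i] that by auto
    then obtain t where "x = \<Gamma> t" "\<tau> i \<le> t" by auto
    then show ?thesis using \<Gamma>_outside[of t j] \<tau>_nonneg[of i] by simp
  qed
  then show "closed_segment (p i) (p (Suc i)) \<inter> interior (ob j) = {}" by blast
qed

lemma angle_function:
  obtains \<theta> where "continuous_on {0..} \<theta>" "\<And>t. 0 \<le> t \<Longrightarrow> is_Arg (wrap (\<Gamma> t) - z) (2 * pi * \<theta> t)"
    "\<And>n. \<theta> (\<tau> n) - \<theta> 0 = chain_disp p n"
    "\<And>a b. 0 \<le> a \<Longrightarrow> a \<le> b \<Longrightarrow> \<bar>\<theta> b - \<theta> a\<bar> \<le> (b - a) / \<rho> + 2"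
proof -
  have "continuous_on {0..} (\<lambda>t. wrap (\<Gamma> t) - z)"
    using wrap_\<Gamma>_Lipschitz
    by (intro lipschitz_on_continuous_on[of 1] lipschitz_onI) (auto simp: dist_norm)
  moreover have "wrap (\<Gamma> t) - z \<noteq> 0" if "t \<in> {0..}" for t
    using norm_wrap_\<Gamma>[of t] that rho_pos by auto
  ultimately obtain \<theta> where \<theta>: "continuous_on {0..} \<theta>" "\<And>t. t \<in> {0..} \<Longrightarrow> is_Arg (wrap (\<Gamma> t) - z) (2 * pi * \<theta> t)"
    using angle_function_exists[of "{0..}" "\<lambda>t. wrap (\<Gamma> t) - z"] by (metis convex_real_interval(1))
  have lift: "angle_lift a b (\<lambda>t. wrap (\<Gamma> t) - z) \<theta>" if "0 \<le> a" for a b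
    unfolding angle_lift_def using \<theta> that continuous_on_subset[OF \<theta>(1), of "{a..b}"] by auto
  have lip: "\<bar>\<theta> b - \<theta> a\<bar> \<le> (b - a) / \<rho> + 2" if "0 \<le> a" "a \<le> b" for a b
  proof -
    have "\<bar>\<theta> b - \<theta> a\<bar> \<le> 1 * (b - a) / \<rho> + 2"
    proof (rule angle_lift_Lipschitz[OF lift[OF that(1)] that(2) rho_pos])
      fix s t assume "s \<in> {a..b}" "t \<in> {a..b}"
      then show "norm (wrap (\<Gamma> s) - z - (wrap (\<Gamma> t) - z)) \<le> 1 * \<bar>s - t\<bar>"
        using wrap_\<Gamma>_Lipschitz[of s t] that by (simp add: dist_norm)
    next
      fix t assume "t \<in> {a..b}"
      then show "\<rho> \<le> norm (wrap (\<Gamma> t) - z)" using that by (intro norm_wrap_\<Gamma>) auto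
    qed
    then show ?thesis by simp
  qed
  have seg: "segdisp (p i) (p (Suc i)) = \<theta> (\<tau> (Suc i)) - \<theta> (\<tau> i)" for i
    using segdisp_straight[OF less_imp_le[OF \<tau>_less] \<Gamma>_straight _ lift[OF \<tau>_nonneg], of i]
      chain_segment[OF chain_p lessI, of i] by simp
  have "\<theta> (\<tau> n) - \<theta> 0 = chain_disp p n" for n
    by (induction n) (simp_all add: chain_disp_def seg)
  then show thesis using that[OF \<theta>(1) _ _ lip] \<theta>(2) by simp
qed

end

section \<open>Uniqueness of the outer normal\<close>

lemma unit_vectors_orthogonal_to_same:
  fixes m n v :: complex
  assumes "norm m = 1" "norm n = 1" "m \<bullet> v = 0" "n \<bullet> v = 0" "v \<noteq> 0"
  shows "m = n \<or> m = - n"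
proof -
  have mv: "Re m * Re v + Im m * Im v = 0" and nv: "Re n * Re v + Im n * Im v = 0"
    using assms by (simp_all add: inner_complex_def)
  have "(Re m * Im n - Im m * Re n) * Re v = (Re m * Re v + Im m * Im v) * Im n - (Re n * Re v + Im n * Im v) * Im m"
    "(Re m * Im n - Im m * Re n) * Im v = (Re n * Re v + Im n * Im v) * Re m - (Re m * Re v + Im m * Im v) * Re n"
    by (simp_all add: algebra_simps)
  then have "Re m * Im n - Im m * Re n = 0" using mv nv assms(5) by (auto simp: complex_eq_iff)
  moreover have "(m \<bullet> n)\<^sup>2 + (Re m * Im n - Im m * Re n)\<^sup>2 = ((Re m)\<^sup>2 + (Im m)\<^sup>2) * ((Re n)\<^sup>2 + (Im n)\<^sup>2)"
    by (simp add: inner_complex_def power2_eq_square algebra_simps)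
  ultimately have "(m \<bullet> n)\<^sup>2 = 1" using assms(1,2) by (simp add: cmod_power2[symmetric])
  then have "m \<bullet> n = 1 \<or> m \<bullet> n = -1" by (simp add: power2_eq_1_iff)
  moreover have "(norm (m - n))\<^sup>2 = 2 - 2 * (m \<bullet> n)" "(norm (m + n))\<^sup>2 = 2 + 2 * (m \<bullet> n)"
  proof -
    have "(norm (m - n))\<^sup>2 = (norm m)\<^sup>2 + (norm n)\<^sup>2 - 2 * (m \<bullet> n)"
      "(norm (m + n))\<^sup>2 = (norm m)\<^sup>2 + (norm n)\<^sup>2 + 2 * (m \<bullet> n)"
      unfolding cmod_power2 inner_complex_def by (simp_all add: power2_eq_square algebra_simps)
    then show "(norm (m - n))\<^sup>2 = 2 - 2 * (m \<bullet> n)" "(norm (m + n))\<^sup>2 = 2 + 2 * (m \<bullet> n)"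
      using assms(1,2) by simp_all
  qed
  ultimately have "m - n = 0 \<or> m + n = 0" by auto
  then show ?thesis by (auto simp: add_eq_0_iff2)
qed

text \<open>The function \<open>l \<bullet> (g t - a)\<close> has a maximum where \<open>g\<close> passes through \<open>a\<close>, for each outer
  normal \<open>l\<close>, so \<open>l\<close> is orthogonal to the tangent vector. Opposite normals are excluded by an interior
  point.\<close>

lemma smooth_boundary_unique_normal:
  assumes smooth: "smooth_boundary K" and K: "closed K" "interior K \<noteq> {}" and a: "a \<in> frontier K"
    and m: "outer_unit_normal K a m" and n: "outer_unit_normal K a n"
  shows "m = n"
proof -
  obtain g g' where g: "\<And>t. (g has_vector_derivative g' t) (at t)" "\<And>t. g' t \<noteq> 0" "\<And>t. g (t + 1) = g t"
    "g ` {0..<1} = frontier K"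
    using smooth unfolding smooth_boundary_def by auto
  obtain t0 where t0: "t0 \<in> {0..<1}" "g t0 = a"
  proof -
    have "a \<in> g ` {0..<1}" using a by (simp only: g(4))
    then show thesis using that by blast
  qed
  have in_frontier: "g t \<in> K" if "-1 < t" "t < 1" for t
  proof -
    have "g t \<in> g ` {0..<1}"
    proof (cases "0 \<le> t")
      case False
      then show ?thesis using g(3)[of t] that by (intro image_eqI[of _ _ "t + 1"]) auto
    qed (use that in auto)
    then show ?thesis unfolding g(4) using K(1) frontier_subset_closed by blast
  qed
  have orth: "l \<bullet> g' t0 = 0" if l: "outer_unit_normal K a l" for l
  proof (rule DERIV_local_max)
    show "((\<lambda>t. l \<bullet> (g t - a)) has_real_derivative l \<bullet> g' t0) (at t0)"
      using bounded_linear.has_vector_derivative[OF bounded_linear_inner_right g(1)[of t0], of l]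
      by (auto simp: has_real_derivative_iff_has_vector_derivative inner_diff_right intro!: derivative_eq_intros)
    \<comment> \<open>The parameter \<open>0\<close> needs values to its left, which periodicity provides down to \<open>-1\<close>.\<close>
    show "0 < 1 - t0" using t0 by simp
    show "\<forall>y. \<bar>t0 - y\<bar> < 1 - t0 \<longrightarrow> l \<bullet> (g y - a) \<le> l \<bullet> (g t0 - a)"
    proof (intro allI impI)
      fix y assume "\<bar>t0 - y\<bar> < 1 - t0"
      then have "g y \<in> K" using t0(1) by (intro in_frontier) (auto simp: abs_less_iff)
      then show "l \<bullet> (g y - a) \<le> l \<bullet> (g t0 - a)" using l t0(2) by (simp add: outer_unit_normal_def)
    qed
  qed
  have "m = n \<or> m = - n"
    using unit_vectors_orthogonal_to_same[OF _ _ orth[OF m] orth[OF n] g(2)] m n by (simp add: outer_unit_normal_def)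
  moreover have "m \<noteq> - n"
  proof
    assume mn: "m = - n"
    obtain y where y: "y \<in> interior K" using K(2) by blast
    have "0 < (- n) \<bullet> (y - a)"
      using n y by (intro inner_pos_interior[of K]) (auto simp: outer_unit_normal_def)
    then show False using m y interior_subset[of K] unfolding mn outer_unit_normal_def by (meson not_less subsetD)
  qed
  ultimately show ?thesis by blast
qed

context small_obstacle
begin

section \<open>Interleaving blocks\<close>

lemma admissible_trajectory:
  assumes k0: "k 0 = (0, 0)" and adm: "\<And>s. adm_type s k"
  obtains c \<theta> p where "trajectory_of_type K k c" "\<And>s. chain s k p"
    "continuous_on {0..} \<theta>" "\<And>t. 0 \<le> t \<Longrightarrow> is_Arg (c t - z) (2 * pi * \<theta> t)"
    "\<And>n. \<theta> (chain_length p n) - \<theta> 0 = chain_disp p n"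
    "\<And>a b. 0 \<le> a \<Longrightarrow> a \<le> b \<Longrightarrow> \<bar>\<theta> b - \<theta> a\<bar> \<le> (b - a) / \<rho> + 2"
    "\<And>t. \<exists>n. t < chain_length p n"
proof -
  have ne: "k (Suc n) \<noteq> k n" for n using adm[of "Suc n"] unfolding adm_type_def by blast
  obtain p where p: "\<And>i. p i \<in> ob (k i)" "\<And>i y. y \<in> ob (k i) \<Longrightarrow> 0 \<le> deflection p i \<bullet> (y - p i)"
    using equilibrium_exists[of k] ne by blast
  interpret equilibrium K z r \<rho> k p
    by unfold_locales (use adm p in auto)
  show thesis
  proof (rule angle_function)
    fix \<theta> assume \<theta>: "continuous_on {0..} \<theta>" "\<And>t. 0 \<le> t \<Longrightarrow> is_Arg (wrap (\<Gamma> t) - z) (2 * pi * \<theta> t)"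
      "\<And>n. \<theta> (\<tau> n) - \<theta> 0 = chain_disp p n"
      "\<And>a b. 0 \<le> a \<Longrightarrow> a \<le> b \<Longrightarrow> \<bar>\<theta> b - \<theta> a\<bar> \<le> (b - a) / \<rho> + 2"
    show thesis
    proof (rule that[of "wrap \<circ> \<Gamma>" p \<theta>])
      show "trajectory_of_type K k (wrap \<circ> \<Gamma>)" by (rule trajectory_of_type_\<Gamma>[OF k0])
      show "\<theta> (chain_length p n) - \<theta> 0 = chain_disp p n" for n using \<theta>(3)[of n] by (simp add: \<tau>_def)
      show "\<exists>n. t < chain_length p n" for t using \<tau>_unbounded[of t] by (simp add: \<tau>_def)
      show "is_Arg ((wrap \<circ> \<Gamma>) t - z) (2 * pi * \<theta> t)" if "0 \<le> t" for t using \<theta>(2)[OF that] by simp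
    qed (rule chain_p \<theta>(1) \<theta>(4); assumption?)+
  qed
qed

lemma chain_length_nonneg: "0 \<le> chain_length p n"
  and chain_length_mono: "m \<le> n \<Longrightarrow> chain_length p m \<le> chain_length p n"
  unfolding chain_length_def by (auto intro!: sum_nonneg sum_mono2)

text \<open>A block can be repeated for ever, and the beginning of the resulting trajectory realizes it.\<close>

lemma block_realizes:
  assumes "block w" obtains d T where "realizes w d T"
proof -
  define P where "P m = ((\<lambda>v. v @ w) ^^ m) w" for m
  have blk: "block (P m)" for m
    by (induction m) (simp_all add: P_def assms block_append)
  obtain k where k: "k 0 = (0, 0)" "\<And>s. adm_type s k" "\<And>m n. n \<le> length (P m) \<Longrightarrow> k n = pos (P m) n"
    using limit_of_words[of P "\<lambda>m. w"] blk assms by (auto simp: block_def P_def)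
  obtain p where "\<And>s. chain s k p" using admissible_trajectory[OF k(1,2)] by metis
  moreover have "P 0 = w" by (simp add: P_def)
  ultimately have "chain (length w) (pos w) p" using chain_cong[of "length w" k p "pos w"] k(3)[of _ 0] by simp
  then show thesis using that unfolding realizes_def by blast
qed

definition uniform_bound :: "real \<Rightarrow> bool" where
  "uniform_bound C \<longleftrightarrow> 0 \<le> C \<and>
    (\<forall>w d T d' T'. good_word w \<longrightarrow> realizes w d T \<longrightarrow> realizes w d' T' \<longrightarrow> \<bar>d - d'\<bar> \<le> C \<and> \<bar>T - T'\<bar> \<le> C) \<and>
    (\<forall>l d T. good_step l \<longrightarrow> realizes [l] d T \<longrightarrow> \<bar>d\<bar> \<le> C \<and> \<bar>T\<bar> \<le> C)"

lemma uniform_bound_exists: "\<exists>C. uniform_bound C"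
  using uniform_bounds unfolding uniform_bound_def by metis

text \<open>The defect \<open>d - u * T\<close> of a piece with displacement \<open>d\<close> and length \<open>T\<close> measures how far
  its mean rotation is from \<open>u\<close>, and unlike the mean rotation it is additive.\<close>

lemma realizes_defect:
  assumes C: "uniform_bound C" and w: "good_word w" and "realizes w d T" "realizes w d' T'"
  shows "\<bar>(d - u * T) - (d' - u * T')\<bar> \<le> (1 + \<bar>u\<bar>) * C"
proof -
  have 1: "\<bar>d - d'\<bar> \<le> C" "\<bar>T - T'\<bar> \<le> C" using assms unfolding uniform_bound_def by blast+
  have "\<bar>u * (T - T')\<bar> \<le> \<bar>u\<bar> * C" using 1(2) by (simp add: abs_mult mult_left_mono)
  moreover have "(d - u * T) - (d' - u * T') = (d - d') - u * (T - T')" by (simp add: algebra_simps)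
  ultimately show ?thesis using 1(1) by (simp add: algebra_simps)
qed

lemma step_defect:
  assumes C: "uniform_bound C" and "good_step l" "realizes [l] d T"
  shows "\<bar>d - u * T\<bar> \<le> (1 + \<bar>u\<bar>) * C"
proof -
  have 1: "\<bar>d\<bar> \<le> C" "\<bar>T\<bar> \<le> C" using assms unfolding uniform_bound_def by blast+
  have "\<bar>u * T\<bar> \<le> \<bar>u\<bar> * C" using 1(2) by (simp add: abs_mult mult_left_mono)
  then show ?thesis using 1(1) by (simp add: algebra_simps)
qed

text \<open>Turning a word into a block costs two unit steps, and its defect changes by a bounded
  amount.\<close>

lemma block_of_word:
  assumes C: "uniform_bound C" and w: "good_word w" "w \<noteq> []" "realizes w d T"
  obtains v where "block v" "\<And>d' T'. realizes v d' T' \<Longrightarrow> \<bar>(d' - u * T') - (d - u * T)\<bar> \<le> 3 * ((1 + \<bar>u\<bar>) * C)"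
proof -
  obtain a b where ab: "good_step a" "good_step b" "block ([a] @ w @ [b])" using block_extension[OF w(1,2)] .
  show thesis
  proof (rule that[OF ab(3)])
    fix d' T' assume "realizes ([a] @ w @ [b]) d' T'"
    then obtain d1 T1 d2 T2 where 1: "realizes [a] d1 T1" "realizes (w @ [b]) d2 T2" "d' = d1 + d2" "T' = T1 + T2"
      by (rule realizes_append)
    from 1(2) obtain d3 T3 d4 T4 where 2: "realizes w d3 T3" "realizes [b] d4 T4" "d2 = d3 + d4" "T2 = T3 + T4"
      by (rule realizes_append)
    have "(d' - u * T') - (d - u * T) = (d1 - u * T1) + ((d3 - u * T3) - (d - u * T)) + (d4 - u * T4)"
      unfolding 1(3,4) 2(3,4) by (simp add: algebra_simps)
    then show "\<bar>(d' - u * T') - (d - u * T)\<bar> \<le> 3 * ((1 + \<bar>u\<bar>) * C)"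
      using step_defect[OF C ab(1) 1(1), of u] step_defect[OF C ab(2) 2(2), of u] realizes_defect[OF C w(1) 2(1) w(3), of u]
      by linarith
  qed
qed

lemma rotation_set_words:
  assumes "v \<in> admissible_rotation_set K z" "0 < \<epsilon>"
  obtains w d T where "good_word w" "w \<noteq> []" "realizes w d T" "M \<le> T" "0 < T" "\<bar>d - v * T\<bar> \<le> \<epsilon> * T"
proof -
  obtain d T where dT: "\<And>n. \<exists>s k c. admissible K (enat s) k \<and> piece_of_type K s k (T n) c \<and> has_displacement z c (T n) (d n)"
    "filterlim T at_top sequentially" "(\<lambda>n. d n / T n) \<longlonglongrightarrow> v"
    using assms(1) unfolding admissible_rotation_set_def by blast
  have "eventually (\<lambda>n. max M 1 \<le> T n) sequentially" using dT(2) unfolding filterlim_at_top by blast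
  moreover have "eventually (\<lambda>n. dist (d n / T n) v < \<epsilon>) sequentially" using dT(3) assms(2) by (rule tendstoD)
  ultimately have "eventually (\<lambda>n. max M 1 \<le> T n \<and> dist (d n / T n) v < \<epsilon>) sequentially" by (rule eventually_conj)
  then obtain n where n: "max M 1 \<le> T n" "dist (d n / T n) v < \<epsilon>" unfolding eventually_sequentially by auto
  obtain s k c where "admissible K (enat s) k" "piece_of_type K s k (T n) c" "has_displacement z c (T n) (d n)"
    using dT(1)[of n] by blast
  then obtain p where p: "k 0 = (0, 0)" "adm_type s k" "chain s k p" "T n = chain_length p s" "d n = chain_disp p s"
    by (rule chain_of_piece)
  obtain w where w: "length w = s" "good_word w" "\<And>n. n \<le> s \<Longrightarrow> pos w n = k n"
    using word_of_type[OF p(1,2)] by metis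
  have T: "0 < T n" using n(1) by simp
  show thesis
  proof (rule that[of w "d n" "T n"])
    show "realizes w (d n) (T n)" unfolding realizes_def w(1)
      using chain_cong[OF p(3), of "pos w"] w(3) p(4,5) by auto
    show "w \<noteq> []" using T p(4) w(1) by (auto simp: chain_length_def)
    have "\<bar>d n - v * T n\<bar> = \<bar>d n / T n - v\<bar> * T n" 
    proof -
      have "d n - v * T n = (d n / T n - v) * T n" using T by (simp add: left_diff_distrib)
      then show ?thesis using T by (simp add: abs_mult)
    qed
    also have "\<dots> \<le> \<epsilon> * T n" using n(2) T by (intro mult_right_mono) (auto simp: dist_real_def)
    finally show "\<bar>d n - v * T n\<bar> \<le> \<epsilon> * T n" .
  qed (use n w T in auto)
qed

text \<open>A piece with mean rotation close to \<open>v\<close> has a defect close to \<open>(v - u) * T\<close>, which for a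
  large length \<open>T\<close> outweighs the cost of turning its word into a block.\<close>

lemma block_with_large_defect:
  assumes C: "uniform_bound C" and v: "v \<in> admissible_rotation_set K z" "v \<noteq> u"
  obtains w where "block w" "\<And>d T. realizes w d T \<Longrightarrow> N < sgn (v - u) * (d - u * T)"
proof -
  define D where "D = (1 + \<bar>u\<bar>) * C"
  define \<sigma> where "\<sigma> = sgn (v - u)"
  define e where "e = \<bar>v - u\<bar> / 2"
  have e: "e > 0" using v(2) by (simp add: e_def)
  have \<sigma>: "\<bar>\<sigma> * x\<bar> = \<bar>x\<bar>" "\<sigma> * (v - u) = 2 * e" for x
    using v(2) by (auto simp: \<sigma>_def e_def sgn_if abs_mult)
  obtain w d T where w: "good_word w" "w \<noteq> []" "realizes w d T" "(N + 3 * D + 1) / e \<le> T" "\<bar>d - v * T\<bar> \<le> e * T"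
    using rotation_set_words[OF v(1) e] by metis
  have "N + 3 * D + 1 \<le> e * T" using w(4) e by (simp add: pos_divide_le_eq mult.commute)
  also have "\<dots> \<le> \<sigma> * (d - v * T) + 2 * (e * T)" using w(5) \<sigma>(1)[of "d - v * T"] by linarith
  also have "\<dots> = \<sigma> * (d - v * T) + \<sigma> * (v - u) * T" unfolding \<sigma>(2) by simp
  also have "\<dots> = \<sigma> * (d - u * T)" by (simp add: algebra_simps)
  finally have big: "N + 3 * D + 1 \<le> \<sigma> * (d - u * T)" .
  obtain w' where w': "block w'" "\<And>d' T'. realizes w' d' T' \<Longrightarrow> \<bar>(d' - u * T') - (d - u * T)\<bar> \<le> 3 * D"
    using block_of_word[OF C w(1-3), of u] unfolding D_def by metis
  show thesis
  proof (rule that[OF w'(1)])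
    fix d' T' assume "realizes w' d' T'"
    then have "\<bar>\<sigma> * ((d' - u * T') - (d - u * T))\<bar> \<le> 3 * D" unfolding \<sigma>(1) by (rule w'(2))
    moreover have "\<sigma> * ((d' - u * T') - (d - u * T)) = \<sigma> * (d' - u * T') - \<sigma> * (d - u * T)" by (rule right_diff_distrib)
    ultimately show "N < sgn (v - u) * (d' - u * T')" using big unfolding \<sigma>_def[symmetric] by linarith
  qed
qed

text \<open>Blocks are added one by one, \<open>A\<close> when the defect of the word built so far is nonnegative
  and \<open>B\<close> otherwise. The defects of \<open>A\<close> and \<open>B\<close> outweigh the error \<open>E\<close> of adding up defects, so each
  block moves the total defect towards zero, past it only by a bounded amount.

  The defect of a word is that of a chosen chain for this word only. The choice of the next block thus
  does not refer to the final trajectory, whose beginning depends on the blocks still to come.\<close>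

lemma greedy_concatenation:
  assumes C: "uniform_bound C" and AB: "block A" "block B" and E: "E = 2 * ((1 + \<bar>u\<bar>) * C)"
    and A: "\<And>d T. realizes A d T \<Longrightarrow> d - u * T < - E"
    and B: "\<And>d T. realizes B d T \<Longrightarrow> E < d - u * T"
  obtains P Q S where "\<And>m. block (P m)" "P 0 = A"
    "\<And>m. P (Suc m) = P m @ A \<or> P (Suc m) = P m @ B"
    "\<And>m d T. realizes (P m) d T \<Longrightarrow> \<bar>d - u * T\<bar> \<le> Q"
proof -
  \<comment> \<open>the defect of a chosen chain; any other choice differs from it by at most \<open>E / 2\<close>\<close>
  define f where "f w = (SOME x. \<exists>d T. realizes w d T \<and> x = d - u * T)" for w
  have f: "\<exists>d T. realizes w d T \<and> f w = d - u * T" if "block w" for w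
    unfolding f_def by (rule someI_ex) (use block_realizes[OF that] in blast)
  have fC: "\<bar>(d - u * T) - f w\<bar> \<le> (1 + \<bar>u\<bar>) * C" if w: "block w" "realizes w d T" for w d T
  proof -
    obtain d' T' where "realizes w d' T'" "f w = d' - u * T'" using f[OF w(1)] by blast
    then show ?thesis using realizes_defect[OF C _ w(2), of d' T' u] w(1) by (auto simp: block_def)
  qed
  have add: "\<bar>f (v @ w) - f v - f w\<bar> \<le> E" if vw: "block v" "block w" for v w
  proof -
    obtain d T where dT: "realizes (v @ w) d T" "f (v @ w) = d - u * T" using f[OF block_append[OF vw]] by blast
    from dT(1) obtain d1 T1 d2 T2 where 1: "realizes v d1 T1" "realizes w d2 T2" "d = d1 + d2" "T = T1 + T2"
      by (rule realizes_append)
    have "f (v @ w) - f v - f w = ((d1 - u * T1) - f v) + ((d2 - u * T2) - f w)"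
      unfolding dT(2) 1(3,4) by (simp add: algebra_simps)
    then show ?thesis using fC[OF vw(1) 1(1)] fC[OF vw(2) 1(2)] unfolding E by linarith
  qed
  have fA: "f A < - E" and fB: "E < f B" using f[OF AB(1)] f[OF AB(2)] A B by metis+
  have E0: "0 \<le> E" using C unfolding E uniform_bound_def by simp
  define P where "P = rec_nat A (\<lambda>_ v. v @ (if 0 \<le> f v then A else B))"
  have P: "P 0 = A" "\<And>m. P (Suc m) = P m @ (if 0 \<le> f (P m) then A else B)" by (simp_all add: P_def)
  have blk: "block (P m)" for m
    by (induction m) (simp_all add: P AB block_append)
  have bnd: "\<bar>f (P m)\<bar> \<le> \<bar>f A\<bar> + \<bar>f B\<bar> + E" for m
  proof (induction m)
    case 0
    then show ?case using E0 by (simp add: P)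
  next
    case (Suc m)
    show ?case
    proof (cases "0 \<le> f (P m)")
      case True
      then have "P (Suc m) = P m @ A" using P(2) by simp
      then show ?thesis using add[OF blk[of m] AB(1)] fA Suc True by simp
    next
      case False
      then have "P (Suc m) = P m @ B" using P(2) by simp
      then show ?thesis using add[OF blk[of m] AB(2)] fB Suc False by simp
    qed
  qed
  show thesis
  proof (rule that[of P "\<bar>f A\<bar> + \<bar>f B\<bar> + E + E"])
    show "block (P m)" for m by (rule blk)
    show "P 0 = A" by (rule P(1))
    show "P (Suc m) = P m @ A \<or> P (Suc m) = P m @ B" for m using P(2) by auto
    fix m d T assume "realizes (P m) d T"
    then have "\<bar>(d - u * T) - f (P m)\<bar> \<le> E" using fC[OF blk, of m d T] E E0 by linarith
    then show "\<bar>d - u * T\<bar> \<le> \<bar>f A\<bar> + \<bar>f B\<bar> + E + E" using bnd[of m] by linarith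
  qed
qed

text \<open>Along the trajectory that belongs to the greedy
  concatenation the defect is bounded at the ends of the blocks, hence at all times, since the blocks
  have bounded length. Division by the time gives the rotation number.\<close>

theorem interior_rotation_number:
  assumes u: "u \<in> interior (admissible_rotation_set K z)"
  shows "\<exists>k c. admissible K \<infinity> k \<and> trajectory_of_type K k c \<and> has_rotation_number z c u"
proof -
  obtain C where C: "uniform_bound C" using uniform_bound_exists by blast
  obtain e where e: "e > 0" "cball u e \<subseteq> admissible_rotation_set K z" using u by (auto simp: mem_interior_cball)
  define E where "E = 2 * ((1 + \<bar>u\<bar>) * C)"
  have uu: "u - e \<in> admissible_rotation_set K z" "u + e \<in> admissible_rotation_set K z"
    using e by (auto simp: dist_real_def)
  obtain A where A: "block A" "\<And>d T. realizes A d T \<Longrightarrow> E < sgn (u - e - u) * (d - u * T)"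
    using block_with_large_defect[OF C uu(1), of u E] e(1) by auto
  have A': "d - u * T < - E" if "realizes A d T" for d T using A(2)[OF that] e(1) by (simp add: sgn_if)
  obtain B where B: "block B" "\<And>d T. realizes B d T \<Longrightarrow> E < sgn (u + e - u) * (d - u * T)"
    using block_with_large_defect[OF C uu(2), of u E] e(1) by auto
  have B': "E < d - u * T" if "realizes B d T" for d T using B(2)[OF that] e(1) by (simp add: sgn_if)
  obtain P Q where P: "\<And>m. block (P m)" "P 0 = A" "\<And>m. P (Suc m) = P m @ A \<or> P (Suc m) = P m @ B"
    "\<And>m d T. realizes (P m) d T \<Longrightarrow> \<bar>d - u * T\<bar> \<le> Q"
    using greedy_concatenation[OF C A(1) B(1) E_def] A' B' by metis
  have "\<forall>m. \<exists>b. (b = A \<or> b = B) \<and> P (Suc m) = P m @ b" using P(3) by blast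
  then obtain b where b: "\<And>m. b m = A \<or> b m = B" "\<And>m. P (Suc m) = P m @ b m" by metis
  have bne: "b m \<noteq> []" for m using b(1)[of m] A(1) B(1) by (auto simp: block_def)
  obtain k where k: "k 0 = (0, 0)" "\<And>s. adm_type s k" "\<And>m n. n \<le> length (P m) \<Longrightarrow> k n = pos (P m) n"
  proof (rule limit_of_words[of P b])
    show "good_word (P m)" for m using P(1)[of m] by (simp add: block_def)
  qed (use b(2) bne in blast)+
  show ?thesis
  proof (rule admissible_trajectory[OF k(1,2)])
    fix c \<theta> p assume c: "trajectory_of_type K k c" and p: "\<And>s. chain s k p"
      and \<theta>: "continuous_on {0..} \<theta>" "\<And>t. 0 \<le> t \<Longrightarrow> is_Arg (c t - z) (2 * pi * \<theta> t)"
      "\<And>n. \<theta> (chain_length p n) - \<theta> 0 = chain_disp p n"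
      "\<And>a b. 0 \<le> a \<Longrightarrow> a \<le> b \<Longrightarrow> \<bar>\<theta> b - \<theta> a\<bar> \<le> (b - a) / \<rho> + 2"
      and unb: "\<And>t. \<exists>n. t < chain_length p n"
    define t where "t m = chain_length p (length (P m))" for m
    have real: "realizes (P m) (chain_disp p (length (P m))) (t m)" for m
      unfolding realizes_def t_def using chain_cong[OF p, of "length (P m)" "pos (P m)"] k(3)[of _ m] by blast
    have at: "\<bar>\<theta> (t m) - \<theta> 0 - u * t m\<bar> \<le> Q" for m
      using P(4)[OF real[of m]] \<theta>(3)[of "length (P m)"] by (simp add: t_def)
    obtain dA TA where rA: "realizes A dA TA" using block_realizes[OF A(1)] .
    obtain dB TB where rB: "realizes B dB TB" using block_realizes[OF B(1)] .
    define S where "S = \<bar>TA\<bar> + \<bar>TB\<bar> + 2 * C"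
    have C0: "0 \<le> C" using C by (simp add: uniform_bound_def)
    have TS: "T \<le> S - C" if "realizes A d T \<or> realizes B d T" for d T
    proof -
      have "\<bar>T - TA\<bar> \<le> C \<or> \<bar>T - TB\<bar> \<le> C"
        using C that rA rB A(1) B(1) unfolding uniform_bound_def block_def by blast
      then show ?thesis unfolding S_def by linarith
    qed
    have t0: "t 0 \<le> S" using TS[of _ "t 0"] real[of 0] P(2) C0 by fastforce
    have step: "t (Suc m) - t m \<le> S" for m
    proof -
      obtain d1 T1 d2 T2 where 1: "realizes (P m) d1 T1" "realizes (b m) d2 T2" "t (Suc m) = T1 + T2"
        using real[of "Suc m"] unfolding b(2) by (rule realizes_append)
      have "T1 \<le> t m + C"
        using C 1(1) real[of m] P(1)[of m] unfolding uniform_bound_def block_def by (smt (verit))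
      moreover have "T2 \<le> S - C" using TS 1(2) b(1)[of m] by metis
      ultimately show ?thesis using 1(3) by simp
    qed
    have len: "m \<le> length (P m)" for m
    proof (induction m)
      case (Suc m)
      have "0 < length (b m)" using bne[of m] by blast
      then show ?case using Suc unfolding b(2) length_append by linarith
    qed simp
    have S0: "0 \<le> S" using C0 by (simp add: S_def)
    have near: "\<exists>m. \<bar>x - t m\<bar> \<le> S" if x: "0 \<le> x" for x
    proof -
      obtain n where "x < chain_length p n" using unb by blast
      also have "\<dots> \<le> t n" unfolding t_def by (rule chain_length_mono[OF len])
      finally have ex: "\<exists>m. x < t m" by blast
      define m where "m = (LEAST m. x < t m)"
      have m: "x < t m" unfolding m_def using ex by (rule LeastI_ex)
      show ?thesis
      proof (cases m)
        case 0
        then show ?thesis using m x t0 by (intro exI[of _ 0]) auto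
      next
        case (Suc l)
        then have "\<not> x < t l" using not_less_Least[of l "\<lambda>m. x < t m"] by (simp add: m_def)
        then show ?thesis using m step[of l] Suc by (intro exI[of _ m]) auto
      qed
    qed
    \<comment> \<open>the three terms bound the defect at the nearest end of a block, the displacement since
    then, and the change of \<open>u * x\<close>\<close>
    define R where "R = Q + (S / \<rho> + 2) + \<bar>u\<bar> * S"
    have main: "\<bar>\<theta> x - \<theta> 0 - u * x\<bar> \<le> R" if x: "0 \<le> x" for x
    proof -
      obtain m where m: "\<bar>x - t m\<bar> \<le> S" using near[OF x] by blast
      have tm: "0 \<le> t m" unfolding t_def by (rule chain_length_nonneg)
      have "\<bar>\<theta> x - \<theta> (t m)\<bar> \<le> \<bar>x - t m\<bar> / \<rho> + 2"
        using \<theta>(4)[OF x, of "t m"] \<theta>(4)[OF tm, of x] by (cases "x \<le> t m") (auto simp: abs_minus_commute)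
      also have "\<dots> \<le> S / \<rho> + 2" using m rho_pos by (simp add: divide_right_mono)
      finally have 1: "\<bar>\<theta> x - \<theta> (t m)\<bar> \<le> S / \<rho> + 2" .
      have 2: "\<bar>u * (x - t m)\<bar> \<le> \<bar>u\<bar> * S" using m by (simp add: abs_mult mult_left_mono)
      have "\<theta> x - \<theta> 0 - u * x = (\<theta> (t m) - \<theta> 0 - u * t m) + (\<theta> x - \<theta> (t m)) - u * (x - t m)"
        by (simp add: algebra_simps)
      then show ?thesis using at[of m] 1 2 unfolding R_def by linarith
    qed
    have "((\<lambda>T. (\<theta> T - \<theta> 0) / T) \<longlongrightarrow> u) at_top"
    proof -
      have "((\<lambda>T. (\<theta> T - \<theta> 0) / T - u) \<longlongrightarrow> 0) at_top"
      proof (rule Lim_null_comparison)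
        show "eventually (\<lambda>T. norm ((\<theta> T - \<theta> 0) / T - u) \<le> R / T) at_top"
          using eventually_gt_at_top[of "0::real"]
        proof eventually_elim
          case (elim T)
          have "norm ((\<theta> T - \<theta> 0) / T - u) = \<bar>\<theta> T - \<theta> 0 - u * T\<bar> / T"
          proof -
            have "(\<theta> T - \<theta> 0) / T - u = (\<theta> T - \<theta> 0 - u * T) / T" using elim by (simp add: diff_divide_distrib)
            then show ?thesis using elim by simp
          qed
          also have "\<dots> \<le> R / T" using main[of T] elim by (intro divide_right_mono) auto
          finally show ?case .
        qed
        show "((\<lambda>T. R / T) \<longlongrightarrow> 0) at_top"
          by (intro tendsto_divide_0[OF tendsto_const] filterlim_at_top_imp_at_infinity filterlim_ident)
      qed
      then show ?thesis by (simp add: LIM_zero_iff)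
    qed
    moreover have "has_displacement z c T (\<theta> T - \<theta> 0)" if "0 \<le> T" for T
      unfolding has_displacement_def using \<theta>(2) continuous_on_subset[OF \<theta>(1), of "{0..T}"] by (intro exI[of _ \<theta>]) auto
    ultimately have "has_rotation_number z c u" unfolding has_rotation_number_def by (intro exI[of _ "\<lambda>T. \<theta> T - \<theta> 0"]) auto
    moreover have "admissible K \<infinity> k"
    proof -
      have "k (Suc n) \<noteq> k n \<and> (\<nexists>j. between K j (k n) (k (Suc n))) \<and> \<not> between K (k (Suc n)) (k n) (k (Suc (Suc n)))" for n
        using k(2)[of "Suc (Suc n)"] unfolding adm_type_def by (meson lessI less_SucI)
      then show ?thesis unfolding admissible_def using k(1) by blast
    qed
    ultimately show ?thesis using c by blast
  qed
qed

end

theorem corollary5p5: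
  fixes K :: "complex set" and z :: complex and u :: real
  assumes "obstacle K" and "small K" and "z \<in> interior K"
    and "u \<in> interior (admissible_rotation_set K z)"
  shows "\<exists>k c. admissible K \<infinity> k \<and> trajectory_of_type K k c \<and> has_rotation_number z c u"
proof -
  obtain r where r: "r < sqrt 2 / 4" "K \<subseteq> cball 0 r" using assms(2) unfolding small_def by blast
  obtain \<rho> where \<rho>: "\<rho> > 0" "cball z \<rho> \<subseteq> K" using assms(3) by (auto simp: mem_interior_cball)
  have K: "compact K" "convex K" "smooth_boundary K" "interior K \<noteq> {}"
    using assms(1) unfolding obstacle_def by auto
  interpret small_obstacle K z r \<rho>
  proof
    show "m = n" if "a \<in> frontier K" "outer_unit_normal K a m" "outer_unit_normal K a n" for a m n
      using smooth_boundary_unique_normal[OF K(3) compact_imp_closed[OF K(1)] K(4) that] .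
  qed (fact K r \<rho>)+
  show ?thesis using assms(4) by (rule interior_rotation_number)
qed

end
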